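(* Let $m\ge 1$. The functional $\mathcal F:\mathcal K_m^f(\overline\Omega)\to[0,\infty[$, $\mathcal F(K):=\int_K\varphi(x,\nu_x)\,d\mathcal H^1(x)$, is lower semicontinuous when $\mathcal K_m^f(\overline\Omega)$ is endowed with the Hausdorff metric; that is, if $K_n,K\in\mathcal K_m^f(\overline\Omega)$ and $K_n\to K$ in the Hausdorff metric, then $\int_K\varphi(x,\nu_x)\,d\mathcal H^1(x)\le\liminf_n\int_{K_n}\varphi(x,\nu_x)\,d\mathcal H^1(x)$.
   Context: $\Omega\subseteq\mathbb R^2$ is a bounded open set with Lipschitz boundary. $\mathcal K(\overline\Omega)$ is the set of all compact subsets of $\overline\Omega$, endowed with the Hausdorff metric $d_H(K_1,K_2)=\max\{\sup_{x\in K_1}\mathrm{dist}(x,K_2),\sup_{y\in K_2}\mathrm{dist}(y,K_1)\}$, with the conventions $\mathrm{dist}(x,\emptyset)=\mathrm{diam}(\Omega)$ and $\sup\emptyset=0$. $\mathcal K_m^f(\overline\Omega)$ is the set of $K\in\mathcal K(\overline\Omega)$ having at most $m$ connected components and $\mathcal H^1(K)<\infty$, where $\mathcal H^1$ is the one-dimensional Hausdorff measure. For $K\in\mathcal K_m^f(\overline\Omega)$, at $\mathcal H^1$-a.e. $x\in K$ there is an approximate unit normal $\nu_x$, determined up to sign and characterized by: with $D_\lambda(\xi)=\frac1\lambda(\xi-x)$, $\mathcal H^1\llcorner D_\lambda(K)\rightharpoonup\mathcal H^1\llcorner T_{\nu_x}$ locally weakly star in the sense of measures as $\lambda\to0^+$,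 where $T_{\nu_x}$ is the line through the origin orthogonal to $\nu_x$; the map $x\mapsto\nu_x$ is Borel measurable. $\varphi:\overline\Omega\times\mathbb R^2\to[0,+\infty[$ is continuous, and positively $1$-homogeneous, even and convex in the second variable, and there are $c_1,c_2>0$ with $c_1|\nu|\le\varphi(x,\nu)\le c_2|\nu|$ for all $(x,\nu)\in\overline\Omega\times\mathbb R^2$. *)

theory Defs
  imports "HOL-Analysis.Analysis"
begin

subsection \<open>One-dimensional Hausdorff measure\<close>

text \<open>
  For dimension one the normalising constant of the Hausdorff measure is 1, so the
  weight of a covering set is its diameter. The restriction to bounded sets is needed since
  \<^const>\<open>diameter\<close> is unspecified on unbounded ones.
\<close>

definition hausdorff1_pre :: "real \<Rightarrow> 'a::metric_space set \<Rightarrow> ennreal" where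
  "hausdorff1_pre \<delta> A =
    (INF C\<in>{C :: nat \<Rightarrow> 'a set. A \<subseteq> (\<Union>i. C i) \<and> (\<forall>i. bounded (C i) \<and> diameter (C i) \<le> \<delta>)}.
       \<Sum>i. ennreal (diameter (C i)))"

definition hausdorff1_outer :: "'a::metric_space set \<Rightarrow> ennreal" where
  "hausdorff1_outer A = (SUP \<delta>\<in>{0<..}. hausdorff1_pre \<delta> A)"

definition hausdorff1 :: "'a::metric_space measure" where
  "hausdorff1 = measure_of UNIV (sets borel) hausdorff1_outer"

text \<open>
  Since \<^const>\<open>measure_of\<close> yields the zero measure when its argument is not countably
  additive, we check that it does not do so here (Caratheodory's criterion for metric outer measures).
\<close>

lemma hausdorff1_outer_mono: "A \<subseteq> B \<Longrightarrow> hausdorff1_outer A \<le> hausdorff1_outer B"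
  unfolding hausdorff1_outer_def hausdorff1_pre_def
  by (rule SUP_mono') (rule INF_superset_mono, auto)

lemma hausdorff1_pre_antimono: "\<delta> \<le> \<delta>' \<Longrightarrow> hausdorff1_pre \<delta>' A \<le> hausdorff1_pre \<delta> A"
  unfolding hausdorff1_pre_def by (intro INF_superset_mono) (auto intro: order_trans)

lemma hausdorff1_outer_empty [simp]: "hausdorff1_outer {} = 0"
proof -
  have "hausdorff1_pre \<delta> ({} :: 'a set) = 0" if "\<delta> > 0" for \<delta>
  proof -
    have "hausdorff1_pre \<delta> ({}::'a set) \<le> (\<Sum>i::nat. ennreal (diameter ({}::'a set)))"
      unfolding hausdorff1_pre_def
      by (rule INF_lower[where i = "\<lambda>_. {}"]) (use that in auto)
    then show ?thesis by simp
  qed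
  then show ?thesis by (simp add: hausdorff1_outer_def)
qed

lemma hausdorff1_pre_eq_outer_measure:
  fixes A :: "'a::metric_space set"
  assumes "\<delta> > 0"
  defines "w \<equiv> (\<lambda>B :: 'a set. if bounded B \<and> diameter B \<le> \<delta> then ennreal (diameter B) else top)"
  shows "hausdorff1_pre \<delta> A = outer_measure (Pow UNIV) w A"
    and "positive (Pow UNIV) w" and "increasing (Pow UNIV) w"
proof -
  interpret ring_of_sets UNIV "Pow UNIV :: 'a set set" by (rule ring_of_sets_Pow)
  show pos: "positive (Pow UNIV) w" using assms by (simp add: positive_def)
  show inc: "increasing (Pow UNIV) w"
    unfolding increasing_def w_def
    by (auto intro!: ennreal_leI diameter_subset intro: bounded_subset)
       (meson diameter_subset order_trans)
  show "hausdorff1_pre \<delta> A = outer_measure (Pow UNIV) w A"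
  proof (rule antisym)
    show "hausdorff1_pre \<delta> A \<le> outer_measure (Pow UNIV) w A"
      unfolding outer_measure_def
    proof (rule INF_greatest)
      fix B :: "nat \<Rightarrow> 'a set"
      assume B: "B \<in> {B. range B \<subseteq> Pow UNIV \<and> disjoint_family B \<and> A \<subseteq> (\<Union>i. B i)}"
      show "hausdorff1_pre \<delta> A \<le> (\<Sum>i. w (B i))"
      proof (cases "\<forall>i. bounded (B i) \<and> diameter (B i) \<le> \<delta>")
        case True
        then have "(\<Sum>i. w (B i)) = (\<Sum>i. ennreal (diameter (B i)))" by (simp add: w_def)
        moreover have "hausdorff1_pre \<delta> A \<le> (\<Sum>i. ennreal (diameter (B i)))"
          unfolding hausdorff1_pre_def by (rule INF_lower) (use B True in auto)
        ultimately show ?thesis by simp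
      next
        case False
        then have "\<exists>i. w (B i) = top" by (auto simp: w_def)
        then obtain i where i: "w (B i) = top" ..
        have "w (B i) \<le> (\<Sum>i. w (B i))"
          using sum_le_suminf[of "\<lambda>i. w (B i)" "{i}"] by simp
        then show ?thesis using i by (simp add: top_unique)
      qed
    qed
    show "outer_measure (Pow UNIV) w A \<le> hausdorff1_pre \<delta> A"
      unfolding hausdorff1_pre_def
    proof (rule INF_greatest)
      fix C :: "nat \<Rightarrow> 'a set"
      assume C: "C \<in> {C. A \<subseteq> (\<Union>i. C i) \<and> (\<forall>i. bounded (C i) \<and> diameter (C i) \<le> \<delta>)}"
      then have "outer_measure (Pow UNIV) w A \<le> (\<Sum>i. w (C i))"
        by (intro outer_measure_le pos inc) auto
      also have "\<dots> = (\<Sum>i. ennreal (diameter (C i)))" using C by (simp add: w_def)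
      finally show "outer_measure (Pow UNIV) w A \<le> (\<Sum>i. ennreal (diameter (C i)))" .
    qed
  qed
qed

lemma hausdorff1_outer_UN:
  fixes A :: "nat \<Rightarrow> 'a::metric_space set"
  shows "hausdorff1_outer (\<Union>i. A i) \<le> (\<Sum>i. hausdorff1_outer (A i))"
proof -
  interpret ring_of_sets UNIV "Pow UNIV :: 'a set set" by (rule ring_of_sets_Pow)
  have "hausdorff1_pre \<delta> (\<Union>i. A i) \<le> (\<Sum>i. hausdorff1_outer (A i))" if "\<delta> > 0" for \<delta>
  proof -
    define w where "w = (\<lambda>B :: 'a set. if bounded B \<and> diameter B \<le> \<delta> then ennreal (diameter B) else top)"
    have eq: "hausdorff1_pre \<delta> X = outer_measure (Pow UNIV) w X" for X
      unfolding w_def by (rule hausdorff1_pre_eq_outer_measure(1)[OF that])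
    have "countably_subadditive (Pow UNIV) (outer_measure (Pow UNIV) w)"
      unfolding w_def
      by (rule countably_subadditive_outer_measure[OF hausdorff1_pre_eq_outer_measure(2,3)[OF that]])
    then have "outer_measure (Pow UNIV) w (\<Union>i. disjointed A i)
        \<le> (\<Sum>i. outer_measure (Pow UNIV) w (disjointed A i))"
      by (simp add: countably_subadditive_def disjoint_family_disjointed del: UN_disjointed_eq)
    also have "\<dots> \<le> (\<Sum>i. outer_measure (Pow UNIV) w (A i))"
      by (intro suminf_le increasingD[OF increasing_outer_measure] disjointed_subset) auto
    finally have "hausdorff1_pre \<delta> (\<Union>i. A i) \<le> (\<Sum>i. hausdorff1_pre \<delta> (A i))"
      unfolding eq UN_disjointed_eq .
    also have "\<dots> \<le> (\<Sum>i. hausdorff1_outer (A i))"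
      unfolding hausdorff1_outer_def using that by (intro suminf_le SUP_upper) auto
    finally show ?thesis .
  qed
  then show ?thesis
    unfolding hausdorff1_outer_def[of "\<Union>i. A i"] by (intro SUP_least) auto
qed

lemma hausdorff1_outer_space: "outer_measure_space (Pow UNIV) hausdorff1_outer"
  by (simp add: outer_measure_space_def positive_def increasing_def countably_subadditive_def
      hausdorff1_outer_mono hausdorff1_outer_UN)

lemma hausdorff1_outer_Un: "hausdorff1_outer (A \<union> B) \<le> hausdorff1_outer A + hausdorff1_outer B"
proof -
  have eq: "(\<Union>i. (if i = 0 then A else if i = Suc 0 then B else {})) = A \<union> B"
    by (auto split: if_splits)
  have "hausdorff1_outer (A \<union> B)
      \<le> (\<Sum>i. hausdorff1_outer (if i = 0 then A else if i = Suc 0 then B else {}))"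
    using hausdorff1_outer_UN[of "\<lambda>i. if i = 0 then A else if i = Suc 0 then B else {}"]
    unfolding eq .
  also have "\<dots> = (\<Sum>i\<in>{0, Suc 0}. hausdorff1_outer (if i = 0 then A else if i = Suc 0 then B else {}))"
    by (rule suminf_finite) auto
  finally show ?thesis by simp
qed

lemma hausdorff1_outer_separated:
  fixes A B :: "'a::metric_space set"
  assumes "r > 0" and sep: "\<And>x y. x \<in> A \<Longrightarrow> y \<in> B \<Longrightarrow> r \<le> dist x y"
  shows "hausdorff1_outer A + hausdorff1_outer B \<le> hausdorff1_outer (A \<union> B)"
proof -
  have pre: "hausdorff1_pre \<delta> A + hausdorff1_pre \<delta> B \<le> hausdorff1_pre \<delta> (A \<union> B)"
    if \<delta>: "\<delta> > 0" "\<delta> < r" for \<delta>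
    unfolding hausdorff1_pre_def[of _ "A \<union> B"]
  proof (rule INF_greatest)
    fix C :: "nat \<Rightarrow> 'a set"
    assume "C \<in> {C. A \<union> B \<subseteq> (\<Union>i. C i) \<and> (\<forall>i. bounded (C i) \<and> diameter (C i) \<le> \<delta>)}"
    then have cov: "A \<subseteq> (\<Union>i. C i)" "B \<subseteq> (\<Union>i. C i)"
      and bd: "\<And>i. bounded (C i)" and dm: "\<And>i. diameter (C i) \<le> \<delta>" by auto
    define C1 where "C1 = (\<lambda>i. if C i \<inter> A = {} then {} else C i)"
    define C2 where "C2 = (\<lambda>i. if C i \<inter> A = {} then C i else {})"
    have disj: "C i \<inter> A = {} \<or> C i \<inter> B = {}" for i
    proof (rule ccontr)
      assume "\<not> ?thesis"
      then obtain x y where "x \<in> C i" "x \<in> A" "y \<in> C i" "y \<in> B" by auto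
      with sep[of x y] diameter_bounded_bound[OF bd[of i], of x y] dm[of i] \<delta>
      show False by auto
    qed
    have c12: "A \<subseteq> (\<Union>i. C1 i)" "B \<subseteq> (\<Union>i. C2 i)"
    proof safe
      fix x assume "x \<in> A"
      with cov obtain i where "x \<in> C i" by auto
      with \<open>x \<in> A\<close> have "x \<in> C1 i" by (auto simp: C1_def)
      then show "x \<in> (\<Union>i. C1 i)" by blast
    next
      fix x assume "x \<in> B"
      with cov obtain i where "x \<in> C i" by auto
      with \<open>x \<in> B\<close> disj[of i] have "x \<in> C2 i" by (auto simp: C2_def)
      then show "x \<in> (\<Union>i. C2 i)" by blast
    qed
    have "hausdorff1_pre \<delta> A \<le> (\<Sum>i. ennreal (diameter (C1 i)))"
      unfolding hausdorff1_pre_def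
      by (rule INF_lower) (use c12 bd dm \<delta> in \<open>auto simp: C1_def\<close>)
    moreover have "hausdorff1_pre \<delta> B \<le> (\<Sum>i. ennreal (diameter (C2 i)))"
      unfolding hausdorff1_pre_def
      by (rule INF_lower) (use c12 bd dm \<delta> in \<open>auto simp: C2_def\<close>)
    ultimately have "hausdorff1_pre \<delta> A + hausdorff1_pre \<delta> B
        \<le> (\<Sum>i. ennreal (diameter (C1 i))) + (\<Sum>i. ennreal (diameter (C2 i)))"
      by (rule add_mono)
    also have "\<dots> = (\<Sum>i. ennreal (diameter (C1 i)) + ennreal (diameter (C2 i)))"
      by (rule suminf_add) auto
    also have "\<dots> = (\<Sum>i. ennreal (diameter (C i)))"
      by (rule suminf_cong) (auto simp: C1_def C2_def)
    finally show "hausdorff1_pre \<delta> A + hausdorff1_pre \<delta> B \<le> (\<Sum>i. ennreal (diameter (C i)))" .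
  qed
  have "hausdorff1_pre \<delta> A + hausdorff1_pre \<delta>' B \<le> hausdorff1_outer (A \<union> B)"
    if "\<delta> > 0" "\<delta>' > 0" for \<delta> \<delta>'
  proof -
    define \<epsilon> where "\<epsilon> = min (min \<delta> \<delta>') (r / 2)"
    have \<epsilon>: "\<epsilon> > 0" "\<epsilon> < r" "\<epsilon> \<le> \<delta>" "\<epsilon> \<le> \<delta>'" using that \<open>r > 0\<close> by (auto simp: \<epsilon>_def)
    have "hausdorff1_pre \<delta> A + hausdorff1_pre \<delta>' B \<le> hausdorff1_pre \<epsilon> A + hausdorff1_pre \<epsilon> B"
      using \<epsilon> by (intro add_mono hausdorff1_pre_antimono) auto
    also have "\<dots> \<le> hausdorff1_pre \<epsilon> (A \<union> B)" using \<epsilon> by (intro pre) auto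
    also have "\<dots> \<le> hausdorff1_outer (A \<union> B)"
      unfolding hausdorff1_outer_def using \<epsilon> by (intro SUP_upper) auto
    finally show ?thesis .
  qed
  then have "hausdorff1_pre \<delta> A + hausdorff1_outer B \<le> hausdorff1_outer (A \<union> B)" if "\<delta> > 0" for \<delta>
    unfolding hausdorff1_outer_def[of B] using that
    by (subst ennreal_SUP_add_right) (auto intro!: SUP_least)
  then show ?thesis
    unfolding hausdorff1_outer_def[of A]
    by (subst ennreal_SUP_add_left[symmetric]) (auto intro!: SUP_least)
qed

lemma closed_caratheodory_hausdorff1:
  fixes A F :: "'a::metric_space set"
  assumes "closed F"
  shows "hausdorff1_outer (A \<inter> F) + hausdorff1_outer (A - F) \<le> hausdorff1_outer A"
proof (cases "F = {} \<or> hausdorff1_outer A = top")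
  case True
  then show ?thesis by auto
next
  case False
  then have F: "F \<noteq> {}" and fin: "hausdorff1_outer A < top" by (auto simp: less_top)
  let ?h = "hausdorff1_outer :: 'a set \<Rightarrow> ennreal"
  define S where "S n = {x\<in>A. inverse (real (Suc n)) \<le> infdist x F}" for n
  define R where "R n = S (Suc n) - S n" for n
  have near: "infdist x F \<le> infdist y F + dist x y" for x y by (rule infdist_triangle)
  have S_le: "?h (A \<inter> F) + ?h (S n) \<le> ?h A" for n
  proof -
    have "?h (A \<inter> F) + ?h (S n) \<le> ?h ((A \<inter> F) \<union> S n)"
    proof (rule hausdorff1_outer_separated)
      show "inverse (real (Suc n)) > 0" by simp
      fix x y assume "x \<in> A \<inter> F" "y \<in> S n"
      then show "inverse (real (Suc n)) \<le> dist x y"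
        using near[of y x] by (auto simp: S_def dist_commute)
    qed
    also have "\<dots> \<le> ?h A" by (rule hausdorff1_outer_mono) (auto simp: S_def)
    finally show ?thesis .
  qed
  have alt: "(\<Sum>k<N. ?h (R (2 * k + p))) \<le> ?h (\<Union>k<N. R (2 * k + p))" for N p
  proof (induction N)
    case (Suc N)
    have "(\<Sum>k<Suc N. ?h (R (2 * k + p))) \<le> ?h (\<Union>k<N. R (2 * k + p)) + ?h (R (2 * N + p))"
      using Suc by (simp add: add_right_mono)
    also have "\<dots> \<le> ?h ((\<Union>k<N. R (2 * k + p)) \<union> R (2 * N + p))"
    proof (cases "N = 0")
      case False
      let ?a = "inverse (real (2 * N + p))" and ?b = "inverse (real (Suc (2 * N + p)))"
      show ?thesis
      proof (rule hausdorff1_outer_separated)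
        show "?a - ?b > 0" using False by simp
        fix x y assume x: "x \<in> (\<Union>k<N. R (2 * k + p))" and y: "y \<in> R (2 * N + p)"
        from x obtain k where k: "k < N" "x \<in> R (2 * k + p)" by auto
        then have "?a \<le> inverse (real (Suc (Suc (2 * k + p))))"
          by (intro le_imp_inverse_le) auto
        also have "\<dots> \<le> infdist x F" using k by (auto simp: R_def S_def)
        finally have "?a \<le> infdist x F" .
        moreover have "infdist y F < ?b" using y by (auto simp: R_def S_def)
        ultimately show "?a - ?b \<le> dist x y" using near[of x y] by linarith
      qed
    qed simp
    also have "(\<Union>k<N. R (2 * k + p)) \<union> R (2 * N + p) = (\<Union>k<Suc N. R (2 * k + p))"
      by (auto simp: less_Suc_eq)
    finally show ?case .
  qed simp
  have alt': "(\<Sum>k<N. ?h (R (2 * k + p))) \<le> ?h A" for N p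
    by (rule order_trans[OF alt hausdorff1_outer_mono]) (auto simp: R_def S_def)
  have split: "(\<Sum>k<2 * N. ?h (R k)) = (\<Sum>k<N. ?h (R (2 * k + 0))) + (\<Sum>k<N. ?h (R (2 * k + 1)))" for N
    by (induction N) (auto simp: algebra_simps)
  have "(\<Sum>k<N. ?h (R k)) \<le> ?h A + ?h A" for N
  proof -
    have "(\<Sum>k<N. ?h (R k)) \<le> (\<Sum>k<2 * N. ?h (R k))" by (rule sum_mono2) auto
    also have "\<dots> \<le> ?h A + ?h A" unfolding split by (intro add_mono alt')
    finally show ?thesis .
  qed
  then have "(\<Sum>k. ?h (R k)) \<le> ?h A + ?h A"
    unfolding suminf_eq_SUP by (rule SUP_least)
  also have "\<dots> < top" using fin by simp
  finally have tot: "(\<Sum>k. ?h (R k)) < top" .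
  have cover: "A - F \<subseteq> S n \<union> (\<Union>k. R (k + n))" for n
  proof
    fix x assume x: "x \<in> A - F"
    then have "infdist x F > 0"
      using in_closed_iff_infdist_zero[OF \<open>closed F\<close> F] infdist_nonneg[of x F] by auto
    then obtain j where "inverse (real (Suc j)) < infdist x F" using reals_Archimedean by blast
    with x have j: "x \<in> S j" by (auto simp: S_def)
    show "x \<in> S n \<union> (\<Union>k. R (k + n))"
    proof (cases "x \<in> S n")
      case False
      define l where "l = (LEAST l. x \<in> S (l + n))"
      have "S j \<subseteq> S (j + n)"
      proof -
        have "inverse (real (Suc (j + n))) \<le> inverse (real (Suc j))"
          by (rule le_imp_inverse_le) auto
        then show ?thesis
          unfolding S_def by (blast intro: order_trans)
      qed
      with j have "\<exists>l. x \<in> S (l + n)" by blast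
      then have "x \<in> S (l + n)" unfolding l_def by (rule LeastI_ex)
      moreover from this False obtain l' where l': "l = Suc l'" by (cases l) auto
      moreover have "x \<notin> S (l' + n)"
        using not_less_Least[of l' "\<lambda>l. x \<in> S (l + n)"] l' unfolding l_def by auto
      ultimately have "x \<in> R (l' + n)" by (auto simp: R_def)
      then show ?thesis by blast
    qed simp
  qed
  show ?thesis
  proof (rule ennreal_le_epsilon)
    fix e :: real assume "0 < e"
    have "\<exists>n. (\<Sum>k. ?h (R (k + n))) \<le> ennreal e"
    proof -
      define f where "f k = enn2real (?h (R k))" for k
      have hf: "?h (R k) = ennreal (f k)" for k
      proof -
        have "?h (R k) \<le> (\<Sum>k. ?h (R k))"
          using sum_le_suminf[of "\<lambda>k. ?h (R k)" "{k}"] by simp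
        with tot have "?h (R k) < top" by (rule le_less_trans[rotated])
        then show ?thesis by (simp add: f_def)
      qed
      have f0: "f k \<ge> 0" for k by (simp add: f_def)
      have "summable f" using tot f0 by (intro summable_suminf_not_top) (auto simp: hf)
      then obtain n where "\<And>m. m \<ge> n \<Longrightarrow> norm (\<Sum>i. f (i + m)) < e"
        using suminf_exist_split[OF \<open>0 < e\<close>] by blast
      then have "norm (\<Sum>i. f (i + n)) < e" by blast
      moreover have "(\<Sum>k. ?h (R (k + n))) = ennreal (\<Sum>i. f (i + n))"
        unfolding hf using f0 \<open>summable f\<close>
        by (intro suminf_ennreal2) (auto simp: summable_iff_shift)
      ultimately show ?thesis by (auto intro!: exI[of _ n] ennreal_leI)
    qed
    then obtain n where n: "(\<Sum>k. ?h (R (k + n))) \<le> ennreal e" ..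
    have "?h (A - F) \<le> ?h (S n) + ?h (\<Union>k. R (k + n))"
      using hausdorff1_outer_mono[OF cover] hausdorff1_outer_Un order_trans by blast
    also have "\<dots> \<le> ?h (S n) + ennreal e"
      using hausdorff1_outer_UN[of "\<lambda>k. R (k + n)"] n by (intro add_left_mono) (rule order_trans)
    finally have "?h (A \<inter> F) + ?h (A - F) \<le> (?h (A \<inter> F) + ?h (S n)) + ennreal e"
      by (simp add: add.assoc add_left_mono)
    also have "\<dots> \<le> ?h A + ennreal e" by (intro add_right_mono S_le)
    finally show "?h (A \<inter> F) + ?h (A - F) \<le> ?h A + ennreal e" .
  qed
qed

lemma measure_space_hausdorff1:
  "measure_space UNIV (sets borel) (hausdorff1_outer :: 'a::metric_space set \<Rightarrow> ennreal)"
proof -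
  interpret P: sigma_algebra UNIV "Pow UNIV :: 'a set set" by (rule sigma_algebra_Pow)
  let ?L = "lambda_system UNIV (Pow UNIV) (hausdorff1_outer :: 'a set \<Rightarrow> ennreal)"
  have L: "measure_space UNIV ?L (hausdorff1_outer :: 'a set \<Rightarrow> ennreal)"
    by (rule P.caratheodory_lemma[OF hausdorff1_outer_space])
  then interpret L: sigma_algebra UNIV ?L by (simp add: measure_space_def)
  have "F \<in> ?L" if "closed F" for F :: "'a set"
  proof -
    have "hausdorff1_outer (A \<inter> F) + hausdorff1_outer (A - F) = hausdorff1_outer A" for A
    proof (rule antisym[OF closed_caratheodory_hausdorff1[OF that]])
      have "A = (A \<inter> F) \<union> (A - F)" by auto
      then show "hausdorff1_outer A \<le> hausdorff1_outer (A \<inter> F) + hausdorff1_outer (A - F)"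
        using hausdorff1_outer_Un[of "A \<inter> F" "A - F"] by simp
    qed
    then show ?thesis by (subst P.lambda_system_eq) simp
  qed
  then have "sigma_sets UNIV (Collect closed) \<subseteq> ?L" by (intro L.sigma_sets_subset) auto
  then have sub: "sets (borel :: 'a measure) \<subseteq> ?L" by (simp add: borel_eq_closed)
  have "positive ?L hausdorff1_outer" "countably_additive ?L hausdorff1_outer"
    using L by (auto simp: measure_space_def)
  with sub have "positive (sets (borel :: 'a measure)) hausdorff1_outer"
    "countably_additive (sets (borel :: 'a measure)) hausdorff1_outer"
    by (auto simp: positive_def countably_additive_def)
  then show ?thesis
    using sets.sigma_algebra_axioms[of "borel :: 'a measure"] by (simp add: measure_space_def)
qed

lemma space_hausdorff1 [simp]: "space hausdorff1 = UNIV"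
  by (simp add: hausdorff1_def)

lemma sets_hausdorff1 [simp, measurable_cong]: "sets hausdorff1 = sets borel"
  using sets.sigma_sets_eq[of borel] by (simp add: hausdorff1_def)

lemma emeasure_hausdorff1: "A \<in> sets borel \<Longrightarrow> emeasure hausdorff1 A = hausdorff1_outer A"
  using measure_space_hausdorff1 unfolding hausdorff1_def measure_space_def
  by (intro emeasure_measure_of_sigma) auto

subsection \<open>Domains, the space of compact sets and its Hausdorff metric\<close>

text \<open>
  Near each boundary point, after a rigid change of coordinates with axes \<open>e\<close> and \<open>n\<close>, the
  set is the part of a ball lying strictly below the graph of a Lipschitz function.
\<close>

definition lipschitz_boundary :: "(real^2) set \<Rightarrow> bool" where
  "lipschitz_boundary \<Omega> \<longleftrightarrow>
    (\<forall>p\<in>frontier \<Omega>. \<exists>r>0. \<exists>e n :: real^2. \<exists>(g :: real \<Rightarrow> real) L.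
       norm e = 1 \<and> norm n = 1 \<and> e \<bullet> n = 0 \<and> L-lipschitz_on UNIV g \<and>
       \<Omega> \<inter> ball p r = {y \<in> ball p r. (y - p) \<bullet> n < g ((y - p) \<bullet> e)})"

text \<open>
  The conventions \<open>dist(x,\<emptyset>) = diam(\<Omega>)\<close> and \<open>sup \<emptyset> = 0\<close> differ from those of
  \<^const>\<open>infdist\<close> and of the (unspecified) supremum of the empty set of reals.
\<close>

definition dist_set :: "(real^2) set \<Rightarrow> real^2 \<Rightarrow> (real^2) set \<Rightarrow> real" where
  "dist_set \<Omega> x K = (if K = {} then diameter \<Omega> else infdist x K)"

definition excess :: "(real^2) set \<Rightarrow> (real^2) set \<Rightarrow> (real^2) set \<Rightarrow> real" where
  "excess \<Omega> K1 K2 = (if K1 = {} then 0 else SUP x\<in>K1. dist_set \<Omega> x K2)"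

definition hausdorff_dist :: "(real^2) set \<Rightarrow> (real^2) set \<Rightarrow> (real^2) set \<Rightarrow> real" where
  "hausdorff_dist \<Omega> K1 K2 = max (excess \<Omega> K1 K2) (excess \<Omega> K2 K1)"

definition Kmf :: "nat \<Rightarrow> (real^2) set \<Rightarrow> (real^2) set set" where
  "Kmf m \<Omega> = {K. compact K \<and> K \<subseteq> closure \<Omega> \<and>
     finite (components K) \<and> card (components K) \<le> m \<and> emeasure hausdorff1 K < \<infinity>}"

subsection \<open>Approximate normals and the functional\<close>

definition measure_restr :: "'a measure \<Rightarrow> 'a set \<Rightarrow> 'a measure" where
  "measure_restr M A = density M (indicator A)"

definition loc_weak_star :: "('b \<Rightarrow> (real^2) measure) \<Rightarrow> (real^2) measure \<Rightarrow> 'b filter \<Rightarrow> bool" where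
  "loc_weak_star M N F \<longleftrightarrow>
    (\<forall>g :: real^2 \<Rightarrow> real. continuous_on UNIV g \<longrightarrow> compact (closure {y. g y \<noteq> 0}) \<longrightarrow>
       ((\<lambda>\<rho>. integral\<^sup>L (M \<rho>) g) \<longlongrightarrow> integral\<^sup>L N g) F)"

definition blow_up :: "real^2 \<Rightarrow> real \<Rightarrow> real^2 \<Rightarrow> real^2" where
  "blow_up x \<rho> \<xi> = (1 / \<rho>) *\<^sub>R (\<xi> - x)"

definition approx_normal :: "(real^2) set \<Rightarrow> real^2 \<Rightarrow> real^2 \<Rightarrow> bool" where
  "approx_normal K x \<nu> \<longleftrightarrow> norm \<nu> = 1 \<and>
     loc_weak_star (\<lambda>\<rho>. measure_restr hausdorff1 (blow_up x \<rho> ` K))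
       (measure_restr hausdorff1 {y. y \<bullet> \<nu> = 0}) (at_right 0)"

text \<open>
  The choice fixes one of the two normals \<open>\<nu>\<close> and \<open>-\<nu>\<close>; the sign is irrelevant below as
  \<open>\<phi>\<close> is even. For \<open>K\<close> in \<^const>\<open>Kmf\<close> a normal exists at almost every point of \<open>K\<close>. No
  measurability of the chosen representative is needed: on functions that agree almost everywhere
  the upward integral \<^const>\<open>nn_integral\<close> takes the same value, and the chosen integrand agrees
  almost everywhere with the one built from a Borel field of normals.
\<close>

definition normal_at :: "(real^2) set \<Rightarrow> real^2 \<Rightarrow> real^2" where
  "normal_at K x = (SOME \<nu>. approx_normal K x \<nu>)"

definition surface_energy :: "(real^2 \<Rightarrow> real^2 \<Rightarrow> real) \<Rightarrow> (real^2) set \<Rightarrow> ennreal" where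
  "surface_energy \<phi> K = (\<integral>\<^sup>+ x\<in>K. ennreal (\<phi> x (normal_at K x)) \<partial>hausdorff1)"

end

theory Submission
  imports Defs
begin

text \<open>
  Where \<open>K\<close> has the normal \<open>\<nu>\<close> at \<open>x\<close>, write \<open>\<phi> x v \<ge> \<bar>p \<bullet> v\<bar>\<close> with equality at \<open>\<nu>\<close>. The
  integral of \<open>\<bar>p \<bullet> v\<bar>\<close> over a part of \<open>Kn n\<close> bounds the length of its projection along \<open>p\<close>, and
  in a small ball around \<open>x\<close> that projection is almost as long as the one of the tangent line:
  \<open>Kn n\<close> is close to the line, and each gap of macroscopic size costs a component, of which there
  are at most \<open>m\<close>. A Vitali covering by such balls globalises the estimate.

  Approximate normals exist almost everywhere because a continuum of finite length is the image of a
  Lipschitz curve (a limit of walks through spanning trees of finite nets), and at a point where the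
  curve has a nonzero velocity and the upper density is at most 1 the curve carries almost all the mass.
\<close>

subsection \<open>One-dimensional Hausdorff measure\<close>

text \<open>The projection is \<open>y \<bullet> w\<close> with \<open>w = rot p\<close>:
  \<open>rot\<close> is an isometry, so
  \<open>\<bar>rot v \<bullet> w\<bar> = \<bar>p \<bullet> v\<bar>\<close>, and a segment in the
  tangent direction \<open>rot \<nu>\<close> is scaled by the factor
  \<open>p \<bullet> \<nu> = \<phi> x \<nu>\<close>. The balls depend on the limit set alone.
  Centres, radii and covering are fixed before \<open>n\<close> tends to infinity, so only finitely
  many local inequalities have to hold eventually. In each of them every error, the lost gaps
  included, is a small multiple of the radius \<open>r\<close>, and it is absorbed because the ball
  carries at least the length \<open>r\<close> of \<open>K\<close>. Two obstacles shape the rest.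
  First, \<open>normal_at\<close> is an arbitrary choice without known measurability; integrals
  therefore go through Borel functions that agree almost everywhere with the integrand and arise as
  limits of blow-up integrals. Second, weak convergence of blow-ups controls mass only; the lower
  density bound, a consequence of connectedness, turns it into closeness in distance.\<close>

lemma hausdorff1_pre_le:
  assumes "A \<subseteq> (\<Union>i. C i)" "\<And>i. bounded (C i)" "\<And>i. diameter (C i) \<le> \<delta>"
  shows "hausdorff1_pre \<delta> A \<le> (\<Sum>i::nat. ennreal (diameter (C i)))"
  unfolding hausdorff1_pre_def by (rule INF_lower) (use assms in auto)

lemma hausdorff1_pre_le_outer: "0 < \<delta> \<Longrightarrow> hausdorff1_pre \<delta> A \<le> hausdorff1_outer A"
  unfolding hausdorff1_outer_def by (rule SUP_upper) auto

lemma hausdorff1_outer_leI: "(\<And>\<delta>. 0 < \<delta> \<Longrightarrow> hausdorff1_pre \<delta> A \<le> c) \<Longrightarrow> hausdorff1_outer A \<le> c"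
  unfolding hausdorff1_outer_def by (rule SUP_least) auto

lemma hausdorff1_pre_mono: "A \<subseteq> B \<Longrightarrow> hausdorff1_pre \<delta> A \<le> hausdorff1_pre \<delta> B"
  unfolding hausdorff1_pre_def by (rule INF_superset_mono) auto

lemma hausdorff1_pre_less_iff:
  "hausdorff1_pre \<delta> A < c \<longleftrightarrow>
    (\<exists>C::nat \<Rightarrow> _. A \<subseteq> (\<Union>i. C i) \<and> (\<forall>i. bounded (C i) \<and> diameter (C i) \<le> \<delta>) \<and>
       (\<Sum>i. ennreal (diameter (C i))) < c)"
  unfolding hausdorff1_pre_def INF_less_iff by auto

lemma hausdorff1_outer_finite_UN:
  assumes "finite I"
  shows "hausdorff1_outer (\<Union>i\<in>I. A i) \<le> (\<Sum>i\<in>I. hausdorff1_outer (A i))"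
  using assms
proof (induction I rule: finite_induct)
  case (insert i I)
  have "hausdorff1_outer (\<Union>i\<in>insert i I. A i) \<le> hausdorff1_outer (A i) + hausdorff1_outer (\<Union>i\<in>I. A i)"
    using hausdorff1_outer_Un by simp
  also have "\<dots> \<le> hausdorff1_outer (A i) + (\<Sum>i\<in>I. hausdorff1_outer (A i))"
    using insert by (intro add_left_mono) auto
  finally show ?case using insert by simp
qed simp

text \<open>Covers by sets of diameter at most \<open>d\<close> never compare points that are
  further apart, so a Lipschitz bound at that scale suffices. The local form serves the estimate of
  critical values, where the small constant holds only at short distances.\<close>

lemma hausdorff1_outer_locally_lipschitz_image:
  fixes f :: "'a::metric_space \<Rightarrow> 'b::metric_space"
  assumes lip: "\<And>x y. x \<in> A \<Longrightarrow> y \<in> A \<Longrightarrow> dist x y \<le> d \<Longrightarrow> dist (f x) (f y) \<le> L * dist x y"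
    and L: "0 < L" and d: "0 < d"
  shows "hausdorff1_outer (f ` A) \<le> ennreal L * hausdorff1_outer A"
proof (rule hausdorff1_outer_leI)
  fix \<delta> :: real assume \<delta>: "0 < \<delta>"
  have cancel: "ennreal (1 / L) * (ennreal L * x) = x" "ennreal L * (ennreal (1 / L) * x) = x" for x
    using L by (simp_all add: mult.assoc[symmetric] ennreal_mult[symmetric])
  \<comment> \<open>The factor is moved to the left so that the claim becomes a lower bound for an
    infimum over covers.\<close>
  have "ennreal (1 / L) * hausdorff1_pre \<delta> (f ` A) \<le> hausdorff1_pre (min (\<delta> / L) d) A"
    unfolding hausdorff1_pre_def[of "min (\<delta> / L) d"]
  proof (rule INF_greatest)
    fix C :: "nat \<Rightarrow> 'a set"
    assume "C \<in> {C. A \<subseteq> (\<Union>i. C i) \<and> (\<forall>i. bounded (C i) \<and> diameter (C i) \<le> min (\<delta> / L) d)}"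
    then have C: "A \<subseteq> (\<Union>i. C i)" "\<And>i. bounded (C i)" "\<And>i. diameter (C i) \<le> \<delta> / L"
      "\<And>i. diameter (C i) \<le> d" by auto
    have d: "dist (f x) (f y) \<le> L * diameter (C i)" if "x \<in> C i \<inter> A" "y \<in> C i \<inter> A" for x y i
    proof -
      have "dist x y \<le> d" using diameter_bounded_bound[OF C(2)[of i]] C(4)[of i] that by (meson IntD1 order_trans)
      then have "dist (f x) (f y) \<le> L * dist x y" using lip that by auto
      also have "\<dots> \<le> L * diameter (C i)"
        using diameter_bounded_bound[OF C(2)[of i]] that L by (intro mult_left_mono) auto
      finally show ?thesis .
    qed
    have bd: "bounded (f ` (C i \<inter> A))" for i
      unfolding bounded_two_points by (rule exI[of _ "L * diameter (C i)"]) (use d in blast)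
    have dm: "diameter (f ` (C i \<inter> A)) \<le> L * diameter (C i)" for i
    proof (cases "C i \<inter> A = {}")
      case True
      then show ?thesis using diameter_ge_0[OF C(2)[of i]] L by simp
    next
      case False
      have "(SUP (u, v)\<in>f ` (C i \<inter> A) \<times> f ` (C i \<inter> A). dist u v) \<le> L * diameter (C i)"
        by (rule cSUP_least) (use False d in auto)
      then show ?thesis using False by (simp add: diameter_def)
    qed
    have "hausdorff1_pre \<delta> (f ` A) \<le> (\<Sum>i. ennreal (diameter (f ` (C i \<inter> A))))"
    proof (rule hausdorff1_pre_le)
      show "f ` A \<subseteq> (\<Union>i. f ` (C i \<inter> A))" using C(1) by blast
      show "diameter (f ` (C i \<inter> A)) \<le> \<delta>" for i
        using dm[of i] C(3)[of i] L by (simp add: field_simps)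
    qed (rule bd)
    also have "\<dots> \<le> (\<Sum>i. ennreal L * ennreal (diameter (C i)))"
      using dm L diameter_ge_0[OF C(2)] by (intro suminf_le) (auto simp: ennreal_mult[symmetric] intro: ennreal_leI)
    also have "\<dots> = ennreal L * (\<Sum>i. ennreal (diameter (C i)))" by simp
    finally show "ennreal (1 / L) * hausdorff1_pre \<delta> (f ` A) \<le> (\<Sum>i. ennreal (diameter (C i)))"
      using cancel(1) mult_left_mono by (metis zero_le)
  qed
  also have "\<dots> \<le> hausdorff1_outer A" using \<delta> L d by (intro hausdorff1_pre_le_outer) simp
  finally have "ennreal L * (ennreal (1 / L) * hausdorff1_pre \<delta> (f ` A)) \<le> ennreal L * hausdorff1_outer A"
    by (rule mult_left_mono) simp
  then show "hausdorff1_pre \<delta> (f ` A) \<le> ennreal L * hausdorff1_outer A" by (simp add: cancel)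
qed

lemma hausdorff1_outer_lipschitz_image:
  fixes f :: "'a::metric_space \<Rightarrow> 'b::metric_space"
  assumes "\<And>x y. x \<in> A \<Longrightarrow> y \<in> A \<Longrightarrow> dist (f x) (f y) \<le> L * dist x y" and "0 < L"
  shows "hausdorff1_outer (f ` A) \<le> ennreal L * hausdorff1_outer A"
  by (rule hausdorff1_outer_locally_lipschitz_image[where d = 1]) (use assms in auto)

lemma bounded_real_subset_Icc:
  fixes X :: "real set"
  assumes "bounded X"
  obtains a b where "X \<subseteq> {a..b}" "a \<le> b" "b - a \<le> diameter X"
proof (cases "X = {}")
  case True then show ?thesis using that[of 0 0] by simp
next
  case False
  have bb: "bdd_below X" "bdd_above X" using assms bounded_imp_bdd_below bounded_imp_bdd_above by auto
  have "Sup X \<le> diameter X + Inf X"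
  proof (rule cSup_least[OF False])
    fix x assume x: "x \<in> X"
    have "x - diameter X \<le> Inf X"
    proof (rule cInf_greatest[OF False])
      fix y assume "y \<in> X"
      with diameter_bounded_bound[OF assms x this] show "x - diameter X \<le> y" by (auto simp: dist_real_def)
    qed
    then show "x \<le> diameter X + Inf X" by simp
  qed
  moreover have "Inf X \<le> Sup X" using bb False by (meson cInf_le_cSup)
  ultimately show ?thesis using bb
    by (intro that[of "Inf X" "Sup X"]) (auto intro: cInf_lower cSup_upper)
qed

lemma hausdorff1_outer_Icc_le:
  assumes "a \<le> (b::real)"
  shows "hausdorff1_outer {a..b} \<le> ennreal (b - a)"
proof (rule hausdorff1_outer_leI)
  fix \<delta> :: real assume \<delta>: "0 < \<delta>"
  obtain n :: nat where n: "(b - a) / \<delta> < n" using reals_Archimedean2 by blast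
  moreover have "(b - a) / \<delta> \<ge> 0" using assms \<delta> by simp
  ultimately have n0: "n > 0" by (metis of_nat_0_less_iff order_le_less_trans)
  define h where "h = (b - a) / n"
  have h: "0 \<le> h" "h \<le> \<delta>" "n * h = b - a"
    using n n0 \<delta> assms by (auto simp: h_def field_simps)
  define C where "C i = (if i < n then {a + i * h .. a + (i + 1) * h} else {})" for i :: nat
  have "hausdorff1_pre \<delta> {a..b} \<le> (\<Sum>i. ennreal (diameter (C i)))"
  proof (rule hausdorff1_pre_le)
    show "{a..b} \<subseteq> (\<Union>i. C i)"
    proof
      fix x assume x: "x \<in> {a..b}"
      show "x \<in> (\<Union>i. C i)"
      \<comment> \<open>The floor of \<open>(x - a) / h\<close> would be \<open>n\<close> at
        \<open>x = b\<close> and is meaningless for \<open>h = 0\<close>; both cases use the last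
        piece.\<close>
      proof (cases "x = b \<or> h = 0")
        case True
        have "a + (real (n - 1) + 1) * h = b" using h n0 by (simp add: of_nat_diff)
        then have "x \<in> C (n - 1)" using True x h n0 by (auto simp: C_def algebra_simps)
        then show ?thesis by blast
      next
        case False
        then have h0: "h > 0" and xb: "x < b" using h x by auto
        define i where "i = nat \<lfloor>(x - a) / h\<rfloor>"
        have "real i \<le> (x - a) / h" "(x - a) / h < real i + 1"
          using x h0 unfolding i_def by (auto intro!: of_nat_floor)
        then have "a + i * h \<le> x" "x < a + (i + 1) * h" using h0 by (auto simp: field_simps)
        moreover have "i < n"
        proof -
          have "i * h < n * h" using calculation xb h by linarith
          then show ?thesis using h0 by simp
        qed
        ultimately have "x \<in> C i" by (auto simp: C_def)
        then show ?thesis by blast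
      qed
    qed
  qed (use h \<delta> in \<open>auto simp: C_def algebra_simps\<close>)
  also have "\<dots> = (\<Sum>i<n. ennreal (diameter (C i)))" by (rule suminf_finite) (auto simp: C_def)
  also have "\<dots> = (\<Sum>i<n. ennreal h)" using h by (intro sum.cong) (auto simp: C_def algebra_simps)
  also have "\<dots> = ennreal (\<Sum>i<n. h)" using h by (intro sum_ennreal) auto
  also have "\<dots> = ennreal (b - a)" using h by simp
  finally show "hausdorff1_pre \<delta> {a..b} \<le> ennreal (b - a)" .
qed

text \<open>Covering sets can be enlarged to closed intervals that are no longer than their
  diameters, and Lebesgue measure is countably subadditive; scale 1 is already enough.\<close>

lemma emeasure_lborel_le_hausdorff1_outer:
  fixes A :: "real set"
  assumes "A \<in> sets borel"
  shows "emeasure lborel A \<le> hausdorff1_outer A"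
proof -
  have "emeasure lborel A \<le> hausdorff1_pre 1 A"
    unfolding hausdorff1_pre_def
  proof (rule INF_greatest)
    fix C :: "nat \<Rightarrow> real set"
    assume "C \<in> {C. A \<subseteq> (\<Union>i. C i) \<and> (\<forall>i. bounded (C i) \<and> diameter (C i) \<le> 1)}"
    then have C: "A \<subseteq> (\<Union>i. C i)" "\<And>i. bounded (C i)" by auto
    have "\<exists>a b. C i \<subseteq> {a..b} \<and> a \<le> b \<and> b - a \<le> diameter (C i)" for i
      using bounded_real_subset_Icc[OF C(2)[of i]] by metis
    then obtain a b where ab: "\<And>i. C i \<subseteq> {a i..b i}" "\<And>i. a i \<le> b i" "\<And>i. b i - a i \<le> diameter (C i)"
      by metis
    have "emeasure lborel A \<le> emeasure lborel (\<Union>i. {a i..b i})"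
      using C(1) ab(1) by (intro emeasure_mono) fastforce+
    also have "\<dots> \<le> (\<Sum>i. emeasure lborel {a i..b i})"
      by (rule emeasure_subadditive_countably) auto
    also have "\<dots> \<le> (\<Sum>i. ennreal (diameter (C i)))"
      using ab by (intro suminf_le) (auto intro: ennreal_leI)
    finally show "emeasure lborel A \<le> (\<Sum>i. ennreal (diameter (C i)))" .
  qed
  also have "\<dots> \<le> hausdorff1_outer A" by (rule hausdorff1_pre_le_outer) simp
  finally show ?thesis .
qed

lemma hausdorff1_real: "(hausdorff1 :: real measure) = lborel"
proof (rule lborel_eqI[symmetric])
  fix l u :: real assume "\<And>b. b \<in> Basis \<Longrightarrow> l \<bullet> b \<le> u \<bullet> b"
  then have lu: "l \<le> u" by simp
  have "hausdorff1_outer (box l u) \<le> hausdorff1_outer {l..u}"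
    by (rule hausdorff1_outer_mono) (auto simp: box_real)
  also have "\<dots> \<le> ennreal (u - l)" by (rule hausdorff1_outer_Icc_le[OF lu])
  finally have "hausdorff1_outer (box l u) \<le> ennreal (u - l)" .
  moreover have "ennreal (u - l) \<le> hausdorff1_outer (box l u)"
    using emeasure_lborel_le_hausdorff1_outer[of "box l u"] lu by (simp add: box_real)
  ultimately show "emeasure hausdorff1 (box l u) = ennreal (\<Prod>b\<in>Basis. (u - l) \<bullet> b)"
    by (simp add: emeasure_hausdorff1)
qed simp

lemma hausdorff1_outer_real: "A \<in> sets borel \<Longrightarrow> hausdorff1_outer (A :: real set) = emeasure lborel A"
  using emeasure_hausdorff1[of A] by (simp add: hausdorff1_real)

text \<open>The Borel set \<open>I\<close> stands in for the image of \<open>A\<close>, which need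
  not be measurable.\<close>

lemma hausdorff1_outer_ge_lborel_image:
  fixes f :: "'a::metric_space \<Rightarrow> real"
  assumes "\<And>x y. x \<in> A \<Longrightarrow> y \<in> A \<Longrightarrow> dist (f x) (f y) \<le> dist x y"
    and "I \<subseteq> f ` A" "I \<in> sets borel"
  shows "emeasure lborel I \<le> hausdorff1_outer A"
proof -
  have "emeasure lborel I \<le> hausdorff1_outer (f ` A)"
    using hausdorff1_outer_mono[OF assms(2)] assms(3) by (simp add: hausdorff1_outer_real)
  also have "\<dots> \<le> ennreal 1 * hausdorff1_outer A"
    by (rule hausdorff1_outer_lipschitz_image) (use assms in auto)
  finally show ?thesis by simp
qed

text \<open>\<open>dist x\<close> is 1-Lipschitz and maps \<open>C\<close> onto an interval that
  contains \<open>{0..r}\<close>. All lower density bounds come from here.\<close>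

lemma hausdorff1_outer_connected_ge:
  fixes C :: "'a::metric_space set"
  assumes "connected C" "x \<in> C" "y \<in> C" "r \<le> dist x y"
  shows "ennreal r \<le> hausdorff1_outer (C \<inter> cball x r)"
proof (cases "0 \<le> r")
  case True
  have "{0..r} \<subseteq> dist x ` (C \<inter> cball x r)"
  proof
    fix s assume s: "s \<in> {0..r}"
    have "connected (dist x ` C)" by (intro connected_continuous_image continuous_intros assms)
    moreover have "0 \<in> dist x ` C" "dist x y \<in> dist x ` C" using assms by force+
    ultimately have "s \<in> dist x ` C"
      using s assms by (auto simp: connected_iff_interval)
    then show "s \<in> dist x ` (C \<inter> cball x r)" using s by auto
  qed
  moreover have "dist (dist x a) (dist x b) \<le> dist a b" for a b
    using dist_triangle[of x a b] dist_triangle[of x b a] by (simp add: dist_real_def abs_le_iff dist_commute)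
  ultimately have "emeasure lborel {0..r} \<le> hausdorff1_outer (C \<inter> cball x r)"
    by (intro hausdorff1_outer_ge_lborel_image[where f = "dist x"]) auto
  then show ?thesis using True by simp
qed (simp add: ennreal_neg)

text \<open>Exceptional sets defined through normals or derivatives need not be Borel; a Borel hull
  makes them usable in almost-everywhere statements.\<close>

lemma hausdorff1_outer_null_superset:
  fixes A :: "'a::metric_space set"
  assumes "hausdorff1_outer A = 0"
  obtains N where "N \<in> null_sets hausdorff1" "A \<subseteq> N"
proof -
  have "\<exists>C::nat \<Rightarrow> 'a set. A \<subseteq> (\<Union>i. C i) \<and> (\<forall>i. bounded (C i) \<and> diameter (C i) \<le> e) \<and>
       (\<Sum>i. ennreal (diameter (C i))) < ennreal e" if "e > 0" for e
  proof -
    have "hausdorff1_pre e A < ennreal e"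
      using hausdorff1_pre_le_outer[OF that, of A] assms that by simp
    then show ?thesis unfolding hausdorff1_pre_less_iff .
  qed
  then have "\<exists>C::nat \<Rightarrow> 'a set. A \<subseteq> (\<Union>i. C i) \<and> (\<forall>i. bounded (C i) \<and> diameter (C i) \<le> inverse (Suc n)) \<and>
       (\<Sum>i. ennreal (diameter (C i))) < ennreal (inverse (Suc n))" for n :: nat by simp
  then obtain C :: "nat \<Rightarrow> nat \<Rightarrow> 'a set" where C: "\<And>n. A \<subseteq> (\<Union>i. C n i)" "\<And>n i. bounded (C n i)"
    "\<And>n i. diameter (C n i) \<le> inverse (Suc n)" "\<And>n. (\<Sum>i. ennreal (diameter (C n i))) < ennreal (inverse (Suc n))"
    by metis
  \<comment> \<open>Closures have the same diameters as the sets, so \<open>N\<close> is Borel and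
    still has covers of total size at most \<open>1 / (n + 1)\<close> for every
    \<open>n\<close>.\<close>
  define N where "N = (\<Inter>n. \<Union>i. closure (C n i))"
  have "hausdorff1_outer N \<le> 0"
  proof (rule hausdorff1_outer_leI)
    fix \<delta> :: real assume \<delta>: "0 < \<delta>"
    have "hausdorff1_pre \<delta> N \<le> 0 + ennreal e" if e: "0 < e" for e
    proof -
      obtain n where n: "inverse (real (Suc n)) < min e \<delta>" using reals_Archimedean[of "min e \<delta>"] e \<delta> by auto
      have "hausdorff1_pre \<delta> N \<le> (\<Sum>i. ennreal (diameter (closure (C n i))))"
      proof (rule hausdorff1_pre_le)
        show "N \<subseteq> (\<Union>i. closure (C n i))" by (auto simp: N_def)
        show "bounded (closure (C n i))" for i using C(2) by (rule bounded_closure)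
        show "diameter (closure (C n i)) \<le> \<delta>" for i
          using C(3)[of n i] n by (simp add: diameter_closure[OF C(2)])
      qed
      also have "\<dots> \<le> ennreal (inverse (Suc n))" using C(4)[of n] C(2) by (simp add: diameter_closure less_imp_le)
      also have "\<dots> \<le> ennreal e" using n by (intro ennreal_leI) auto
      finally show ?thesis by simp
    qed
    then show "hausdorff1_pre \<delta> N \<le> 0" by (rule ennreal_le_epsilon)
  qed
  moreover have "N \<in> sets borel" unfolding N_def by auto
  ultimately have "N \<in> null_sets hausdorff1" by (auto simp: null_sets_def emeasure_hausdorff1)
  moreover have "A \<subseteq> N" using C(1) closure_subset unfolding N_def by blast
  ultimately show ?thesis using that by blast
qed

subsection \<open>Restricted measures, blow-ups and Vitali coverings\<close>

abbreviation H1_on :: "'a::metric_space set \<Rightarrow> 'a measure" where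
  "H1_on K \<equiv> measure_restr hausdorff1 K"

lemma sets_measure_restr [simp, measurable_cong]: "sets (measure_restr M A) = sets M"
  and space_measure_restr [simp]: "space (measure_restr M A) = space M"
  by (simp_all add: measure_restr_def)

lemma emeasure_measure_restr:
  "A \<in> sets M \<Longrightarrow> B \<in> sets M \<Longrightarrow> emeasure (measure_restr M A) B = emeasure M (A \<inter> B)"
  by (simp add: measure_restr_def emeasure_density nn_integral_indicator
      flip: indicator_inter_arith)

lemma AE_measure_restr:
  "A \<in> sets M \<Longrightarrow> (AE x in measure_restr M A. P x) \<longleftrightarrow> (AE x in M. x \<in> A \<longrightarrow> P x)"
  unfolding measure_restr_def by (subst AE_density) (auto simp: indicator_def intro!: AE_cong)

lemma emeasure_H1_on:
  "K \<in> sets borel \<Longrightarrow> B \<in> sets borel \<Longrightarrow> emeasure (H1_on K) B = hausdorff1_outer (K \<inter> B)"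
  by (simp add: emeasure_measure_restr emeasure_hausdorff1)

lemma finite_measure_H1_on:
  assumes "K \<in> sets borel" "hausdorff1_outer K < \<infinity>"
  shows "finite_measure (H1_on K)"
  by (rule finite_measureI) (use assms in \<open>simp add: emeasure_H1_on\<close>)

lemma AE_H1_onI:
  assumes "K \<in> sets borel" "hausdorff1_outer {x \<in> K. \<not> P x} = 0"
  shows "AE x in H1_on K. P x"
proof -
  obtain N where "N \<in> null_sets hausdorff1" "{x \<in> K. \<not> P x} \<subseteq> N"
    using hausdorff1_outer_null_superset[OF assms(2)] .
  then have "AE x in hausdorff1. x \<in> K \<longrightarrow> P x" by (intro AE_I'[of N]) auto
  then show ?thesis using assms(1) by (simp add: AE_measure_restr)
qed

section \<open>Quarter turns and lines in the plane\<close>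

definition rot :: "real^2 \<Rightarrow> real^2" where
  "rot z = vector [- z $ 2, z $ 1]"

lemma rot_nth [simp]: "rot z $ 1 = - z $ 2" "rot z $ 2 = z $ 1"
  by (simp_all add: rot_def)

lemma inner_2: "x \<bullet> y = x $ 1 * y $ 1 + x $ 2 * y $ (2::2)" for x y :: "real^2"
  by (simp add: inner_vec_def sum_2)

lemma vec2_eqI: "x $ 1 = y $ 1 \<Longrightarrow> x $ 2 = y $ 2 \<Longrightarrow> x = y" for x y :: "real^2"
  by (simp add: vec_eq_iff forall_2)

lemma norm_rot [simp]: "norm (rot z) = norm z"
  by (simp add: norm_eq_sqrt_inner inner_2)

lemma inner_rot [simp]: "z \<bullet> rot z = 0" "rot z \<bullet> z = 0"
  by (simp_all add: inner_2)

lemma inner_rot_rot [simp]: "rot x \<bullet> rot y = x \<bullet> y"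
  by (simp add: inner_2)

lemma rot_rot [simp]: "rot (rot z) = - z"
  by (rule vec2_eqI) simp_all

lemma linear_rot: "linear rot"
  by (rule linearI) (auto intro!: vec2_eqI)

lemma rot_scaleR [simp]: "rot (c *\<^sub>R x) = c *\<^sub>R rot x"
  and rot_minus [simp]: "rot (- x) = - rot x"
  by (auto intro!: vec2_eqI)

lemma continuous_on_rot [continuous_intros]: "continuous_on S f \<Longrightarrow> continuous_on S (\<lambda>x. rot (f x))"
  using linear_rot by (auto intro: bounded_linear.continuous_on simp: linear_conv_bounded_linear)

lemma orthonormal_decomposition:
  assumes "norm \<nu> = 1"
  shows "w = (w \<bullet> \<nu>) *\<^sub>R \<nu> + (w \<bullet> rot \<nu>) *\<^sub>R rot \<nu>"
proof -
  have n: "\<nu> $ 1 * \<nu> $ 1 + \<nu> $ 2 * \<nu> $ 2 = 1"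
    using assms by (simp add: norm_eq_1 inner_2)
  have "w $ 1 = w $ 1 * (\<nu> $ 1 * \<nu> $ 1 + \<nu> $ 2 * \<nu> $ 2)" "w $ 2 = w $ 2 * (\<nu> $ 1 * \<nu> $ 1 + \<nu> $ 2 * \<nu> $ 2)"
    using n by simp_all
  then show ?thesis by (intro vec2_eqI) (simp_all add: inner_2 algebra_simps)
qed

lemma inner_orthonormal:
  assumes "norm \<nu> = 1"
  shows "p \<bullet> w = (p \<bullet> \<nu>) * (w \<bullet> \<nu>) + (p \<bullet> rot \<nu>) * (w \<bullet> rot \<nu>)"
  by (subst orthonormal_decomposition[OF assms, of w]) (simp add: inner_add_right)

lemma norm_le_orthonormal:
  assumes "norm \<nu> = 1"
  shows "norm w \<le> \<bar>w \<bullet> \<nu>\<bar> + \<bar>w \<bullet> rot \<nu>\<bar>"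
  by (subst orthonormal_decomposition[OF assms, of w], rule order_trans[OF norm_triangle_ineq])
    (simp add: assms)

lemma line_eq_range:
  assumes "norm \<nu> = 1"
  shows "{y. y \<bullet> \<nu> = 0} = range (\<lambda>t. t *\<^sub>R rot \<nu>)"
proof (intro set_eqI iffI)
  fix y assume "y \<in> {y. y \<bullet> \<nu> = 0}"
  then have "y = (y \<bullet> rot \<nu>) *\<^sub>R rot \<nu>" using orthonormal_decomposition[OF assms, of y] by simp
  then show "y \<in> range (\<lambda>t. t *\<^sub>R rot \<nu>)" by (rule range_eqI)
qed auto

lemma closed_line: "closed {y. y \<bullet> \<nu> = 0}" for \<nu> :: "'a::real_inner"
  by (intro closed_Collect_eq continuous_intros)

text \<open>The parametrisation by \<open>t *\<^sub>R rot \<nu>\<close> and its left inverse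
  \<open>y \<bullet> rot \<nu>\<close> are both 1-Lipschitz, so length on the line is Lebesgue
  measure of the parameter.\<close>

lemma H1_on_line:
  assumes "norm \<nu> = 1"
  shows "H1_on {y. y \<bullet> \<nu> = 0} = distr lborel borel (\<lambda>t. t *\<^sub>R rot \<nu>)"
proof (rule measure_eqI)
  let ?f = "\<lambda>t. t *\<^sub>R rot \<nu>"
  fix B assume "B \<in> sets (H1_on {y. y \<bullet> \<nu> = 0})"
  then have B: "B \<in> sets borel" by simp
  have f: "?f \<in> borel_measurable borel" by simp
  have S: "?f -` B \<in> sets borel" using measurable_sets[OF f B] by simp
  have "emeasure (H1_on {y. y \<bullet> \<nu> = 0}) B = hausdorff1_outer ({y. y \<bullet> \<nu> = 0} \<inter> B)"
    using closed_line B by (intro emeasure_H1_on) auto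
  also have "{y. y \<bullet> \<nu> = 0} \<inter> B = ?f ` (?f -` B)"
    unfolding line_eq_range[OF assms] by auto
  also have "hausdorff1_outer (?f ` (?f -` B)) = hausdorff1_outer (?f -` B)"
  proof (rule antisym)
    have "hausdorff1_outer (?f ` (?f -` B)) \<le> ennreal 1 * hausdorff1_outer (?f -` B)"
      by (rule hausdorff1_outer_lipschitz_image)
        (auto simp: dist_norm assms scaleR_diff_left[symmetric])
    then show "hausdorff1_outer (?f ` (?f -` B)) \<le> hausdorff1_outer (?f -` B)" by simp
    have eq: "(\<lambda>y. y \<bullet> rot \<nu>) ` ?f ` (?f -` B) = ?f -` B"
      using assms by (simp add: image_image dot_square_norm del: image_vimage_eq)
    have "hausdorff1_outer ((\<lambda>y. y \<bullet> rot \<nu>) ` ?f ` (?f -` B)) \<le> ennreal 1 * hausdorff1_outer (?f ` (?f -` B))"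
    proof (rule hausdorff1_outer_lipschitz_image)
      fix x y
      have "\<bar>(x - y) \<bullet> rot \<nu>\<bar> \<le> norm (x - y) * norm (rot \<nu>)" by (rule Cauchy_Schwarz_ineq2)
      then show "dist (x \<bullet> rot \<nu>) (y \<bullet> rot \<nu>) \<le> 1 * dist x y"
        by (simp add: dist_norm assms inner_diff_left)
    qed simp
    then show "hausdorff1_outer (?f -` B) \<le> hausdorff1_outer (?f ` (?f -` B))" by (simp only: eq) simp
  qed
  also have "\<dots> = emeasure lborel (?f -` B)" using S by (rule hausdorff1_outer_real)
  also have "\<dots> = emeasure (distr lborel borel ?f) B" using B by (simp add: emeasure_distr)
  finally show "emeasure (H1_on {y. y \<bullet> \<nu> = 0}) B = emeasure (distr lborel borel ?f) B" .
qed simp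

lemma integral_H1_on_line:
  fixes g :: "real^2 \<Rightarrow> real"
  assumes "norm \<nu> = 1" "g \<in> borel_measurable borel"
  shows "integral\<^sup>L (H1_on {y. y \<bullet> \<nu> = 0}) g = (\<integral>t. g (t *\<^sub>R rot \<nu>) \<partial>lborel)"
  unfolding H1_on_line[OF assms(1)] using assms(2) by (subst integral_distr) auto

section \<open>Blow-ups\<close>

lemma blow_up_dist: "0 < \<rho> \<Longrightarrow> dist (blow_up x \<rho> y) (blow_up x \<rho> z) = dist y z / \<rho>"
  by (simp add: blow_up_def dist_norm scaleR_diff_right[symmetric] del: scaleR_diff_right)

lemma norm_blow_up: "0 < \<rho> \<Longrightarrow> norm (blow_up x \<rho> y) = dist x y / \<rho>"
  by (simp add: blow_up_def dist_norm norm_minus_commute)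

lemma blow_up_inverse [simp]:
  "0 < \<rho> \<Longrightarrow> x + \<rho> *\<^sub>R blow_up x \<rho> y = y" "0 < \<rho> \<Longrightarrow> blow_up x \<rho> (x + \<rho> *\<^sub>R z) = z"
  by (simp_all add: blow_up_def)

lemma continuous_on_blow_up [continuous_intros]: "continuous_on S (blow_up x \<rho>)"
  unfolding blow_up_def by (intro continuous_intros)

lemma borel_measurable_blow_up [measurable]: "blow_up x \<rho> \<in> borel_measurable borel"
  by (intro borel_measurable_continuous_onI continuous_intros)

lemma blow_up_image_borel:
  assumes "0 < \<rho>" "K \<in> sets borel"
  shows "blow_up x \<rho> ` K \<in> sets borel"
proof -
  have "blow_up x \<rho> ` K = (\<lambda>z. x + \<rho> *\<^sub>R z) -` K"
  proof (intro set_eqI iffI)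
    fix z assume "z \<in> (\<lambda>z. x + \<rho> *\<^sub>R z) -` K"
    then show "z \<in> blow_up x \<rho> ` K" using assms by (intro image_eqI[of _ _ "x + \<rho> *\<^sub>R z"]) auto
  qed (use assms in auto)
  moreover have "(\<lambda>z. x + \<rho> *\<^sub>R z) \<in> borel_measurable borel" by simp
  ultimately show ?thesis using measurable_sets[of "\<lambda>z. x + \<rho> *\<^sub>R z" borel borel K] assms by simp
qed

lemma hausdorff1_outer_blow_up:
  assumes \<rho>: "0 < \<rho>"
  shows "hausdorff1_outer (blow_up x \<rho> ` A) = ennreal (1 / \<rho>) * hausdorff1_outer A"
proof (rule antisym)
  show "hausdorff1_outer (blow_up x \<rho> ` A) \<le> ennreal (1 / \<rho>) * hausdorff1_outer A"
    by (rule hausdorff1_outer_lipschitz_image) (use \<rho> in \<open>auto simp: blow_up_dist\<close>)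
  have "(\<lambda>z. x + \<rho> *\<^sub>R z) ` blow_up x \<rho> ` A = A" using \<rho> by (auto simp: image_image)
  moreover have "hausdorff1_outer ((\<lambda>z. x + \<rho> *\<^sub>R z) ` blow_up x \<rho> ` A) \<le> ennreal \<rho> * hausdorff1_outer (blow_up x \<rho> ` A)"
    by (rule hausdorff1_outer_lipschitz_image)
      (use \<rho> in \<open>auto simp: dist_norm scaleR_diff_right[symmetric] simp del: scaleR_diff_right\<close>)
  ultimately have "ennreal (1 / \<rho>) * hausdorff1_outer A \<le> ennreal (1 / \<rho>) * (ennreal \<rho> * hausdorff1_outer (blow_up x \<rho> ` A))"
    by (intro mult_left_mono) auto
  then show "ennreal (1 / \<rho>) * hausdorff1_outer A \<le> hausdorff1_outer (blow_up x \<rho> ` A)"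
    using \<rho> by (simp add: mult.assoc[symmetric] ennreal_mult[symmetric])
qed

text \<open>Restrictions to varying blown-up sets become push-forwards of the one measure
  \<open>H1_on K\<close>, so blow-up integrals can be compared with masses of balls.\<close>

lemma H1_on_blow_up:
  assumes \<rho>: "0 < \<rho>" and K: "K \<in> sets borel"
  shows "H1_on (blow_up x \<rho> ` K) = distr (density (H1_on K) (\<lambda>_. ennreal (1 / \<rho>))) borel (blow_up x \<rho>)"
proof (rule measure_eqI)
  fix B assume "B \<in> sets (H1_on (blow_up x \<rho> ` K))"
  then have B: "B \<in> sets borel" by simp
  have pre: "blow_up x \<rho> -` B \<in> sets borel"
    using measurable_sets[OF borel_measurable_blow_up B, of x \<rho>] by simp
  have "emeasure (H1_on (blow_up x \<rho> ` K)) B = hausdorff1_outer (blow_up x \<rho> ` K \<inter> B)"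
    using B blow_up_image_borel[OF \<rho> K] by (rule emeasure_H1_on[rotated])
  also have "blow_up x \<rho> ` K \<inter> B = blow_up x \<rho> ` (K \<inter> blow_up x \<rho> -` B)" by auto
  also have "hausdorff1_outer \<dots> = ennreal (1 / \<rho>) * hausdorff1_outer (K \<inter> blow_up x \<rho> -` B)"
    by (rule hausdorff1_outer_blow_up[OF \<rho>])
  also have "\<dots> = emeasure (distr (density (H1_on K) (\<lambda>_. ennreal (1 / \<rho>))) borel (blow_up x \<rho>)) B"
    using B pre K by (simp add: emeasure_distr emeasure_density_const emeasure_H1_on)
  finally show "emeasure (H1_on (blow_up x \<rho> ` K)) B = \<dots>" .
qed simp

lemma integral_H1_on_blow_up:
  fixes g :: "real^2 \<Rightarrow> real"
  assumes "0 < \<rho>" "K \<in> sets borel" "g \<in> borel_measurable borel"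
  shows "integral\<^sup>L (H1_on (blow_up x \<rho> ` K)) g = (1 / \<rho>) * (\<integral>y. g (blow_up x \<rho> y) \<partial>H1_on K)"
  unfolding H1_on_blow_up[OF assms(1,2)] using assms by (simp add: integral_distr integral_density)

section \<open>Vitali coverings and the upper density\<close>

lemma hausdorff1_pre_UN:
  fixes A :: "nat \<Rightarrow> 'a::metric_space set"
  assumes \<delta>: "0 < \<delta>"
  shows "hausdorff1_pre \<delta> (\<Union>i. A i) \<le> (\<Sum>i. hausdorff1_pre \<delta> (A i))"
proof -
  interpret ring_of_sets UNIV "Pow UNIV :: 'a set set" by (rule ring_of_sets_Pow)
  define w where "w = (\<lambda>B :: 'a set. if bounded B \<and> diameter B \<le> \<delta> then ennreal (diameter B) else top)"
  have eq: "hausdorff1_pre \<delta> X = outer_measure (Pow UNIV) w X" for X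
    unfolding w_def by (rule hausdorff1_pre_eq_outer_measure(1)[OF \<delta>])
  have "countably_subadditive (Pow UNIV) (outer_measure (Pow UNIV) w)"
    unfolding w_def
    by (rule countably_subadditive_outer_measure[OF hausdorff1_pre_eq_outer_measure(2,3)[OF \<delta>]])
  then have "outer_measure (Pow UNIV) w (\<Union>i. disjointed A i)
      \<le> (\<Sum>i. outer_measure (Pow UNIV) w (disjointed A i))"
    by (simp add: countably_subadditive_def disjoint_family_disjointed del: UN_disjointed_eq)
  then have "hausdorff1_pre \<delta> (\<Union>i. A i) \<le> (\<Sum>i. hausdorff1_pre \<delta> (disjointed A i))"
    unfolding eq UN_disjointed_eq .
  also have "\<dots> \<le> (\<Sum>i. hausdorff1_pre \<delta> (A i))"
    by (intro suminf_le hausdorff1_pre_mono disjointed_subset) auto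
  finally show ?thesis .
qed

lemma hausdorff1_pre_Un:
  assumes \<delta>: "0 < \<delta>"
  shows "hausdorff1_pre \<delta> (A \<union> B) \<le> hausdorff1_pre \<delta> A + hausdorff1_pre \<delta> B"
proof -
  let ?A = "\<lambda>i::nat. if i = 0 then A else if i = Suc 0 then B else {}"
  have empty: "hausdorff1_pre \<delta> ({} :: 'a set) = 0"
    using hausdorff1_pre_le_outer[OF \<delta>, of "{}"] by simp
  have eq: "(\<Union>i. ?A i) = A \<union> B" by (auto split: if_splits)
  have "hausdorff1_pre \<delta> (A \<union> B) \<le> (\<Sum>i. hausdorff1_pre \<delta> (?A i))"
    using hausdorff1_pre_UN[OF \<delta>, of ?A] unfolding eq .
  also have "\<dots> = (\<Sum>i\<in>{0, Suc 0}. hausdorff1_pre \<delta> (?A i))"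
    by (rule suminf_finite) (auto simp: empty)
  finally show ?thesis by simp
qed

text \<open>At the fixed scale \<open>\<delta>\<close> the diameters of a Vitali family are an
  admissible bound; for the outer measure they are not, since it asks for ever finer covers.\<close>

lemma hausdorff1_pre_finite_UN_le:
  assumes "finite I" "0 < \<delta>" "\<And>i. i \<in> I \<Longrightarrow> bounded (A i) \<and> diameter (A i) \<le> \<delta>"
  shows "hausdorff1_pre \<delta> (\<Union>i\<in>I. A i) \<le> (\<Sum>i\<in>I. ennreal (diameter (A i)))"
  using assms(1,3)
proof (induction I rule: finite_induct)
  case empty
  then show ?case using hausdorff1_pre_le_outer[OF assms(2), of "{}"] by simp
next
  case (insert i I)
  have "hausdorff1_pre \<delta> (A i) \<le> (\<Sum>k. ennreal (diameter (if k = 0 then A i else {})))"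
    by (rule hausdorff1_pre_le) (use insert assms(2) in \<open>auto split: if_splits\<close>)
  also have "\<dots> = (\<Sum>k\<in>{0::nat}. ennreal (diameter (if k = 0 then A i else {})))"
    by (rule suminf_finite) auto
  finally have "hausdorff1_pre \<delta> (A i) \<le> ennreal (diameter (A i))" by simp
  then have "hausdorff1_pre \<delta> (A i \<union> (\<Union>i\<in>I. A i)) \<le> ennreal (diameter (A i)) + (\<Sum>i\<in>I. ennreal (diameter (A i)))"
    using insert by (intro order_trans[OF hausdorff1_pre_Un[OF assms(2)]] add_mono) auto
  then show ?case using insert by simp
qed

text \<open>Each ball carries a mass of at least its radius, so the radii of a disjoint family are
  summable. What such a family misses lies in the 5-fold enlargements of the balls beyond any given
  index, and their diameters sum to as little as desired.\<close>

theorem vitali_hausdorff1: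
  fixes K E :: "'a::euclidean_space set" and F :: "('a \<times> real) set"
  assumes K: "K \<in> sets borel" "hausdorff1_outer K < \<infinity>" and EK: "E \<subseteq> K"
    and F: "\<And>x r. (x, r) \<in> F \<Longrightarrow> 0 < r \<and> ennreal r \<le> hausdorff1_outer (K \<inter> cball x r)"
    and fine: "\<And>x \<eta>. x \<in> E \<Longrightarrow> 0 < \<eta> \<Longrightarrow> \<exists>r<\<eta>. (x, r) \<in> F"
    and \<eta>: "0 < \<eta>"
  obtains C where "finite C" "C \<subseteq> F"
    "pairwise (\<lambda>p q. disjnt (cball (fst p) (snd p)) (cball (fst q) (snd q))) C"
    "hausdorff1_outer (E - (\<Union>p\<in>C. cball (fst p) (snd p))) < ennreal \<eta>"
proof -
  interpret M: finite_measure "H1_on K" by (rule finite_measure_H1_on[OF K])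
  \<comment> \<open>The Vitali covering lemma asks for bounded radii; truncation keeps the family
    fine.\<close>
  define F1 where "F1 = {p \<in> F. snd p \<le> 1}"
  have F1: "0 < snd i \<and> snd i \<le> 1" if "i \<in> F1" for i
    using F[of "fst i" "snd i"] that by (auto simp: F1_def)
  obtain C where C: "countable C" "C \<subseteq> F1"
     "pairwise (\<lambda>i j. disjnt (cball (fst i) (snd i)) (cball (fst j) (snd j))) C"
     "\<And>i. i \<in> F1 \<Longrightarrow> \<exists>j. j \<in> C \<and> \<not> disjnt (cball (fst i) (snd i)) (cball (fst j) (snd j)) \<and>
                        cball (fst i) (snd i) \<subseteq> ball (fst j) (5 * snd j)"
    by (rule Vitali_covering_lemma_cballs_balls[OF F1, where a = fst]) (assumption | rule that)+
  \<comment> \<open>The selected balls are numbered so that tails of series can be used; indices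
    outside \<open>I\<close> stand for empty balls of radius 0.\<close>
  define I where "I = to_nat_on C ` C"
  define q where "q = from_nat_into C"
  have qC: "q i \<in> C" if "i \<in> I" for i using that C(1) by (auto simp: I_def q_def)
  have qsurj: "\<exists>i\<in>I. q i = p" if "p \<in> C" for p
    using that C(1) by (auto simp: I_def q_def)
  have qinj: "i = j" if "i \<in> I" "j \<in> I" "q i = q j" for i j
    using that C(1) by (auto simp: I_def q_def)
  define B where "B i = (if i \<in> I then cball (fst (q i)) (snd (q i)) else {})" for i
  define R where "R i = (if i \<in> I then snd (q i) else 0)" for i
  have Bm [measurable]: "B i \<in> sets borel" for i by (simp add: B_def)
  have dB: "disjoint_family B"
    unfolding disjoint_family_on_def
  proof (intro ballI impI)
    fix i j :: nat assume "i \<noteq> j"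
    show "B i \<inter> B j = {}"
    proof (cases "i \<in> I \<and> j \<in> I")
      case True
      with \<open>i \<noteq> j\<close> qinj have "q i \<noteq> q j" by auto
      with C(3) qC True show ?thesis by (auto simp: B_def pairwise_def disjnt_def)
    qed (auto simp: B_def)
  qed
  define m where "m i = measure (H1_on K) (B i)" for i
  have emB: "ennreal (m i) = hausdorff1_outer (K \<inter> B i)" for i
    unfolding m_def using K by (simp add: M.emeasure_eq_measure[symmetric] emeasure_H1_on)
  have sm: "summable m"
    unfolding m_def by (rule sums_summable, rule M.finite_measure_UNION) (use dB in auto)
  have Rm: "R i \<le> m i" and R0: "0 \<le> R i" for i
  proof -
    have "ennreal (R i) \<le> ennreal (m i)" and "0 \<le> R i" unfolding emB
      using F[of "fst (q i)" "snd (q i)"] qC[of i] C(2) by (auto simp: R_def B_def F1_def)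
    then show "R i \<le> m i" "0 \<le> R i" by (simp_all add: m_def)
  qed
  have tail: "\<exists>N. (\<Sum>i. m (i + N)) < e" if "e > 0" for e
    using suminf_exist_split[OF that sm] by (metis abs_ge_self le_less_trans order_refl real_norm_def)
  have smN: "summable (\<lambda>i. m (i + N))" for N using sm by (simp add: summable_iff_shift)
  have RmN: "summable (\<lambda>i. R (i + N))" for N
    by (rule summable_comparison_test'[OF smN[of N], of 0]) (use Rm R0 in auto)
  \<comment> \<open>A missed point has a ball of the family that avoids the first \<open>N\<close>
    selected balls. The selected ball that it meets is therefore a later one, and its enlargement
    contains the point.\<close>
  have cov: "E - (\<Union>i. B i) \<subseteq> (\<Union>i. cball (fst (q (i + N))) (5 * R (i + N)))" for N
  proof
    fix x assume x: "x \<in> E - (\<Union>i. B i)"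
    have "closed (\<Union>i<N. B i)" by (intro closed_UN) (auto simp: B_def)
    then have "open (- (\<Union>i<N. B i))" by (rule open_Compl)
    moreover have "x \<in> - (\<Union>i<N. B i)" using x by auto
    ultimately obtain e where e: "e > 0" "ball x e \<subseteq> - (\<Union>i<N. B i)" by (meson openE)
    obtain r where r: "r < min e 1" "(x, r) \<in> F" using fine[of x "min e 1"] x e by auto
    then have "(x, r) \<in> F1" by (auto simp: F1_def)
    from C(4)[OF this] obtain j where j: "j \<in> C" "\<not> disjnt (cball x r) (cball (fst j) (snd j))"
      "cball x r \<subseteq> ball (fst j) (5 * snd j)" by auto
    obtain i where i: "i \<in> I" "q i = j" using qsurj[OF j(1)] by auto
    have "\<not> i < N"
    proof
      assume "i < N"
      moreover have "cball x r \<subseteq> ball x e" using r by auto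
      ultimately have "cball x r \<inter> B i = {}" using e(2) by blast
      then show False using j(2) i by (auto simp: B_def disjnt_def)
    qed
    then obtain k where k: "i = k + N" by (metis add.commute le_Suc_ex not_less)
    have "x \<in> cball x r" using F[OF r(2)] by simp
    then have "x \<in> ball (fst j) (5 * snd j)" using j(3) by (rule subsetD[rotated])
    then have "x \<in> cball (fst (q (k + N))) (5 * R (k + N))" using i k by (simp add: R_def)
    then show "x \<in> (\<Union>i. cball (fst (q (i + N))) (5 * R (i + N)))" by blast
  qed
  have null: "hausdorff1_outer (E - (\<Union>i. B i)) \<le> 0"
  proof (rule hausdorff1_outer_leI, rule ennreal_le_epsilon)
    fix \<delta> e :: real assume \<delta>: "0 < \<delta>" and e: "0 < e"
    \<comment> \<open>The enlarged balls have diameter \<open>10 * R\<close>; each must be at most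
      \<open>\<delta>\<close> and their sum at most \<open>e\<close>.\<close>
    obtain N where N: "(\<Sum>i. m (i + N)) < min e \<delta> / 10" using tail[of "min e \<delta> / 10"] \<delta> e by auto
    have Rs: "R (i + N) \<le> (\<Sum>i. m (i + N))" for i
    proof -
      have "m (i + N) \<le> (\<Sum>i. m (i + N))"
        using sum_le_suminf[OF smN[of N], of "{i}"] by (simp add: m_def)
      then show ?thesis using Rm[of "i + N"] by simp
    qed
    have dm: "diameter (cball (fst (q (i + N))) (5 * R (i + N))) = 10 * R (i + N)" for i
      using R0[of "i + N"] by simp
    have "hausdorff1_pre \<delta> (E - (\<Union>i. B i)) \<le> (\<Sum>i. ennreal (diameter (cball (fst (q (i + N))) (5 * R (i + N)))))"
    proof (rule hausdorff1_pre_le[OF cov])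
      show "diameter (cball (fst (q (i + N))) (5 * R (i + N))) \<le> \<delta>" for i
        using Rs[of i] N unfolding dm by linarith
    qed (rule bounded_cball)
    also have "\<dots> = (\<Sum>i. ennreal (10 * R (i + N)))" by (simp only: dm)
    also have "\<dots> = ennreal (\<Sum>i. 10 * R (i + N))"
      using R0 RmN by (intro suminf_ennreal2) (auto intro: summable_mult)
    also have "\<dots> \<le> ennreal e"
    proof (rule ennreal_leI)
      have "(\<Sum>i. 10 * R (i + N)) = 10 * (\<Sum>i. R (i + N))" by (rule suminf_mult[OF RmN])
      also have "(\<Sum>i. R (i + N)) \<le> (\<Sum>i. m (i + N))" by (rule suminf_le[OF Rm RmN smN])
      finally show "(\<Sum>i. 10 * R (i + N)) \<le> e" using N by simp
    qed
    finally show "hausdorff1_pre \<delta> (E - (\<Union>i. B i)) \<le> 0 + ennreal e" by simp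
  qed
  obtain N where N: "(\<Sum>i. m (i + N)) < \<eta>" using tail[OF \<eta>] by auto
  let ?C0 = "q ` (I \<inter> {..<N})"
  show ?thesis
  proof (rule that)
    show "finite ?C0" by auto
    show "?C0 \<subseteq> F" using qC C(2) unfolding F1_def by blast
    show "pairwise (\<lambda>p q. disjnt (cball (fst p) (snd p)) (cball (fst q) (snd q))) ?C0"
      by (rule pairwise_subset[OF C(3)]) (use qC in auto)
    \<comment> \<open>The finite subfamily loses only the null set found above and the later balls,
      whose mass in \<open>K\<close> is a tail.\<close>
    have "E - (\<Union>p\<in>?C0. cball (fst p) (snd p)) \<subseteq> (E - (\<Union>i. B i)) \<union> (\<Union>i. K \<inter> B (i + N))"
    proof
      fix x assume x: "x \<in> E - (\<Union>p\<in>?C0. cball (fst p) (snd p))"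
      show "x \<in> (E - (\<Union>i. B i)) \<union> (\<Union>i. K \<inter> B (i + N))"
      proof (cases "x \<in> (\<Union>i. B i)")
        case True
        then obtain i where i: "x \<in> B i" by auto
        then have "\<not> i < N" using x by (auto simp: B_def split: if_splits)
        then obtain k where "i = k + N" by (metis add.commute le_Suc_ex not_less)
        then show ?thesis using i x EK by blast
      qed (use x in auto)
    qed
    then have "hausdorff1_outer (E - (\<Union>p\<in>?C0. cball (fst p) (snd p)))
        \<le> hausdorff1_outer (E - (\<Union>i. B i)) + hausdorff1_outer (\<Union>i. K \<inter> B (i + N))"
      by (rule order_trans[OF hausdorff1_outer_mono hausdorff1_outer_Un])
    also have "\<dots> \<le> 0 + (\<Sum>i. hausdorff1_outer (K \<inter> B (i + N)))"
      by (intro add_mono null hausdorff1_outer_UN)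
    also have "\<dots> = (\<Sum>i. ennreal (m (i + N)))" by (simp add: emB)
    also have "\<dots> = ennreal (\<Sum>i. m (i + N))"
      using smN by (intro suminf_ennreal2) (auto simp: m_def)
    also have "\<dots> < ennreal \<eta>" using N by (intro ennreal_lessI \<eta>)
    finally show "hausdorff1_outer (E - (\<Union>p\<in>?C0. cball (fst p) (snd p))) < ennreal \<eta>" .
  qed
qed

text \<open>A shift of the centre by less than \<open>d\<close> is paid for by enlarging the radius
  by \<open>d\<close>; the strict inequalities leave room for it. Openness makes the set of points
  of high density Borel.\<close>

lemma open_large_cball_mass:
  fixes M :: "'a::metric_space measure"
  assumes M: "finite_measure M" "sets M = sets borel"
  shows "open {x. \<exists>r>0. r < \<eta> \<and> c * r < measure M (cball x r)}"
proof (rule openI)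
  interpret finite_measure M by (rule M)
  fix x assume "x \<in> {x. \<exists>r>0. r < \<eta> \<and> c * r < measure M (cball x r)}"
  then obtain r where r: "0 < r" "r < \<eta>" "c * r < measure M (cball x r)" by auto
  define d where "d = min ((\<eta> - r) / 2) ((measure M (cball x r) - c * r) / (2 * (\<bar>c\<bar> + 1)))"
  have d: "d > 0" using r by (simp add: d_def)
  have d1: "r + d < \<eta>" using r by (simp add: d_def min_def field_simps)
  have "c * d \<le> (\<bar>c\<bar> + 1) * d" using d by (intro mult_right_mono) auto
  also have "\<dots> \<le> (\<bar>c\<bar> + 1) * ((measure M (cball x r) - c * r) / (2 * (\<bar>c\<bar> + 1)))"
    by (intro mult_left_mono) (auto simp: d_def)
  also have "\<dots> = (measure M (cball x r) - c * r) / 2" by (simp add: field_simps)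
  finally have "c * (r + d) < measure M (cball x r)" using r by (simp add: algebra_simps)
  then have *: "c * (r + d) < measure M (cball y (r + d))" if "y \<in> ball x d" for y
  proof -
    have "cball x r \<subseteq> cball y (r + d)"
    proof
      fix z assume "z \<in> cball x r"
      then show "z \<in> cball y (r + d)" using that dist_triangle[of y z x] by (auto simp: dist_commute)
    qed
    then have "measure M (cball x r) \<le> measure M (cball y (r + d))"
      using M(2) by (intro finite_measure_mono) auto
    with \<open>c * (r + d) < measure M (cball x r)\<close> show ?thesis by simp
  qed
  show "\<exists>e>0. ball x e \<subseteq> {x. \<exists>r>0. r < \<eta> \<and> c * r < measure M (cball x r)}"
    using d d1 r(1) * by (intro exI[of _ d]) (auto intro!: exI[of _ "r + d"])
qed

text \<open>Let \<open>D\<close> be the set where the density exceeds \<open>1 + e\<close> at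
  arbitrarily small radii. Disjoint balls of this kind inside an open \<open>V\<close> cover
  \<open>D\<close> up to a small rest, and their diameters sum to at most the mass of
  \<open>V\<close> divided by \<open>1 + e\<close>. With \<open>V\<close> hardly heavier than
  \<open>D\<close>, the mass of \<open>D\<close> is at most itself divided by \<open>1 + e\<close>,
  hence 0.\<close>

theorem AE_upper_density_le_1:
  fixes K :: "'a::euclidean_space set"
  assumes K: "K \<in> sets borel" "hausdorff1_outer K < \<infinity>"
  shows "AE x in H1_on K. \<forall>e>0. \<exists>\<eta>>0. \<forall>r. 0 < r \<longrightarrow> r < \<eta> \<longrightarrow> measure (H1_on K) (cball x r) \<le> (1 + e) * (2 * r)"
proof -
  interpret M: finite_measure "H1_on K" by (rule finite_measure_H1_on[OF K])
  let ?m = "measure (H1_on K)"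
  have emM: "hausdorff1_outer (K \<inter> B) = ennreal (?m B)" if "B \<in> sets borel" for B
    using emeasure_H1_on[OF K(1) that] by (simp add: M.emeasure_eq_measure)
  have *: "AE x in H1_on K. \<exists>\<eta>>0. \<forall>r. 0 < r \<longrightarrow> r < \<eta> \<longrightarrow> ?m (cball x r) \<le> (1 + e) * (2 * r)"
    if e: "0 < e" for e
  proof -
    define U where "U n = {x. \<exists>r>0. r < inverse (real (Suc n)) \<and> ((1 + e) * 2) * r < ?m (cball x r)}" for n
    have oU: "open (U n)" for n unfolding U_def by (rule open_large_cball_mass) (auto intro: M.finite_measure_axioms)
    define D where "D = (\<Inter>n. U n)"
    have D [measurable]: "D \<in> sets borel" unfolding D_def using oU by auto
    have D_small: "\<exists>r<\<eta>. 0 < r \<and> (1 + e) * (2 * r) < ?m (cball x r)" if "x \<in> D" "\<eta> > 0" for x \<eta>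
    proof -
      obtain n where "inverse (real (Suc n)) < \<eta>" using reals_Archimedean \<open>\<eta> > 0\<close> by blast
      moreover have "x \<in> U n" using that by (auto simp: D_def)
      then obtain r where "0 < r" "r < inverse (real (Suc n))" "((1 + e) * 2) * r < ?m (cball x r)"
        unfolding U_def by blast
      ultimately show ?thesis by (intro exI[of _ r]) (auto simp: algebra_simps)
    qed
    \<comment> \<open>\<open>h\<close> is spent twice: on the excess of \<open>V\<close> over
      \<open>D\<close> and on the part of \<open>D\<close> that the balls miss.\<close>
    have key: "(1 + e) * ?m D \<le> ?m D + h + (1 + e) * h" if h: "0 < h" for h
    proof -
      obtain V where V: "D \<subseteq> V" "open V" "emeasure (H1_on K) V < ?m D + ennreal h"
      proof -
        have "emeasure (H1_on K) D = (INF V\<in>{V. D \<subseteq> V \<and> open V}. emeasure (H1_on K) V)"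
          by (rule outer_regular) (auto simp: M.emeasure_finite[simplified])
        moreover have "emeasure (H1_on K) D < ?m D + ennreal h"
          using h by (simp add: M.emeasure_eq_measure ennreal_plus[symmetric] ennreal_less_iff del: ennreal_plus)
        ultimately show ?thesis using that by (auto simp: INF_less_iff)
      qed
      have V': "?m V \<le> ?m D + h"
        using V(3) h by (simp add: M.emeasure_eq_measure ennreal_plus[symmetric] ennreal_less_iff del: ennreal_plus)
      have "hausdorff1_outer (D \<inter> K) \<le> ennreal ((?m D + h) / (1 + e) + h)"
      proof (rule hausdorff1_outer_leI)
        fix \<delta> :: real assume \<delta>: "0 < \<delta>"
        define F where "F = {(x, r). 0 < r \<and> 2 * r \<le> \<delta> \<and> cball x r \<subseteq> V \<and> (1 + e) * (2 * r) < ?m (cball x r)}"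
        obtain C where C: "finite C" "C \<subseteq> F"
          "pairwise (\<lambda>p q. disjnt (cball (fst p) (snd p)) (cball (fst q) (snd q))) C"
          "hausdorff1_outer (D \<inter> K - (\<Union>p\<in>C. cball (fst p) (snd p))) < ennreal h"
        proof (rule vitali_hausdorff1[OF K, of "D \<inter> K" F h])
          fix x r assume "(x, r) \<in> F"
          then have r: "0 < r" "(1 + e) * (2 * r) < ?m (cball x r)" by (auto simp: F_def)
          have "r \<le> (1 + e) * (2 * r)" using r(1) e by (simp add: algebra_simps)
          with r(2) have "r \<le> ?m (cball x r)" by linarith
          with r(1) show "0 < r \<and> ennreal r \<le> hausdorff1_outer (K \<inter> cball x r)"
            by (auto simp: emM intro!: ennreal_leI)
        next
          fix x \<eta> :: real and y :: 'a
          assume y: "y \<in> D \<inter> K" and \<eta>: "0 < \<eta>"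
          obtain d where d: "d > 0" "ball y d \<subseteq> V" using V y by (meson IntD1 openE subsetD)
          have "min (min \<eta> d) (\<delta> / 2) > 0" using \<eta> d \<delta> by auto
          from D_small[OF _ this, of y] y obtain r where
            r: "r < \<eta>" "r < d" "2 * r < \<delta>" "0 < r" "(1 + e) * (2 * r) < ?m (cball y r)" by auto
          moreover have "cball y r \<subseteq> V" using r d by (auto simp: subset_iff)
          ultimately show "\<exists>r<\<eta>. (y, r) \<in> F" by (auto simp: F_def)
        qed (use h in auto)
        let ?U = "\<Union>p\<in>C. cball (fst p) (snd p)"
        have Cb: "0 < snd p" "2 * snd p \<le> \<delta>" "cball (fst p) (snd p) \<subseteq> V"
          "2 * snd p \<le> ?m (cball (fst p) (snd p)) / (1 + e)" if "p \<in> C" for p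
        proof -
          have "p \<in> F" using C(2) that by blast
          then have "0 < snd p \<and> 2 * snd p \<le> \<delta> \<and> cball (fst p) (snd p) \<subseteq> V \<and>
            (1 + e) * (2 * snd p) < ?m (cball (fst p) (snd p))"
            by (simp add: F_def case_prod_beta)
          then show "0 < snd p" "2 * snd p \<le> \<delta>" "cball (fst p) (snd p) \<subseteq> V"
            "2 * snd p \<le> ?m (cball (fst p) (snd p)) / (1 + e)"
            using e by (blast, blast, blast, simp add: field_simps)
        qed
        have "hausdorff1_pre \<delta> (D \<inter> K) \<le> hausdorff1_pre \<delta> (?U \<union> (D \<inter> K - ?U))"
          by (rule hausdorff1_pre_mono) auto
        also have "\<dots> \<le> hausdorff1_pre \<delta> ?U + hausdorff1_pre \<delta> (D \<inter> K - ?U)"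
          by (rule hausdorff1_pre_Un[OF \<delta>])
        also have "\<dots> \<le> (\<Sum>p\<in>C. ennreal (diameter (cball (fst p) (snd p)))) + ennreal h"
          using C(4) hausdorff1_pre_le_outer[OF \<delta>, of "D \<inter> K - ?U"] Cb(2) less_imp_le[OF \<delta>]
          by (intro add_mono hausdorff1_pre_finite_UN_le C(1) \<delta>) (auto intro: order_trans less_imp_le)
        also have "(\<Sum>p\<in>C. ennreal (diameter (cball (fst p) (snd p)))) = (\<Sum>p\<in>C. ennreal (2 * snd p))"
          using Cb(1) by (intro sum.cong) (auto dest: less_imp_le simp: not_less[symmetric])
        also have "\<dots> = ennreal (\<Sum>p\<in>C. 2 * snd p)"
          using Cb(1) by (intro sum_ennreal) (auto intro: less_imp_le)
        also have "\<dots> + ennreal h = ennreal ((\<Sum>p\<in>C. 2 * snd p) + h)"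
          using h Cb(1) by (intro ennreal_plus[symmetric] sum_nonneg) (auto intro: less_imp_le)
        also have "\<dots> \<le> ennreal ((?m D + h) / (1 + e) + h)"
        proof (intro ennreal_leI add_right_mono)
          have "(\<Sum>p\<in>C. 2 * snd p) \<le> (\<Sum>p\<in>C. ?m (cball (fst p) (snd p)) / (1 + e))"
            by (rule sum_mono) (rule Cb(4))
          also have "\<dots> = (\<Sum>p\<in>C. ?m (cball (fst p) (snd p))) / (1 + e)" by (simp add: sum_divide_distrib)
          also have "(\<Sum>p\<in>C. ?m (cball (fst p) (snd p))) = ?m ?U"
            using C(1,3) by (intro M.finite_measure_finite_Union[symmetric])
              (auto simp: disjoint_family_on_def pairwise_def disjnt_def)
          also have "?m ?U / (1 + e) \<le> (?m D + h) / (1 + e)"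
          proof (intro divide_right_mono)
            have "?m ?U \<le> ?m V" using Cb(3) V(2) by (intro M.finite_measure_mono) auto
            then show "?m ?U \<le> ?m D + h" using V' by simp
          qed (use e in auto)
          finally show "(\<Sum>p\<in>C. 2 * snd p) \<le> (?m D + h) / (1 + e)" .
        qed
        finally show "hausdorff1_pre \<delta> (D \<inter> K) \<le> ennreal ((?m D + h) / (1 + e) + h)" .
      qed
      then have "ennreal (?m D) \<le> ennreal ((?m D + h) / (1 + e) + h)"
        using emM[OF D] by (simp only: Int_commute)
      moreover have "0 \<le> (?m D + h) / (1 + e) + h" using h e by simp
      ultimately have "?m D \<le> (?m D + h) / (1 + e) + h" by (simp only: ennreal_le_iff)
      then show ?thesis using e by (simp add: field_simps)
    qed
    have "e * ?m D \<le> 0"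
    proof (rule field_le_epsilon)
      fix z :: real assume "0 < z"
      define h where "h = z / (2 + e)"
      have h: "0 < h" "(2 + e) * h = z" using \<open>0 < z\<close> e by (simp_all add: h_def)
      from key[OF h(1)] have "e * ?m D \<le> (2 + e) * h" by (simp add: algebra_simps)
      then show "e * ?m D \<le> 0 + z" using h(2) by simp
    qed
    then have "?m D = 0" using e by (simp add: mult_le_0_iff order_antisym)
    then have "hausdorff1_outer {x \<in> K. x \<in> D} = 0" using emM[OF D] by (simp add: Int_def)
    then have "AE x in H1_on K. x \<notin> D" using K(1) by (intro AE_H1_onI) auto
    then show ?thesis
    proof (rule AE_mp, intro AE_I2 impI)
      fix x assume "x \<notin> D"
      then obtain n where "x \<notin> U n" by (auto simp: D_def)
      then show "\<exists>\<eta>>0. \<forall>r. 0 < r \<longrightarrow> r < \<eta> \<longrightarrow> ?m (cball x r) \<le> (1 + e) * (2 * r)"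
        by (intro exI[of _ "inverse (real (Suc n))"])
          (auto simp: U_def not_less algebra_simps dest: linorder_not_less[THEN iffD2])
    qed
  qed
  have "AE x in H1_on K. \<forall>k::nat. \<exists>\<eta>>0. \<forall>r. 0 < r \<longrightarrow> r < \<eta> \<longrightarrow> ?m (cball x r) \<le> (1 + inverse (real (Suc k))) * (2 * r)"
    unfolding AE_all_countable by (intro allI *) simp
  then show ?thesis
  proof (rule AE_mp, intro AE_I2 impI allI)
    fix x and e :: real
    assume x: "\<forall>k::nat. \<exists>\<eta>>0. \<forall>r. 0 < r \<longrightarrow> r < \<eta> \<longrightarrow> ?m (cball x r) \<le> (1 + inverse (real (Suc k))) * (2 * r)"
      and e: "0 < e"
    obtain k where k: "inverse (real (Suc k)) < e" using reals_Archimedean e by blast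
    from x obtain \<eta> where \<eta>: "\<eta> > 0"
      "\<And>r. 0 < r \<Longrightarrow> r < \<eta> \<Longrightarrow> ?m (cball x r) \<le> (1 + inverse (real (Suc k))) * (2 * r)" by blast
    have "?m (cball x r) \<le> (1 + e) * (2 * r)" if "0 < r" "r < \<eta>" for r
    proof -
      have "(1 + inverse (real (Suc k))) * (2 * r) \<le> (1 + e) * (2 * r)"
        using k that by (intro mult_right_mono) auto
      with \<eta>(2)[OF that] show ?thesis by linarith
    qed
    with \<eta>(1) show "\<exists>\<eta>>0. \<forall>r. 0 < r \<longrightarrow> r < \<eta> \<longrightarrow> ?m (cball x r) \<le> (1 + e) * (2 * r)" by blast
  qed
qed

subsection \<open>Differentiability of Lipschitz curves\<close>

lemma has_real_derivativeI_average:
  fixes F :: "real \<Rightarrow> real"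
  assumes right: "\<And>e. 0 < e \<Longrightarrow> \<exists>d>0. \<forall>h. 0 < h \<and> h < d \<longrightarrow> \<bar>(F (x + h) - F x) / h - D\<bar> < e"
    and left: "\<And>e. 0 < e \<Longrightarrow> \<exists>d>0. \<forall>h. 0 < h \<and> h < d \<longrightarrow> \<bar>(F x - F (x - h)) / h - D\<bar> < e"
  shows "(F has_real_derivative D) (at x)"
  unfolding DERIV_def
proof (rule LIM_I)
  fix e :: real assume "0 < e"
  from right[OF this] left[OF this] obtain d1 d2 where d: "d1 > 0" "d2 > 0"
    "\<And>h. 0 < h \<Longrightarrow> h < d1 \<Longrightarrow> \<bar>(F (x + h) - F x) / h - D\<bar> < e"
    "\<And>h. 0 < h \<Longrightarrow> h < d2 \<Longrightarrow> \<bar>(F x - F (x - h)) / h - D\<bar> < e" by blast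
  have "\<bar>(F (x + h) - F x) / h - D\<bar> < e" if h: "h \<noteq> 0" "\<bar>h\<bar> < min d1 d2" for h
  proof (cases "h > 0")
    case True with d(3)[of h] h show ?thesis by simp
  next
    case False
    then have "(F (x + h) - F x) / h = (F x - F (x - (- h))) / (- h)" using h by (simp add: field_simps)
    then show ?thesis using d(4)[of "- h"] h False by simp
  qed
  then show "\<exists>s>0. \<forall>h. h \<noteq> 0 \<and> norm (h - 0) < s \<longrightarrow> norm ((F (x + h) - F x) / h - D) < e"
    using d(1,2) by (intro exI[of _ "min d1 d2"]) auto
qed

text \<open>The Lipschitz bound makes the Stieltjes measure of \<open>F\<close> absolutely
  continuous. So \<open>F\<close> is an indefinite integral of a density \<open>g\<close>, and
  Lebesgue differentiation applies.\<close>

lemma negligible_not_differentiable_mono_lipschitz: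
  fixes F :: "real \<Rightarrow> real"
  assumes mono: "\<And>x y. x \<le> y \<Longrightarrow> F x \<le> F y"
    and lip: "\<And>x y. x \<le> y \<Longrightarrow> F y - F x \<le> L * (y - x)" and L: "0 < L"
  obtains N where "negligible N" "\<And>x. x \<notin> N \<Longrightarrow> \<exists>D. (F has_real_derivative D) (at x)"
proof -
  have cont: "continuous_on UNIV F"
  proof (rule continuous_on_iff[THEN iffD2], intro ballI allI impI)
    fix x e :: real assume "0 < e"
    have "dist (F y) (F x) \<le> L * dist y x" for y
      using lip[of x y] lip[of y x] mono[of x y] mono[of y x] by (cases "x \<le> y") (auto simp: dist_real_def)
    moreover have "L * dist y x < e" if "dist y x < e / L" for y
      using that L by (simp add: field_simps)
    ultimately show "\<exists>d>0. \<forall>y\<in>UNIV. dist y x < d \<longrightarrow> dist (F y) (F x) < e"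
      using L \<open>0 < e\<close> by (intro exI[of _ "e / L"]) (auto intro: le_less_trans)
  qed
  let ?\<mu> = "interval_measure F"
  have Icc: "emeasure ?\<mu> {a..b} = ennreal (F b - F a)" if "a \<le> b" for a b
    by (rule emeasure_interval_measure_Icc[OF that mono cont])
  have "absolutely_continuous lborel ?\<mu>"
    unfolding absolutely_continuous_def
  proof
    fix N :: "real set" assume N: "N \<in> null_sets lborel"
    then have Nb: "N \<in> sets borel" and N0: "hausdorff1_outer N = 0" by (auto simp: null_sets_def hausdorff1_outer_real)
    have "emeasure ?\<mu> N \<le> 0"
    proof (rule ennreal_le_epsilon)
      fix e :: real assume e: "0 < e"
      have "hausdorff1_pre 1 N < ennreal (e / L)"
        using hausdorff1_pre_le_outer[of 1 N] N0 e L by simp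
      then obtain C :: "nat \<Rightarrow> real set" where C: "N \<subseteq> (\<Union>i. C i)" "\<And>i. bounded (C i)"
        "(\<Sum>i. ennreal (diameter (C i))) < ennreal (e / L)"
        unfolding hausdorff1_pre_less_iff by auto
      have "\<exists>a b. C i \<subseteq> {a..b} \<and> a \<le> b \<and> b - a \<le> diameter (C i)" for i
        using bounded_real_subset_Icc[OF C(2)[of i]] by metis
      then obtain a b where ab: "\<And>i. C i \<subseteq> {a i..b i}" "\<And>i. a i \<le> b i" "\<And>i. b i - a i \<le> diameter (C i)"
        by metis
      have "emeasure ?\<mu> N \<le> emeasure ?\<mu> (\<Union>i. {a i..b i})"
        using C(1) ab(1) by (intro emeasure_mono) fastforce+
      also have "\<dots> \<le> (\<Sum>i. emeasure ?\<mu> {a i..b i})"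
        by (rule emeasure_subadditive_countably) auto
      also have "\<dots> \<le> (\<Sum>i. ennreal L * ennreal (diameter (C i)))"
      proof (rule suminf_le)
        fix i
        have "F (b i) - F (a i) \<le> L * (b i - a i)" using lip[OF ab(2)] .
        also have "\<dots> \<le> L * diameter (C i)" using ab(3) L by (intro mult_left_mono) auto
        finally show "emeasure ?\<mu> {a i..b i} \<le> ennreal L * ennreal (diameter (C i))"
          using L ab(2) diameter_ge_0[OF C(2)[of i]]
          by (simp add: Icc ennreal_mult[symmetric] ennreal_leI)
      qed auto
      also have "\<dots> = ennreal L * (\<Sum>i. ennreal (diameter (C i)))" by simp
      also have "\<dots> \<le> ennreal L * ennreal (e / L)" using C(3) by (intro mult_left_mono) auto
      also have "\<dots> = ennreal e" using L e by (simp add: ennreal_mult[symmetric])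
      finally show "emeasure ?\<mu> N \<le> 0 + ennreal e" by simp
    qed
    then show "N \<in> null_sets ?\<mu>" using Nb by (simp add: null_sets_def)
  qed
  from sigma_finite_measure.Radon_Nikodym[OF sigma_finite_lborel this] obtain h where h [measurable]: "h \<in> borel_measurable borel"
    and dens: "density lborel h = ?\<mu>" by auto
  have int_h: "(\<integral>\<^sup>+x. h x * indicator {a..b} x \<partial>lborel) = ennreal (F b - F a)" if "a \<le> b" for a b
    using Icc[OF that] unfolding dens[symmetric] by (simp add: emeasure_density)
  have "AE x in lborel. h x * indicator {- real n..real n} x \<noteq> \<infinity>" for n :: nat
    by (rule nn_integral_noteq_infinite) (simp_all add: int_h)
  then have "AE x in lborel. \<forall>n::nat. h x * indicator {- real n..real n} x \<noteq> \<infinity>"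
    by (simp add: AE_all_countable)
  then have fin: "AE x in lborel. h x \<noteq> \<infinity>"
  proof (rule AE_mp, intro AE_I2 impI)
    fix x :: real assume x: "\<forall>n::nat. h x * indicator {- real n..real n} x \<noteq> \<infinity>"
    obtain n :: nat where "\<bar>x\<bar> \<le> n" using real_arch_simple by blast
    then have "x \<in> {- real n..real n}" by auto
    with x[rule_format, of n] show "h x \<noteq> \<infinity>" by simp
  qed
  define g where "g x = enn2real (h x)" for x
  have g: "(g has_integral (F b - F a)) {a..b}" if "a \<le> b" for a b
  proof -
    have "((\<lambda>x. g x * indicator {a..b} x) has_integral (F b - F a)) UNIV"
    proof (rule nn_integral_has_integral)
      have "(\<integral>\<^sup>+x. ennreal (g x * indicator {a..b} x) \<partial>lborel) = (\<integral>\<^sup>+x. h x * indicator {a..b} x \<partial>lborel)"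
        using fin by (intro nn_integral_cong_AE) (auto simp: g_def indicator_def less_top)
      then show "(\<integral>\<^sup>+x. ennreal (g x * indicator {a..b} x) \<partial>lborel) = ennreal (F b - F a)"
        using int_h[OF that] by simp
    qed (use that mono in \<open>auto simp: g_def\<close>)
    then have "((\<lambda>x. if x \<in> {a..b} then g x else 0) has_integral (F b - F a)) UNIV"
      by (rule has_integral_eq[rotated]) auto
    then show ?thesis by (simp only: has_integral_restrict_UNIV)
  qed
  have ig: "g integrable_on cbox a b" for a b
    using g[of a b] by (cases "a \<le> b") (auto simp: box_real)
  obtain N1 where N1: "negligible N1"
    "\<And>x e. \<lbrakk>x \<notin> N1; 0 < e\<rbrakk> \<Longrightarrow> \<exists>d>0. \<forall>h. 0 < h \<and> h < d \<longrightarrow>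
       norm (integral (cbox x (x + h *\<^sub>R One)) g /\<^sub>R h ^ DIM(real) - g x) < e"
    using integrable_ccontinuous_explicit[OF ig] by metis
  \<comment> \<open>Averages are taken over intervals \<open>[x, x + h]\<close>; the reflected
    density supplies the left difference quotients.\<close>
  have g': "((\<lambda>x. g (- x)) has_integral (F (- a) - F (- b))) {a..b}" if "a \<le> b" for a b
    using g[of "- b" "- a"] that has_integral_reflect_real[of g "F (- a) - F (- b)" "- a" "- b"] by simp
  have ig': "(\<lambda>x. g (- x)) integrable_on cbox a b" for a b
    using g'[of a b] by (cases "a \<le> b") (auto simp: box_real)
  obtain N2 where N2: "negligible N2"
    "\<And>x e. \<lbrakk>x \<notin> N2; 0 < e\<rbrakk> \<Longrightarrow> \<exists>d>0. \<forall>h. 0 < h \<and> h < d \<longrightarrow>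
       norm (integral (cbox x (x + h *\<^sub>R One)) (\<lambda>x. g (- x)) /\<^sub>R h ^ DIM(real) - g (- x)) < e"
    using integrable_ccontinuous_explicit[OF ig'] by metis
  show ?thesis
  proof (rule that[of "N1 \<union> uminus ` N2"])
    have "(uminus :: real \<Rightarrow> real) differentiable_on N2" by (intro derivative_intros)
    then show "negligible (N1 \<union> uminus ` N2)"
      using N1(1) N2(1) by (intro negligible_Un negligible_differentiable_image_negligible) auto
  next
    fix x assume "x \<notin> N1 \<union> uminus ` N2"
    then have x: "x \<notin> N1" "- x \<notin> N2" by force+
    have "(F has_real_derivative g x) (at x)"
    proof (rule has_real_derivativeI_average)
      fix e :: real assume "0 < e"
      from N1(2)[OF x(1) this] obtain d where d: "d > 0" "\<And>h. 0 < h \<Longrightarrow> h < d \<Longrightarrow>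
        \<bar>integral {x..x + h} g / h - g x\<bar> < e" by (auto simp: box_real divide_inverse mult.commute)
      show "\<exists>d>0. \<forall>h. 0 < h \<and> h < d \<longrightarrow> \<bar>(F (x + h) - F x) / h - g x\<bar> < e"
        using d integral_unique[OF g] by (intro exI[of _ d]) auto
    next
      fix e :: real assume "0 < e"
      from N2(2)[OF x(2) this] obtain d where d: "d > 0" "\<And>h. 0 < h \<Longrightarrow> h < d \<Longrightarrow>
        \<bar>integral {- x..- x + h} (\<lambda>x. g (- x)) / h - g x\<bar> < e" by (auto simp: box_real divide_inverse mult.commute)
      have "integral {- x..- x + h} (\<lambda>x. g (- x)) = F x - F (x - h)" if "0 < h" for h
        using integral_unique[OF g'[of "- x" "- x + h"]] that by simp
      then show "\<exists>d>0. \<forall>h. 0 < h \<and> h < d \<longrightarrow> \<bar>(F x - F (x - h)) / h - g x\<bar> < e"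
        using d by (intro exI[of _ d]) auto
    qed
    then show "\<exists>D. (F has_real_derivative D) (at x)" ..
  qed
qed

lemma negligible_not_differentiable_lipschitz_real:
  fixes f :: "real \<Rightarrow> real"
  assumes "\<And>x y. dist (f x) (f y) \<le> L * dist x y" "0 < L"
  obtains N where "negligible N" "\<And>x. x \<notin> N \<Longrightarrow> \<exists>D. (f has_real_derivative D) (at x)"
proof -
  \<comment> \<open>The added linear term makes the function monotone, at the price of the Lipschitz
    constant \<open>2 * L\<close>.\<close>
  define F where "F x = f x + L * x" for x
  have *: "\<bar>f y - f x\<bar> \<le> L * (y - x)" if "x \<le> y" for x y
    using assms(1)[of y x] that by (simp add: dist_real_def)
  obtain N where N: "negligible N" "\<And>x. x \<notin> N \<Longrightarrow> \<exists>D. (F has_real_derivative D) (at x)"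
  proof (rule negligible_not_differentiable_mono_lipschitz[of F "2 * L"])
    fix x y :: real assume "x \<le> y"
    from *[OF this] show "F x \<le> F y" "F y - F x \<le> 2 * L * (y - x)"
      by (auto simp: F_def algebra_simps abs_le_iff)
  qed (use assms in auto)
  show ?thesis
  proof (rule that[OF N(1)])
    fix x assume "x \<notin> N"
    then obtain D where "(F has_real_derivative D) (at x)" using N(2) by blast
    then have "((\<lambda>x. F x - L * x) has_real_derivative (D - L * 1)) (at x)"
      by (intro derivative_intros) auto
    then show "\<exists>D. (f has_real_derivative D) (at x)" by (auto simp: F_def)
  qed
qed

theorem negligible_not_differentiable_lipschitz:
  fixes f :: "real \<Rightarrow> 'a::euclidean_space"
  assumes lip: "\<And>x y. dist (f x) (f y) \<le> L * dist x y" "0 < L"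
  obtains N where "negligible N" "\<And>x. x \<notin> N \<Longrightarrow> \<exists>D. (f has_vector_derivative D) (at x)"
proof -
  have "\<exists>N. negligible N \<and> (\<forall>x. x \<notin> N \<longrightarrow> (\<exists>D. ((\<lambda>t. f t \<bullet> b) has_real_derivative D) (at x)))" if "b \<in> Basis" for b
  proof -
    have "dist (f x \<bullet> b) (f y \<bullet> b) \<le> L * dist x y" for x y
      using Basis_le_norm[OF that, of "f x - f y"] lip(1)[of x y] by (simp add: dist_norm inner_diff_left)
    from negligible_not_differentiable_lipschitz_real[OF this lip(2)] show ?thesis by metis
  qed
  then obtain N where N: "\<And>b. b \<in> Basis \<Longrightarrow> negligible (N b)"
    "\<And>b x. b \<in> Basis \<Longrightarrow> x \<notin> N b \<Longrightarrow> \<exists>D. ((\<lambda>t. f t \<bullet> b) has_real_derivative D) (at x)" by metis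
  show ?thesis
  proof (rule that[of "\<Union>b\<in>Basis. N b"])
    show "negligible (\<Union>b\<in>Basis. N b)" using N(1) by (intro negligible_Union) auto
    fix x assume "x \<notin> (\<Union>b\<in>Basis. N b)"
    then have "\<forall>b\<in>Basis. \<exists>D. ((\<lambda>t. f t \<bullet> b) has_real_derivative D) (at x)" using N(2) by blast
    then obtain D where D: "\<And>b. b \<in> Basis \<Longrightarrow> ((\<lambda>t. f t \<bullet> b) has_real_derivative D b) (at x)" by metis
    have "((\<lambda>t. \<Sum>b\<in>Basis. (f t \<bullet> b) *\<^sub>R b) has_vector_derivative (\<Sum>b\<in>Basis. D b *\<^sub>R b)) (at x)"
    proof (rule has_vector_derivative_sum)
      fix b :: 'a assume "b \<in> Basis"
      then show "((\<lambda>t. (f t \<bullet> b) *\<^sub>R b) has_vector_derivative D b *\<^sub>R b) (at x)"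
        using has_vector_derivative_scaleR[OF D has_vector_derivative_const[of b]] by simp
    qed
    then show "\<exists>D. (f has_vector_derivative D) (at x)" by (auto simp: euclidean_representation)
  qed
qed

section \<open>Critical and regular values of Lipschitz curves\<close>

lemma hausdorff1_outer_negligible:
  assumes "negligible N"
  shows "hausdorff1_outer (N :: real set) = 0"
proof -
  from assms obtain N' where "N' \<in> null_sets lborel" "N \<subseteq> N'"
    by (auto simp: negligible_iff_null_sets null_sets_completion_iff2)
  then show ?thesis
    using hausdorff1_outer_mono[of N N'] by (simp add: null_sets_def hausdorff1_outer_real)
qed

text \<open>A one-dimensional Sard argument: close to a critical point \<open>f\<close> contracts by
  an arbitrarily small factor \<open>c\<close>, so critical points in a bounded interval have an
  image of length at most \<open>c\<close> times the length of that interval.\<close>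

lemma hausdorff1_outer_critical_values:
  fixes f :: "real \<Rightarrow> 'a::real_normed_vector"
  assumes cont: "continuous_on UNIV f"
  shows "hausdorff1_outer (f ` {t. (f has_vector_derivative 0) (at t)}) = 0"
proof -
  let ?Z = "{t. (f has_vector_derivative 0) (at t)}"
  have cont': "continuous_on S f" for S using cont continuous_on_subset by blast
  have *: "hausdorff1_outer (f ` (?Z \<inter> {- real j..real j})) = 0" for j
  proof -
    have "hausdorff1_outer (f ` (?Z \<inter> {- real j..real j})) \<le> 0 + ennreal e" if e: "0 < e" for e
    proof -
      \<comment> \<open>The interval has length \<open>2 * real j\<close>, so the image gets length
        at most \<open>e\<close>; the summand 1 keeps the quotient meaningful for
        \<open>j = 0\<close>.\<close>
      define c where "c = e / (2 * real j + 1)"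
      have c: "0 < c" "c * (2 * real j) \<le> e" using e by (auto simp: c_def field_simps)
      \<comment> \<open>Points with slope at most \<open>c\<close> up to the scale
        \<open>1 / (k + 1)\<close>. These sets are compact and increase with \<open>k\<close>, so
        their images are Borel and continuity from below applies.\<close>
      define Zk where "Zk k = {t \<in> {- real j..real j}. \<forall>s. dist s t < inverse (real (Suc k)) \<longrightarrow> dist (f s) (f t) \<le> c * dist s t}" for k
      have "Zk k = {- real j..real j} \<inter> (\<Inter>s. {t. inverse (real (Suc k)) \<le> dist s t} \<union> {t. dist (f s) (f t) \<le> c * dist s t})" for k
        by (simp add: Zk_def set_eq_iff) (metis not_le)
      moreover have "closed ({- real j..real j} \<inter> (\<Inter>s. {t. inverse (real (Suc k)) \<le> dist s t} \<union> {t. dist (f s) (f t) \<le> c * dist s t}))" for k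
        by (intro closed_Int closed_INT ballI closed_Un closed_Collect_le continuous_intros cont') auto
      ultimately have cl: "closed (Zk k)" for k by simp
      have sub: "Zk k \<subseteq> {- real j..real j}" for k by (auto simp: Zk_def)
      have "compact (Zk k)" for k
        using cl sub compact_Icc by (metis closed_Int_compact inf.absorb_iff1)
      then have comp: "compact (f ` Zk k)" for k by (intro compact_continuous_image cont')
      have inc: "incseq (\<lambda>k. f ` Zk k)"
      proof (intro incseq_SucI image_mono)
        fix k
        have "inverse (real (Suc (Suc k))) \<le> inverse (real (Suc k))" by (rule le_imp_inverse_le) auto
        then show "Zk k \<subseteq> Zk (Suc k)" unfolding Zk_def by (blast intro: less_le_trans)
      qed
      have small: "hausdorff1_outer (f ` Zk k) \<le> ennreal e" for k
      proof -
        have "hausdorff1_outer (f ` Zk k) \<le> ennreal c * hausdorff1_outer (Zk k)"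
        proof (rule hausdorff1_outer_locally_lipschitz_image[where d = "inverse (real (Suc k)) / 2"])
          fix s t assume st: "s \<in> Zk k" "t \<in> Zk k" "dist s t \<le> inverse (real (Suc k)) / 2"
          have "0 < inverse (real (Suc k))" by simp
          with st(3) have "dist s t < inverse (real (Suc k))" by linarith
          with st(2) show "dist (f s) (f t) \<le> c * dist s t" unfolding Zk_def by blast
        qed (use c in auto)
        also have "\<dots> \<le> ennreal c * ennreal (real j - - real j)"
          by (intro mult_left_mono order_trans[OF hausdorff1_outer_mono[OF sub] hausdorff1_outer_Icc_le]) auto
        also have "\<dots> = ennreal (c * (2 * real j))" using c by (simp add: ennreal_mult[symmetric])
        also have "\<dots> \<le> ennreal e" by (rule ennreal_leI[OF c(2)])
        finally show ?thesis .
      qed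
      have "?Z \<inter> {- real j..real j} \<subseteq> (\<Union>k. Zk k)"
      proof
        fix t assume t: "t \<in> ?Z \<inter> {- real j..real j}"
        then have "(f has_derivative (\<lambda>_. 0)) (at t)" by (simp add: has_vector_derivative_def)
        then obtain d where d: "d > 0" "\<And>s. norm (s - t) < d \<Longrightarrow> norm (f s - f t) \<le> c * norm (s - t)"
          unfolding has_derivative_at_alt using c(1) by auto
        obtain k where "inverse (real (Suc k)) < d" using reals_Archimedean d(1) by blast
        then have "t \<in> Zk k" using t d(2) by (auto simp: Zk_def dist_norm)
        then show "t \<in> (\<Union>k. Zk k)" by blast
      qed
      then have "hausdorff1_outer (f ` (?Z \<inter> {- real j..real j})) \<le> hausdorff1_outer (\<Union>k. f ` Zk k)"
        by (intro hausdorff1_outer_mono) blast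
      also have "\<dots> = emeasure hausdorff1 (\<Union>k. f ` Zk k)"
        using comp by (intro emeasure_hausdorff1[symmetric] sets.countable_UN) (auto intro: borel_compact)
      also have "\<dots> = (SUP k. emeasure hausdorff1 (f ` Zk k))"
        using comp inc by (intro SUP_emeasure_incseq[symmetric]) (auto intro: borel_compact)
      also have "\<dots> \<le> ennreal e"
        using small comp by (intro SUP_least) (simp add: emeasure_hausdorff1 borel_compact)
      finally show ?thesis by simp
    qed
    then have "hausdorff1_outer (f ` (?Z \<inter> {- real j..real j})) \<le> 0" by (rule ennreal_le_epsilon)
    then show ?thesis by simp
  qed
  have "?Z \<subseteq> (\<Union>j. ?Z \<inter> {- real j..real j})"
  proof
    fix t assume "t \<in> ?Z"
    moreover obtain j :: nat where "\<bar>t\<bar> \<le> j" using real_arch_simple by blast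
    ultimately show "t \<in> (\<Union>j. ?Z \<inter> {- real j..real j})" by (auto simp: abs_le_iff intro!: exI[of _ j])
  qed
  then have "hausdorff1_outer (f ` ?Z) \<le> hausdorff1_outer (\<Union>j. f ` (?Z \<inter> {- real j..real j}))"
    by (intro hausdorff1_outer_mono) blast
  also have "\<dots> \<le> (\<Sum>j. hausdorff1_outer (f ` (?Z \<inter> {- real j..real j})))" by (rule hausdorff1_outer_UN)
  also have "\<dots> = 0" by (simp add: *)
  finally show ?thesis by simp
qed

theorem hausdorff1_outer_not_regular_value:
  fixes f :: "real \<Rightarrow> 'a::euclidean_space"
  assumes lip: "\<And>x y. dist (f x) (f y) \<le> L * dist x y" "0 < L"
  shows "hausdorff1_outer {x \<in> range f. \<not> (\<exists>t v. f t = x \<and> v \<noteq> 0 \<and> (f has_vector_derivative v) (at t))} = 0"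
proof -
  obtain N where N: "negligible N" "\<And>x. x \<notin> N \<Longrightarrow> \<exists>D. (f has_vector_derivative D) (at x)"
    using negligible_not_differentiable_lipschitz[OF lip] by metis
  let ?Z = "{t. (f has_vector_derivative 0) (at t)}"
  have cont: "continuous_on UNIV f"
  proof (rule lipschitz_on_continuous_on)
    show "L-lipschitz_on UNIV f" by (rule lipschitz_onI) (use lip in auto)
  qed
  have "hausdorff1_outer (f ` N) \<le> ennreal L * hausdorff1_outer N"
    by (rule hausdorff1_outer_lipschitz_image) (use lip in auto)
  then have "hausdorff1_outer (f ` N) = 0" using hausdorff1_outer_negligible[OF N(1)] by simp
  moreover have "{x \<in> range f. \<not> (\<exists>t v. f t = x \<and> v \<noteq> 0 \<and> (f has_vector_derivative v) (at t))} \<subseteq> f ` N \<union> f ` ?Z"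
  proof
    fix x assume x: "x \<in> {x \<in> range f. \<not> (\<exists>t v. f t = x \<and> v \<noteq> 0 \<and> (f has_vector_derivative v) (at t))}"
    then obtain t where t: "f t = x" by auto
    show "x \<in> f ` N \<union> f ` ?Z"
    proof (cases "t \<in> N")
      case False
      with N(2) obtain D where D: "(f has_vector_derivative D) (at t)" by blast
      with x t have "D = 0" by blast
      with D t show ?thesis by auto
    qed (use t in auto)
  qed
  then have "hausdorff1_outer {x \<in> range f. \<not> (\<exists>t v. f t = x \<and> v \<noteq> 0 \<and> (f has_vector_derivative v) (at t))}
      \<le> hausdorff1_outer (f ` N) + hausdorff1_outer (f ` ?Z)"
    by (rule order_trans[OF hausdorff1_outer_mono hausdorff1_outer_Un])
  ultimately show ?thesis using hausdorff1_outer_critical_values[OF cont] by simp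
qed

subsection \<open>Continua of finite length are Lipschitz curves\<close>

text \<open>The walk around a spanning tree, built directly: a new point \<open>w\<close> next to a
  visited \<open>s\<close> is spliced in as the detour \<open>s, w, s\<close>, which lengthens the
  walk by two.\<close>

lemma spanning_walk:
  fixes V :: "'a::metric_space set"
  assumes V: "finite V" "V \<noteq> {}"
    and conn: "\<And>S. S \<subseteq> V \<Longrightarrow> S \<noteq> {} \<Longrightarrow> S \<noteq> V \<Longrightarrow> \<exists>s\<in>S. \<exists>w\<in>V - S. dist s w \<le> d"
  obtains ws where "set ws = V" "length ws \<le> 2 * card V" "successively (\<lambda>a b. dist a b \<le> d) ws"
proof -
  have "\<exists>ws. set ws \<subseteq> V \<and> card (set ws) = Suc k \<and> length ws \<le> 2 * Suc k \<and>
      successively (\<lambda>a b. dist a b \<le> d) ws" if "Suc k \<le> card V" for k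
    using that
  proof (induction k)
    case 0
    obtain v where "v \<in> V" using V by auto
    then show ?case by (intro exI[of _ "[v]"]) auto
  next
    case (Suc k)
    then obtain ws where ws: "set ws \<subseteq> V" "card (set ws) = Suc k" "length ws \<le> 2 * Suc k"
      "successively (\<lambda>a b. dist a b \<le> d) ws" by auto
    have "set ws \<noteq> {}" "set ws \<noteq> V" using ws(2) Suc.prems by auto
    then obtain s w where sw: "s \<in> set ws" "w \<in> V" "w \<notin> set ws" "dist s w \<le> d"
      using conn[OF ws(1)] by blast
    then obtain as bs where ab: "ws = as @ s # bs" by (meson split_list)
    have "successively (\<lambda>a b. dist a b \<le> d) (as @ s # w # s # bs)"
      using ws(4) sw(4) unfolding ab by (auto simp: successively_append_iff dist_commute)
    moreover have "set (as @ s # w # s # bs) = insert w (set ws)" unfolding ab by auto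
    moreover have "length (as @ s # w # s # bs) \<le> 2 * Suc (Suc k)" using ws(3) unfolding ab by simp
    ultimately show ?case using ws(1,2) sw(2,3)
      by (intro exI[of _ "as @ s # w # s # bs"]) (simp only: card_insert_disjoint[OF finite_set] simp_thms insert_subset)
  qed
  from this[of "card V - 1"] V obtain ws where ws: "set ws \<subseteq> V" "card (set ws) = card V"
    "length ws \<le> 2 * card V" "successively (\<lambda>a b. dist a b \<le> d) ws"
    by (auto simp: card_gt_0_iff Suc_leI)
  then have "set ws = V" using V(1) by (intro card_subset_eq) auto
  with ws that show ?thesis by blast
qed

text \<open>Balls of radius \<open>\<delta> / 3\<close> around the points of \<open>V\<close> are
  disjoint, and each contains at least the length \<open>\<delta> / 3\<close> because
  \<open>C\<close> is connected and reaches beyond it.\<close>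

lemma separated_card_le:
  fixes C :: "'a::metric_space set"
  assumes C: "compact C" "connected C" "hausdorff1_outer C < \<infinity>"
    and far: "\<And>x. x \<in> C \<Longrightarrow> \<exists>y\<in>C. \<delta> \<le> dist x y" and \<delta>: "0 < \<delta>"
    and V: "finite V" "V \<subseteq> C" "pairwise (\<lambda>v w. \<delta> < dist v w) V"
  shows "real (card V) * \<delta> \<le> 3 * measure (H1_on C) UNIV"
proof -
  have Cb: "C \<in> sets borel" using C(1) by (rule borel_compact)
  interpret M: finite_measure "H1_on C" by (rule finite_measure_H1_on[OF Cb C(3)])
  let ?B = "\<lambda>v. cball v (\<delta> / 3)"
  have "\<delta> / 3 \<le> measure (H1_on C) (?B v)" if "v \<in> V" for v
  proof -
    from far[of v] V that obtain y where "y \<in> C" "\<delta> \<le> dist v y" by auto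
    then have "ennreal (\<delta> / 3) \<le> hausdorff1_outer (C \<inter> ?B v)"
      using V that \<delta> by (intro hausdorff1_outer_connected_ge[OF C(2), of v y]) auto
    then show ?thesis using \<delta> by (simp add: emeasure_H1_on[OF Cb, symmetric] M.emeasure_eq_measure)
  qed
  then have "(\<Sum>v\<in>V. \<delta> / 3) \<le> (\<Sum>v\<in>V. measure (H1_on C) (?B v))" by (rule sum_mono)
  also have "\<dots> = measure (H1_on C) (\<Union>v\<in>V. ?B v)"
  proof (rule M.finite_measure_finite_Union[symmetric])
    show "disjoint_family_on ?B V"
      unfolding disjoint_family_on_def
    proof (intro ballI impI)
      fix v w assume "v \<in> V" "w \<in> V" "v \<noteq> w"
      then have "\<delta> < dist v w" using V(3) by (auto simp: pairwise_def)
      show "?B v \<inter> ?B w = {}"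
      proof (rule ccontr)
        assume "?B v \<inter> ?B w \<noteq> {}"
        then obtain z where "dist v z \<le> \<delta> / 3" "dist w z \<le> \<delta> / 3" by auto
        then show False using \<open>\<delta> < dist v w\<close> dist_triangle2[of v w z] \<delta> by linarith
      qed
    qed
  qed (use V in auto)
  also have "\<dots> \<le> measure (H1_on C) UNIV" by (intro M.finite_measure_mono) auto
  finally show ?thesis by simp
qed

text \<open>Counts the grid steps between two times; \<open>nat\<close> freezes the index at 0 for
  negative times, which explains the case split.\<close>

lemma floor_divide_diff:
  fixes s t \<delta> :: real
  assumes "s \<le> t" "0 < \<delta>"
  shows "\<delta> * (real (nat \<lfloor>t / \<delta>\<rfloor>) - real (nat \<lfloor>s / \<delta>\<rfloor>)) \<le> (t - s) + \<delta>"
proof -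
  have *: "real (nat \<lfloor>t / \<delta>\<rfloor>) - real (nat \<lfloor>s / \<delta>\<rfloor>) \<le> (t - s) / \<delta> + 1"
  proof (cases "0 \<le> \<lfloor>t / \<delta>\<rfloor>")
    case True
    then have "real (nat \<lfloor>t / \<delta>\<rfloor>) \<le> t / \<delta>" by simp
    moreover have "s / \<delta> - 1 \<le> real (nat \<lfloor>s / \<delta>\<rfloor>)" by linarith
    ultimately show ?thesis by (simp add: diff_divide_distrib)
  next
    case False
    then have "real (nat \<lfloor>t / \<delta>\<rfloor>) = 0" by simp
    then show ?thesis using assms by (simp add: add_nonneg_nonneg order_trans[of _ 0])
  qed
  from mult_left_mono[OF *, of \<delta>] assms show ?thesis by (simp add: distrib_left)
qed

text \<open>A maximal \<open>\<delta>\<close>-separated set is a \<open>\<delta>\<close>-net, and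
  connectedness links it by hops of at most \<open>2 * \<delta>\<close>. One hop per time
  \<open>\<delta>\<close> means speed 2, up to the jumps of a step function; at most
  \<open>2 * card V\<close> vertices are visited, within 6 times the length.\<close>

lemma approximate_curve:
  fixes C :: "'a::metric_space set"
  assumes C: "compact C" "connected C" "hausdorff1_outer C < \<infinity>" "C \<noteq> {}"
    and far: "\<And>x. x \<in> C \<Longrightarrow> \<exists>y\<in>C. \<delta> \<le> dist x y" and \<delta>: "0 < \<delta>"
  shows "\<exists>f. (\<forall>t. f t \<in> C) \<and> (\<forall>s t. dist (f s) (f t) \<le> 2 * \<bar>s - t\<bar> + 2 * \<delta>) \<and>
    (\<forall>x\<in>C. \<exists>t. 0 \<le> t \<and> t \<le> 6 * measure (H1_on C) UNIV \<and> dist x (f t) \<le> \<delta>)"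
proof -
  let ?l = "measure (H1_on C) UNIV"
  let ?sep = "\<lambda>V. finite V \<and> V \<subseteq> C \<and> pairwise (\<lambda>v w. \<delta> < dist v w) V"
  obtain c where c: "c \<in> C" using C(4) by auto
  have "\<exists>V. ?sep V \<and> (\<forall>W. ?sep W \<longrightarrow> card W \<le> card V)"
  proof (rule Lattices_Big.ex_has_greatest_nat[of _ "{}" _ "nat \<lceil>3 * ?l / \<delta>\<rceil> + 1"])
    show "\<forall>W. ?sep W \<longrightarrow> card W < nat \<lceil>3 * ?l / \<delta>\<rceil> + 1"
    proof (intro allI impI)
      fix W assume "?sep W"
      then have "real (card W) * \<delta> \<le> 3 * ?l" using separated_card_le[OF C(1-3) far \<delta>] by blast
      then have "real (card W) \<le> 3 * ?l / \<delta>" using \<delta> by (simp add: field_simps)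
      then show "card W < nat \<lceil>3 * ?l / \<delta>\<rceil> + 1" by linarith
    qed
  qed auto
  then obtain V where V: "finite V" "V \<subseteq> C" "pairwise (\<lambda>v w. \<delta> < dist v w) V"
    and max: "\<And>W. ?sep W \<Longrightarrow> card W \<le> card V" by blast
  have net: "\<exists>v\<in>V. dist v x \<le> \<delta>" if x: "x \<in> C" for x
  proof (rule ccontr)
    assume "\<not> ?thesis"
    then have *: "\<delta> < dist v x" if "v \<in> V" for v using that by (auto simp: not_le)
    then have "x \<notin> V" using \<delta> by fastforce
    have "?sep (insert x V)" using V x * by (auto simp: pairwise_insert dist_commute)
    from max[OF this] show False using V(1) \<open>x \<notin> V\<close> by simp
  qed
  have "V \<noteq> {}" using net[OF c] by auto
  obtain ws where ws: "set ws = V" "length ws \<le> 2 * card V" "successively (\<lambda>a b. dist a b \<le> 2 * \<delta>) ws"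
  proof (rule spanning_walk[OF V(1) \<open>V \<noteq> {}\<close>, of "2 * \<delta>"])
    fix S assume S: "S \<subseteq> V" "S \<noteq> {}" "S \<noteq> V"
    let ?N = "\<lambda>S. \<Union>v\<in>S. cball v \<delta>"
    have "finite S" using S V(1) finite_subset by blast
    \<comment> \<open>Otherwise the closed neighbourhoods of \<open>S\<close> and of
      \<open>V - S\<close> would disconnect \<open>C\<close>.\<close>
    have "?N S \<inter> ?N (V - S) \<inter> C \<noteq> {}"
    proof
      assume e: "?N S \<inter> ?N (V - S) \<inter> C = {}"
      have "closed (?N S)" "closed (?N (V - S))" using V(1) \<open>finite S\<close> by auto
      moreover have "C \<subseteq> ?N S \<union> ?N (V - S)" using net by fastforce
      moreover have "?N S \<inter> C \<noteq> {}" "?N (V - S) \<inter> C \<noteq> {}" using S V(2) \<delta> by force+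
      ultimately show False using C(2) e unfolding connected_closed by blast
    qed
    then obtain x where "x \<in> ?N S" "x \<in> ?N (V - S)" by blast
    then obtain s w where "s \<in> S" "w \<in> V - S" "dist s x \<le> \<delta>" "dist w x \<le> \<delta>"
      unfolding UN_iff mem_cball by blast
    then show "\<exists>s\<in>S. \<exists>w\<in>V - S. dist s w \<le> 2 * \<delta>"
      using dist_triangle2[of s w x] by (intro bexI[of _ s] bexI[of _ w]) auto
  qed
  define n where "n = length ws"
  have n: "0 < n" using ws(1) \<open>V \<noteq> {}\<close> by (auto simp: n_def)
  \<comment> \<open>The cap lets the walk rest at its last vertex for all later times.\<close>
  define w where "w i = ws ! min i (n - 1)" for i
  have wV: "w i \<in> V" for i using n ws(1) unfolding w_def n_def by (metis min_less_iff_disj nth_mem Suc_pred' lessI)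
  have step: "dist (w i) (w (Suc i)) \<le> 2 * \<delta>" for i
  proof (cases "Suc i < n")
    case True
    then have "dist (ws ! i) (ws ! Suc i) \<le> 2 * \<delta>"
      using ws(3) by (auto simp: successively_conv_nth n_def)
    then show ?thesis using True by (simp add: w_def min_def)
  next
    case False
    then have "w (Suc i) = w i" by (simp add: w_def min_def) (metis le_antisym diff_Suc_1 le_diff_conv Suc_eq_plus1 not_less not_less_eq_eq)
    then show ?thesis using \<delta> by simp
  qed
  have walk: "dist (w i) (w (i + k)) \<le> 2 * \<delta> * k" for i k
  proof (induction k)
    case (Suc k)
    have "dist (w i) (w (i + Suc k)) \<le> dist (w i) (w (i + k)) + dist (w (i + k)) (w (Suc (i + k)))"
      using dist_triangle by simp
    with Suc step[of "i + k"] show ?case by (simp add: algebra_simps)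
  qed simp
  define f where "f t = w (nat \<lfloor>t / \<delta>\<rfloor>)" for t
  have f_le: "dist (f s) (f t) \<le> 2 * (t - s) + 2 * \<delta>" if "s \<le> t" for s t
  proof -
    have le: "nat \<lfloor>s / \<delta>\<rfloor> \<le> nat \<lfloor>t / \<delta>\<rfloor>"
      using that \<delta> by (intro nat_mono floor_mono divide_right_mono) auto
    then have "dist (f s) (f t) \<le> 2 * (\<delta> * (real (nat \<lfloor>t / \<delta>\<rfloor>) - real (nat \<lfloor>s / \<delta>\<rfloor>)))"
      using walk[of "nat \<lfloor>s / \<delta>\<rfloor>" "nat \<lfloor>t / \<delta>\<rfloor> - nat \<lfloor>s / \<delta>\<rfloor>"] by (simp add: f_def of_nat_diff)
    also have "\<dots> \<le> 2 * ((t - s) + \<delta>)" by (intro mult_left_mono floor_divide_diff that \<delta>) auto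
    finally show ?thesis by simp
  qed
  show ?thesis
  proof (intro exI[of _ f] conjI allI ballI)
    show "f t \<in> C" for t using wV V(2) by (auto simp: f_def)
    show "dist (f s) (f t) \<le> 2 * \<bar>s - t\<bar> + 2 * \<delta>" for s t
      using f_le[of s t] f_le[of t s] by (cases "s \<le> t") (auto simp: dist_commute)
    fix x assume "x \<in> C"
    then obtain v where v: "v \<in> V" "dist v x \<le> \<delta>" using net by blast
    then obtain i where i: "i < n" "ws ! i = v" using ws(1) by (auto simp: in_set_conv_nth n_def)
    have "min i (n - 1) = i" using i(1) by linarith
    then have "f (i * \<delta>) = v" using i(2) \<delta> by (simp add: f_def w_def)
    moreover have "i * \<delta> \<le> 6 * ?l"
    proof -
      have "i * \<delta> \<le> real (2 * card V) * \<delta>" using i(1) ws(2) \<delta> by (intro mult_right_mono) (auto simp: n_def)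
      also have "\<dots> \<le> 2 * (3 * ?l)" using separated_card_le[OF C(1-3) far \<delta> V] by (simp add: mult.commute)
      finally show ?thesis by simp
    qed
    ultimately show "\<exists>t. 0 \<le> t \<and> t \<le> 6 * ?l \<and> dist x (f t) \<le> \<delta>"
      using v \<delta> by (intro exI[of _ "i * \<delta>"]) (auto simp: dist_commute)
  qed
qed

text \<open>Tychonoff's theorem takes the place of Arzela-Ascoli, since the approximating curves are
  step functions. Closeness on finite sets of parameters is enough for what follows.\<close>

lemma compact_fun_cluster_point:
  fixes f :: "nat \<Rightarrow> 'b \<Rightarrow> 'a::metric_space"
  assumes "compact C" "\<And>n t. f n t \<in> C"
  obtains g where "\<And>t. g t \<in> C"
    "\<And>T \<epsilon> N. finite T \<Longrightarrow> 0 < \<epsilon> \<Longrightarrow> \<exists>n\<ge>N. \<forall>t\<in>T. dist (f n t) (g t) < \<epsilon>"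
proof -
  have "compactin (product_topology (\<lambda>_. euclidean) UNIV) (PiE (UNIV :: 'b set) (\<lambda>_. C))"
    unfolding compactin_PiE using assms(1) by simp
  then have cpt: "compact (PiE (UNIV :: 'b set) (\<lambda>_. C))"
    unfolding euclidean_product_topology by simp
  have "\<forall>\<^sub>F h in filtermap f sequentially. h \<in> PiE UNIV (\<lambda>_. C)"
    using assms(2) by (simp add: eventually_filtermap PiE_iff)
  then obtain g where g: "g \<in> PiE UNIV (\<lambda>_. C)" "inf (nhds g) (filtermap f sequentially) \<noteq> bot"
    using cpt[unfolded compact_filter] by (metis filtermap_bot_iff sequentially_bot)
  show ?thesis
  proof (rule that)
    show "g t \<in> C" for t using g(1) by auto
    fix T :: "'b set" and \<epsilon> :: real and N :: nat
    assume T: "finite T" and \<epsilon>: "0 < \<epsilon>"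
    define O' where "O' = (\<Inter>t\<in>T. {h. dist (h t) (g t) < \<epsilon>})"
    have "open {h. dist (h t) (g t) < \<epsilon>}" for t
      by (intro open_Collect_less continuous_intros continuous_on_product_coordinates)
    then have "open O'" unfolding O'_def using T by auto
    moreover have "g \<in> O'" using \<epsilon> by (auto simp: O'_def)
    ultimately have ev: "\<forall>\<^sub>F h in nhds g. h \<in> O'" by (auto simp: eventually_nhds)
    show "\<exists>n\<ge>N. \<forall>t\<in>T. dist (f n t) (g t) < \<epsilon>"
    proof (rule ccontr)
      assume "\<not> ?thesis"
      then have "\<forall>n\<ge>N. f n \<notin> O'" by (auto simp: O'_def)
      then have "\<forall>\<^sub>F h in filtermap f sequentially. h \<notin> O'"
        by (auto simp: eventually_filtermap eventually_sequentially)
      with ev have "\<forall>\<^sub>F h in inf (nhds g) (filtermap f sequentially). False"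
        unfolding eventually_inf by blast
      then show False using g(2) by (simp add: eventually_False)
    qed
  qed
qed

text \<open>The additive error \<open>2 * \<delta> n\<close> in the speed bound disappears in the
  limit. The limit is onto because all approximations come close to every point within the same
  compact time interval.\<close>

theorem continuum_lipschitz_curve:
  fixes C :: "'a::metric_space set"
  assumes C: "compact C" "connected C" "hausdorff1_outer C < \<infinity>" and pq: "p \<in> C" "q \<in> C" "p \<noteq> q"
  obtains g :: "real \<Rightarrow> 'a" where "range g = C" "\<And>s t. dist (g s) (g t) \<le> 2 * dist s t"
proof -
  let ?l = "measure (H1_on C) UNIV"
  \<comment> \<open>Never more than half of \<open>dist p q\<close>, so each point of
    \<open>C\<close> is at distance at least \<open>\<delta> n\<close> from \<open>p\<close> or from
    \<open>q\<close>.\<close>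
  define \<delta> where "\<delta> n = dist p q / 2 / real (Suc n)" for n
  have \<delta>0: "0 < \<delta> n" for n using pq by (simp add: \<delta>_def)
  have far: "\<exists>y\<in>C. \<delta> n \<le> dist x y" if "x \<in> C" for x n
  proof -
    have "\<delta> n \<le> dist p q / 2" using pq by (simp add: \<delta>_def field_simps)
    then have "\<delta> n \<le> dist x p \<or> \<delta> n \<le> dist x q" using dist_triangle3[of p q x] by linarith
    then show ?thesis using pq by blast
  qed
  have small: "\<exists>N. \<forall>n\<ge>N. \<delta> n < e" if e: "0 < e" for e
  proof -
    have "0 < e / (dist p q / 2)" using e pq by simp
    from reals_Archimedean[OF this] obtain N where N: "inverse (real (Suc N)) < e / (dist p q / 2)" ..
    have "\<delta> n < e" if "n \<ge> N" for n
    proof -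
      have "inverse (real (Suc n)) \<le> inverse (real (Suc N))" using that by (intro le_imp_inverse_le) auto
      with N have "inverse (real (Suc n)) < e / (dist p q / 2)" by linarith
      then have "(dist p q / 2) * inverse (real (Suc n)) < e" using pq by (simp add: pos_less_divide_eq mult.commute)
      then show ?thesis by (simp only: \<delta>_def divide_inverse[of _ "real (Suc n)"])
    qed
    then show ?thesis by blast
  qed
  have "C \<noteq> {}" using pq by auto
  have "\<forall>n. \<exists>f. (\<forall>t. f t \<in> C) \<and> (\<forall>s t. dist (f s) (f t) \<le> 2 * \<bar>s - t\<bar> + 2 * \<delta> n) \<and>
    (\<forall>x\<in>C. \<exists>t. 0 \<le> t \<and> t \<le> 6 * ?l \<and> dist x (f t) \<le> \<delta> n)"
    by (intro allI approximate_curve[OF C \<open>C \<noteq> {}\<close> far \<delta>0])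
  then obtain f where f: "\<And>n t. f n t \<in> C" "\<And>n s t. dist (f n s) (f n t) \<le> 2 * \<bar>s - t\<bar> + 2 * \<delta> n"
    "\<And>n x. x \<in> C \<Longrightarrow> \<exists>t. 0 \<le> t \<and> t \<le> 6 * ?l \<and> dist x (f n t) \<le> \<delta> n" by metis
  obtain g where g: "\<And>t. g t \<in> C"
    "\<And>T \<epsilon> N. finite T \<Longrightarrow> 0 < \<epsilon> \<Longrightarrow> \<exists>n\<ge>N. \<forall>t\<in>T. dist (f n t) (g t) < \<epsilon>"
    by (rule compact_fun_cluster_point[of C f, OF C(1) f(1)]) (assumption | rule that)+
  have lip: "dist (g s) (g t) \<le> 2 * dist s t" for s t
  proof (rule field_le_epsilon)
    fix e :: real assume e: "0 < e"
    obtain N where N: "\<And>n. n \<ge> N \<Longrightarrow> \<delta> n < e / 4" using small[of "e / 4"] e by auto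
    obtain n where n: "n \<ge> N" "dist (f n s) (g s) < e / 4" "dist (f n t) (g t) < e / 4"
      using g(2)[of "{s, t}" "e / 4" N] e by auto
    have "dist (g s) (g t) \<le> dist (f n s) (g s) + dist (f n s) (f n t) + dist (f n t) (g t)"
      using dist_triangle3[of "g s" "g t" "f n s"] dist_triangle[of "f n s" "g t" "f n t"] by linarith
    also have "\<dots> \<le> 2 * dist s t + e"
      using n N[OF n(1)] f(2)[of n s t] by (simp add: dist_real_def)
    finally show "dist (g s) (g t) \<le> 2 * dist s t + e" .
  qed
  have "C \<subseteq> g ` {0..6 * ?l}"
  proof
    fix x assume x: "x \<in> C"
    have "continuous_on {0..6 * ?l} g"
    proof (rule lipschitz_on_continuous_on)
      show "2-lipschitz_on {0..6 * ?l} g" by (rule lipschitz_onI) (use lip in auto)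
    qed
    then have cl: "closed (g ` {0..6 * ?l})"
      by (intro compact_imp_closed compact_continuous_image) auto
    have "\<exists>y\<in>g ` {0..6 * ?l}. dist y x < e" if e: "0 < e" for e
    proof -
      \<comment> \<open>The distance from \<open>x\<close> to the curve at a grid time has three
        parts: \<open>h\<close> to the approximate curve, \<open>4 * h\<close> along it to the grid
        time, and \<open>h\<close> to the limit. Rounding to a finite grid is needed because the
        limit is controlled on finite sets only.\<close>
      define h where "h = e / 7"
      have h: "0 < h" using e by (simp add: h_def)
      obtain N where N: "\<And>n. n \<ge> N \<Longrightarrow> \<delta> n < h" using small[OF h] by auto
      define T where "T = (\<lambda>k::nat. k * h) ` {..nat \<lfloor>6 * ?l / h\<rfloor>}"
      obtain n where n: "n \<ge> N" "\<And>t. t \<in> T \<Longrightarrow> dist (f n t) (g t) < h"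
        using g(2)[of T h N] h by (auto simp: T_def)
      obtain t where t: "0 \<le> t" "t \<le> 6 * ?l" "dist x (f n t) \<le> \<delta> n" using f(3)[OF x] by blast
      define k where "k = nat \<lfloor>t / h\<rfloor>"
      have "real k \<le> t / h" "t / h < real k + 1" using t h unfolding k_def by (auto intro!: of_nat_floor)
      then have k: "k * h \<le> t" "t \<le> k * h + h" using h by (auto simp: field_simps)
      have "k \<le> nat \<lfloor>6 * ?l / h\<rfloor>" unfolding k_def using t h by (intro nat_mono floor_mono divide_right_mono) auto
      then have kT: "k * h \<in> T" by (auto simp: T_def)
      have "dist (f n t) (f n (k * h)) \<le> 2 * h + 2 * \<delta> n"
        using f(2)[of n t "k * h"] k by simp
      moreover have "dist x (g (k * h)) \<le> dist x (f n t) + dist (f n t) (f n (k * h)) + dist (f n (k * h)) (g (k * h))"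
        using dist_triangle[of x "g (k * h)" "f n t"] dist_triangle[of "f n t" "g (k * h)" "f n (k * h)"] by linarith
      ultimately have "dist x (g (k * h)) < 7 * h" using n(2)[OF kT] t(3) N[OF n(1)] h by linarith
      moreover have "k * h \<in> {0..6 * ?l}" using k t h by auto
      ultimately show ?thesis by (intro bexI[of _ "g (k * h)"]) (auto simp: h_def dist_commute)
    qed
    then have "x \<in> closure (g ` {0..6 * ?l})" unfolding closure_approachable by blast
    then show "x \<in> g ` {0..6 * ?l}" using cl by simp
  qed
  then have "range g = C" using g(1) by blast
  with lip that show ?thesis by blast
qed

subsection \<open>Approximate normals\<close>

lemma nn_integral_H1_on:
  assumes "K \<in> sets borel" "f \<in> borel_measurable borel"
  shows "(\<integral>\<^sup>+y. f y \<partial>H1_on K) = (\<integral>\<^sup>+y. f y * indicator K y \<partial>hausdorff1)"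
  unfolding measure_restr_def using assms
  by (subst nn_integral_density) (auto simp: mult.commute)

text \<open>An inequality form of the area formula: Lebesgue measure on \<open>J\<close> is
  dominated, set by set, by the push-forward of length under the 1-Lipschitz map
  \<open>p\<close>.\<close>

lemma nn_integral_projection_le:
  fixes p :: "'a::metric_space \<Rightarrow> real"
  assumes p: "\<And>x y. dist (p x) (p y) \<le> dist x y" "p \<in> borel_measurable borel"
    and G: "G \<in> sets borel" and J: "J \<in> sets borel" "J \<subseteq> p ` G"
    and f: "f \<in> borel_measurable borel"
  shows "(\<integral>\<^sup>+t. f t * indicator J t \<partial>lborel) \<le> (\<integral>\<^sup>+y. f (p y) \<partial>H1_on G)"
proof -
  have "measure_restr lborel J \<le> distr (H1_on G) borel p"
  proof (subst le_measure, simp, rule ballI)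
    fix A assume "A \<in> sets (measure_restr lborel J)"
    then have A: "A \<in> sets borel" by simp
    have pA: "p -` A \<in> sets borel" using measurable_sets[OF p(2) A] by simp
    have "emeasure (measure_restr lborel J) A = emeasure lborel (J \<inter> A)"
      using A J by (simp add: emeasure_measure_restr)
    also have "\<dots> \<le> hausdorff1_outer (G \<inter> p -` A)"
      by (rule hausdorff1_outer_ge_lborel_image[where f = p]) (use p J A in auto)
    also have "\<dots> = emeasure (distr (H1_on G) borel p) A"
      using A pA p(2) G by (simp add: emeasure_distr emeasure_H1_on measurable_def)
    finally show "emeasure (measure_restr lborel J) A \<le> emeasure (distr (H1_on G) borel p) A" .
  qed
  then have "(\<integral>\<^sup>+t. f t \<partial>measure_restr lborel J) \<le> (\<integral>\<^sup>+t. f t \<partial>distr (H1_on G) borel p)"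
    by (intro nn_integral_mono_measure) auto
  also have "\<dots> = (\<integral>\<^sup>+y. f (p y) \<partial>H1_on G)"
    using p(2) f by (intro nn_integral_distr) (auto simp: measurable_def)
  also have "(\<integral>\<^sup>+t. f t \<partial>measure_restr lborel J) = (\<integral>\<^sup>+t. f t * indicator J t \<partial>lborel)"
    unfolding measure_restr_def using f J by (subst nn_integral_density) (auto simp: mult.commute)
  finally show ?thesis .
qed

lemma blow_up_curve_covers_line:
  fixes g :: "real \<Rightarrow> real^2"
  assumes g: "continuous_on UNIV g" "range g \<subseteq> K" "g t0 = x" "(g has_vector_derivative v) (at t0)"
    and v: "v = c *\<^sub>R rot \<nu>" "0 < c" and \<nu>: "norm \<nu> = 1" and d: "0 < d" and R: "0 < R"
  shows "\<forall>\<^sub>F \<rho> in at_right 0. \<forall>t\<in>{-R..R}. \<exists>y\<in>blow_up x \<rho> ` K. y \<bullet> rot \<nu> = t \<and> \<bar>y \<bullet> \<nu>\<bar> \<le> d"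
proof -
  \<comment> \<open>With a tangential error of at most 1 the parameters in \<open>{-S..S}\<close>
    sweep past both ends of \<open>{-R..R}\<close>. The relative error \<open>\<kappa>\<close> of
    the derivative amounts to the absolute error \<open>min d 1\<close> over this range.\<close>
  define S where "S = (R + 1) / c"
  define \<kappa> where "\<kappa> = min d 1 / S"
  have S: "0 < S" "S * c = R + 1" using R v by (simp_all add: S_def)
  have \<kappa>: "0 < \<kappa>" "\<kappa> * S = min d 1" using S d by (simp_all add: \<kappa>_def)
  obtain \<delta> where \<delta>: "0 < \<delta>" "\<And>h. \<bar>h\<bar> < \<delta> \<Longrightarrow> norm (g (t0 + h) - x - h *\<^sub>R v) \<le> \<kappa> * \<bar>h\<bar>"
  proof -
    have "(g has_derivative (\<lambda>h. h *\<^sub>R v)) (at t0)" using g(4) by (simp add: has_vector_derivative_def)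
    then obtain \<delta> where \<delta>: "0 < \<delta>" "\<And>s. norm (s - t0) < \<delta> \<Longrightarrow> norm (g s - g t0 - (s - t0) *\<^sub>R v) \<le> \<kappa> * norm (s - t0)"
      unfolding has_derivative_at_alt using \<kappa>(1) by blast
    show ?thesis
    proof (rule that[OF \<delta>(1)])
      fix h assume "\<bar>h\<bar> < \<delta>"
      with \<delta>(2)[of "t0 + h"] show "norm (g (t0 + h) - x - h *\<^sub>R v) \<le> \<kappa> * \<bar>h\<bar>" by (simp add: g(3))
    qed
  qed
  show ?thesis
  proof (rule eventually_at_rightI[of 0 "\<delta> / S"])
    fix \<rho> :: real assume \<rho>: "\<rho> \<in> {0<..<\<delta> / S}"
    then have \<rho>0: "0 < \<rho>" and \<rho>S: "\<rho> * S < \<delta>" using S by (auto simp: field_simps)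
    define \<sigma> where "\<sigma> s = blow_up x \<rho> (g (t0 + \<rho> * s))" for s
    have \<sigma>: "norm (\<sigma> s - s *\<^sub>R v) \<le> min d 1" if s: "s \<in> {-S..S}" for s
    proof -
      have abs: "\<bar>\<rho> * s\<bar> \<le> \<rho> * S" using s \<rho>0 by (auto simp: abs_mult abs_le_iff)
      have "\<sigma> s - s *\<^sub>R v = (1 / \<rho>) *\<^sub>R (g (t0 + \<rho> * s) - x - (\<rho> * s) *\<^sub>R v)"
        using \<rho>0 by (simp add: \<sigma>_def blow_up_def scaleR_diff_right)
      then have "norm (\<sigma> s - s *\<^sub>R v) = norm (g (t0 + \<rho> * s) - x - (\<rho> * s) *\<^sub>R v) / \<rho>"
        using \<rho>0 by simp
      also have "\<dots> \<le> (\<kappa> * \<bar>\<rho> * s\<bar>) / \<rho>"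
        using \<delta>(2)[of "\<rho> * s"] abs \<rho>S \<rho>0 by (intro divide_right_mono) auto
      also have "\<dots> \<le> (\<kappa> * (\<rho> * S)) / \<rho>"
        using abs \<kappa> \<rho>0 by (intro divide_right_mono mult_left_mono) auto
      also have "\<dots> = min d 1" using \<rho>0 \<kappa>(2) by simp
      finally show ?thesis .
    qed
    have inner: "\<bar>(\<sigma> s - s *\<^sub>R v) \<bullet> w\<bar> \<le> min d 1" if "s \<in> {-S..S}" "norm w = 1" for s w
      using Cauchy_Schwarz_ineq2[of "\<sigma> s - s *\<^sub>R v" w] \<sigma>[OF that(1)] that(2) by simp
    have vt: "v \<bullet> rot \<nu> = c" "v \<bullet> \<nu> = 0" using v \<nu> by (simp_all add: dot_square_norm)
    show "\<forall>t\<in>{-R..R}. \<exists>y\<in>blow_up x \<rho> ` K. y \<bullet> rot \<nu> = t \<and> \<bar>y \<bullet> \<nu>\<bar> \<le> d"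
    proof
      fix t assume t: "t \<in> {-R..R}"
      have tang: "\<bar>\<sigma> s \<bullet> rot \<nu> - s * c\<bar> \<le> 1" if "s \<in> {-S..S}" for s
        using inner[OF that, of "rot \<nu>"] \<nu> by (simp add: inner_diff_left vt)
      have "continuous_on {-S..S} (\<lambda>s. \<sigma> s \<bullet> rot \<nu>)"
        unfolding \<sigma>_def
        by (intro continuous_intros continuous_on_compose2[OF continuous_on_blow_up[of UNIV]]
            continuous_on_compose2[OF g(1)]) auto
      moreover have "\<sigma> (- S) \<bullet> rot \<nu> \<le> t" using tang[of "- S"] S t by (auto simp: abs_le_iff)
      moreover have "t \<le> \<sigma> S \<bullet> rot \<nu>" using tang[of S] S t by (auto simp: abs_le_iff)
      ultimately obtain s where s: "s \<in> {-S..S}" "\<sigma> s \<bullet> rot \<nu> = t"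
        using IVT'[of "\<lambda>s. \<sigma> s \<bullet> rot \<nu>" "- S" t S] S by auto
      moreover have "\<bar>\<sigma> s \<bullet> \<nu>\<bar> \<le> d" using inner[OF s(1) \<nu>] vt by (simp add: inner_diff_left)
      moreover have "\<sigma> s \<in> blow_up x \<rho> ` K" using g(2) by (auto simp: \<sigma>_def)
      ultimately show "\<exists>y\<in>blow_up x \<rho> ` K. y \<bullet> rot \<nu> = t \<and> \<bar>y \<bullet> \<nu>\<bar> \<le> d" by blast
    qed
  qed (use \<delta> S in auto)
qed

lemma finite_measure_blow_up:
  assumes "0 < \<rho>" "K \<in> sets borel" "hausdorff1_outer K < \<infinity>"
  shows "finite_measure (H1_on (blow_up x \<rho> ` K))"
  using assms by (intro finite_measure_H1_on blow_up_image_borel)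
    (auto simp: hausdorff1_outer_blow_up ennreal_mult_less_top)

lemma measure_blow_up_cball:
  assumes \<rho>: "0 < \<rho>" and K: "K \<in> sets borel"
  shows "measure (H1_on (blow_up x \<rho> ` K)) (cball 0 R) = measure (H1_on K) (cball x (\<rho> * R)) / \<rho>"
proof -
  have *: "blow_up x \<rho> -` cball 0 R = cball x (\<rho> * R)"
    using \<rho> by (auto simp: norm_blow_up field_simps)
  have "emeasure (H1_on (blow_up x \<rho> ` K)) (cball 0 R) = ennreal (1 / \<rho>) * emeasure (H1_on K) (cball x (\<rho> * R))"
    unfolding H1_on_blow_up[OF assms] by (simp add: emeasure_distr emeasure_density_const *)
  then show ?thesis using \<rho> by (simp add: measure_def enn2real_mult)
qed

text \<open>The curve may be only a part of \<open>K\<close>, hence a bound from below: its blow-up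
  stays in a thin strip and projects onto nearly the whole tangent segment. The opposite bound needs
  the upper density.\<close>

lemma blow_up_integral_cball_ge:
  fixes g :: "real \<Rightarrow> real^2" and h :: "real^2 \<Rightarrow> real"
  assumes K: "K \<in> sets borel" "hausdorff1_outer K < \<infinity>"
    and g: "continuous_on UNIV g" "range g \<subseteq> K" "g t0 = x" "(g has_vector_derivative v) (at t0)"
    and v: "v = c *\<^sub>R rot \<nu>" "0 < c" and \<nu>: "norm \<nu> = 1"
    and h: "continuous_on UNIV h" "\<And>y. 0 \<le> h y" and R: "0 < R" and e: "0 < e"
  shows "\<forall>\<^sub>F \<rho> in at_right 0. (\<integral>t. h (t *\<^sub>R rot \<nu>) * indicator {-R..R} t \<partial>lborel) - e
    \<le> (\<integral>y. h y * indicator (cball 0 R) y \<partial>H1_on (blow_up x \<rho> ` K))"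
proof -
  let ?\<tau> = "rot \<nu>"
  have hc: "continuous_on S h" for S using h(1) continuous_on_subset by blast
  have [measurable]: "h \<in> borel_measurable borel" using h(1) by (rule borel_measurable_continuous_onI)
  obtain B where B: "0 < B" "\<And>y. y \<in> cball 0 R \<Longrightarrow> h y \<le> B"
  proof -
    have "bounded (h ` cball 0 R)" by (intro compact_imp_bounded compact_continuous_image hc) auto
    then show ?thesis using that unfolding bounded_pos by (auto simp: abs_le_iff)
  qed
  define \<epsilon> where "\<epsilon> = e / (4 * R)"
  have \<epsilon>: "0 < \<epsilon>" "2 * R * \<epsilon> = e / 2" using e R by (simp_all add: \<epsilon>_def)
  have "uniformly_continuous_on (cball 0 R) h" by (intro compact_uniformly_continuous hc) auto
  then obtain d0 where d0: "0 < d0"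
    "\<And>y z. y \<in> cball 0 R \<Longrightarrow> z \<in> cball 0 R \<Longrightarrow> dist z y < d0 \<Longrightarrow> dist (h z) (h y) < \<epsilon>"
    unfolding uniformly_continuous_on_def using \<epsilon>(1) by metis
  \<comment> \<open>Lowering the height by \<open>\<epsilon>\<close> over the length
    \<open>2 * R\<close> costs at most \<open>e / 2\<close>, and so does giving up two end pieces of
    length \<open>d\<close>, where the height is at most \<open>B\<close>.\<close>
  define d where "d = min (min (d0 / 2) (R / 2)) (e / (4 * B))"
  have d: "0 < d" "d < d0" "d < R" "2 * d * B \<le> e / 2"
  proof -
    show "0 < d" using d0(1) R e B(1) by (simp add: d_def)
    have "d \<le> d0 / 2" "d \<le> R / 2" "d \<le> e / (4 * B)" by (auto simp: d_def)
    then show "d < d0" "d < R" "2 * d * B \<le> e / 2" using d0(1) R B(1) by (auto simp: field_simps)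
  qed
  \<comment> \<open>Shortened by \<open>d\<close>, so that a point over \<open>?J\<close> with
    normal component at most \<open>d\<close> lies in the ball of radius \<open>R\<close>.\<close>
  let ?J = "{-(R-d)..R-d}"
  \<comment> \<open>By uniform continuity \<open>h\<close> at a point of the thin strip is at least
    \<open>f\<close> at its projection to the line.\<close>
  define f where "f t = max 0 (h (t *\<^sub>R ?\<tau>) - \<epsilon>)" for t
  have fm [measurable]: "f \<in> borel_measurable borel" unfolding f_def by measurable
  have int_cont: "integrable lborel (\<lambda>t. u t * indicator {a..b} t)" if "continuous_on UNIV u" for u :: "real \<Rightarrow> real" and a b
    using borel_integrable_compact[of "{a..b}" u] that continuous_on_subset
    by (auto simp: set_integrable_def mult.commute)
  have hl: "continuous_on UNIV (\<lambda>t. h (t *\<^sub>R ?\<tau>))"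
    by (intro continuous_on_compose2[OF h(1)] continuous_intros) auto
  have lower: "(\<integral>t. h (t *\<^sub>R ?\<tau>) * indicator {-R..R} t \<partial>lborel) - e \<le> (\<integral>t. f t * indicator ?J t \<partial>lborel)"
  proof -
    have "(\<integral>t. h (t *\<^sub>R ?\<tau>) * indicator {-R..R} t \<partial>lborel) \<le>
      (\<integral>t. f t * indicator ?J t + (\<epsilon> * indicator {-R..R} t + (B * indicator {-R..-(R-d)} t + B * indicator {R-d..R} t)) \<partial>lborel)"
    proof (rule integral_mono)
      fix t
      show "h (t *\<^sub>R ?\<tau>) * indicator {-R..R} t \<le> f t * indicator ?J t +
        (\<epsilon> * indicator {-R..R} t + (B * indicator {-R..-(R-d)} t + B * indicator {R-d..R} t))"
        using B(1) B(2)[of "t *\<^sub>R ?\<tau>"] \<epsilon>(1) d(1,3) by (auto simp: f_def indicator_def \<nu> abs_le_iff max_def)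
    next
      have "continuous_on UNIV f" unfolding f_def by (intro continuous_intros hl)
      then show "integrable lborel (\<lambda>t. f t * indicator ?J t +
        (\<epsilon> * indicator {-R..R} t + (B * indicator {-R..-(R-d)} t + B * indicator {R-d..R} t)))"
        by (intro Bochner_Integration.integrable_add int_cont continuous_on_const)
    qed (rule int_cont[OF hl])
    also have "\<dots> = (\<integral>t. f t * indicator ?J t \<partial>lborel) + (\<epsilon> * (2 * R) + (B * d + B * d))"
    proof -
      have "continuous_on UNIV f" unfolding f_def by (intro continuous_intros hl)
      then have fi: "integrable lborel (\<lambda>t. f t * indicator ?J t)" by (rule int_cont)
      have ci: "integrable lborel (\<lambda>t. a * indicator {p..q} t)" for a p q :: real
        by (rule int_cont) (rule continuous_on_const)
      have cv: "(\<integral>t. a * indicator {p..q} t \<partial>lborel) = a * (q - p)" if "p \<le> q" for a p q :: real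
        using that by simp
      show ?thesis
        unfolding Bochner_Integration.integral_add[OF fi Bochner_Integration.integrable_add[OF ci Bochner_Integration.integrable_add[OF ci ci]]]
          Bochner_Integration.integral_add[OF ci Bochner_Integration.integrable_add[OF ci ci]] Bochner_Integration.integral_add[OF ci ci]
        using R d by (simp add: cv algebra_simps)
    qed
    also have "\<epsilon> * (2 * R) + (B * d + B * d) \<le> e" using \<epsilon>(2) d(4) by (simp add: algebra_simps)
    finally show ?thesis by simp
  qed
  have "\<forall>\<^sub>F \<rho> in at_right 0. \<forall>t\<in>{-R..R}. \<exists>y\<in>blow_up x \<rho> ` K. y \<bullet> ?\<tau> = t \<and> \<bar>y \<bullet> \<nu>\<bar> \<le> d"
    by (rule blow_up_curve_covers_line[OF g v \<nu> d(1) R])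
  moreover have "\<forall>\<^sub>F \<rho>::real in at_right 0. 0 < \<rho>" by (simp add: eventually_at_right_less)
  ultimately show ?thesis
  proof eventually_elim
    case (elim \<rho>)
    let ?K = "blow_up x \<rho> ` K"
    interpret M: finite_measure "H1_on ?K" by (rule finite_measure_blow_up[OF elim(2) K])
    have Kb: "?K \<in> sets borel" by (rule blow_up_image_borel[OF elim(2) K(1)])
    define G where "G = ?K \<inter> (cball 0 R \<inter> {y. \<bar>y \<bullet> \<nu>\<bar> \<le> d})"
    have "closed (cball 0 R \<inter> {y. \<bar>y \<bullet> \<nu>\<bar> \<le> d})"
      by (intro closed_Int closed_cball closed_Collect_le continuous_intros)
    then have G: "G \<in> sets borel" unfolding G_def using Kb by auto
    have "?J \<subseteq> (\<lambda>y. y \<bullet> ?\<tau>) ` G"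
    proof
      fix t assume t: "t \<in> ?J"
      then obtain y where y: "y \<in> ?K" "y \<bullet> ?\<tau> = t" "\<bar>y \<bullet> \<nu>\<bar> \<le> d" using elim(1) d(1) by force
      have "norm y \<le> R" using norm_le_orthonormal[OF \<nu>, of y] y t by auto
      then show "t \<in> (\<lambda>y. y \<bullet> ?\<tau>) ` G" using y by (auto simp: G_def)
    qed
    then have "(\<integral>\<^sup>+t. ennreal (f t) * indicator ?J t \<partial>lborel) \<le> (\<integral>\<^sup>+y. ennreal (f (y \<bullet> ?\<tau>)) \<partial>H1_on G)"
    proof (intro nn_integral_projection_le G)
      fix y z :: "real^2"
      show "dist (y \<bullet> ?\<tau>) (z \<bullet> ?\<tau>) \<le> dist y z"
        using Cauchy_Schwarz_ineq2[of "y - z" ?\<tau>] \<nu> by (simp add: dist_norm inner_diff_left)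
    qed auto
    also have "\<dots> = (\<integral>\<^sup>+y. ennreal (f (y \<bullet> ?\<tau>)) * indicator G y \<partial>hausdorff1)"
      by (rule nn_integral_H1_on[OF G]) measurable
    also have "\<dots> \<le> (\<integral>\<^sup>+y. ennreal (h y * indicator (cball 0 R) y) * indicator ?K y \<partial>hausdorff1)"
    proof (rule nn_integral_mono)
      fix y
      show "ennreal (f (y \<bullet> ?\<tau>)) * indicator G y \<le> ennreal (h y * indicator (cball 0 R) y) * indicator ?K y"
      proof (cases "y \<in> G")
        case True
        then have y: "y \<in> ?K" "norm y \<le> R" "\<bar>y \<bullet> \<nu>\<bar> \<le> d" by (auto simp: G_def)
        let ?z = "(y \<bullet> ?\<tau>) *\<^sub>R ?\<tau>"
        have "y - ?z = (y \<bullet> \<nu>) *\<^sub>R \<nu>"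
          using orthonormal_decomposition[OF \<nu>, of y] by (simp add: algebra_simps)
        then have "dist ?z y < d0" using y(3) d(2) \<nu> by (simp add: dist_norm norm_minus_commute)
        moreover have "norm ?z \<le> R"
          using Cauchy_Schwarz_ineq2[of y ?\<tau>] \<nu> y(2) by simp
        ultimately have "dist (h ?z) (h y) < \<epsilon>" using d0(2)[of y ?z] y(2) by simp
        then have "f (y \<bullet> ?\<tau>) \<le> h y" using h(2)[of y] by (auto simp: f_def dist_real_def)
        then show ?thesis using y True by (auto simp: indicator_def intro!: ennreal_leI)
      qed simp
    qed
    also have "\<dots> = (\<integral>\<^sup>+y. ennreal (h y * indicator (cball 0 R) y) \<partial>H1_on ?K)"
    proof (rule nn_integral_H1_on[OF Kb, symmetric])
      have "(\<lambda>y. h y * indicator (cball 0 R) y) \<in> borel_measurable borel"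
        by (intro borel_measurable_times borel_measurable_indicator) auto
      then show "(\<lambda>y. ennreal (h y * indicator (cball 0 R) y)) \<in> borel_measurable borel" by simp
    qed
    also have "\<dots> = ennreal (\<integral>y. h y * indicator (cball 0 R) y \<partial>H1_on ?K)"
    proof (rule nn_integral_eq_integral)
      show "integrable (H1_on ?K) (\<lambda>y. h y * indicator (cball 0 R) y)"
        by (rule M.integrable_const_bound[where B = B]) (use B h(2) in \<open>auto simp: indicator_def\<close>)
    qed (use h(2) in auto)
    finally have le: "(\<integral>\<^sup>+t. ennreal (f t) * indicator ?J t \<partial>lborel)
      \<le> ennreal (\<integral>y. h y * indicator (cball 0 R) y \<partial>H1_on ?K)" .
    have "(\<integral>\<^sup>+t. ennreal (f t) * indicator ?J t \<partial>lborel) = (\<integral>\<^sup>+t. ennreal (f t * indicator ?J t) \<partial>lborel)"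
      by (intro nn_integral_cong) (auto simp: indicator_def)
    also have "\<dots> = ennreal (\<integral>t. f t * indicator ?J t \<partial>lborel)"
    proof (rule nn_integral_eq_integral)
      have "continuous_on UNIV f" unfolding f_def by (intro continuous_intros hl)
      then show "integrable lborel (\<lambda>t. f t * indicator ?J t)" by (rule int_cont)
    qed (auto simp: f_def)
    finally have "ennreal (\<integral>t. f t * indicator ?J t \<partial>lborel) \<le> ennreal (\<integral>y. h y * indicator (cball 0 R) y \<partial>H1_on ?K)"
      using le by simp
    moreover have "0 \<le> (\<integral>y. h y * indicator (cball 0 R) y \<partial>H1_on ?K)"
      using h(2) by (intro integral_nonneg_AE) auto
    ultimately have "(\<integral>t. f t * indicator ?J t \<partial>lborel) \<le> (\<integral>y. h y * indicator (cball 0 R) y \<partial>H1_on ?K)"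
      by (simp only: ennreal_le_iff)
    with lower show ?case by linarith
  qed
qed

text \<open>The bound from below is applied to \<open>B + f\<close> and to \<open>B - f\<close>,
  both nonnegative. As the upper density limits the mass of the blown-up ball to nearly
  \<open>2 * R\<close>, the two bounds squeeze the integral of \<open>f\<close>.\<close>

theorem approx_normal_of_tangent:
  fixes g :: "real \<Rightarrow> real^2"
  assumes K: "K \<in> sets borel" "hausdorff1_outer K < \<infinity>"
    and g: "continuous_on UNIV g" "range g \<subseteq> K" "g t0 = x" "(g has_vector_derivative v) (at t0)"
    and v: "v \<noteq> 0"
    and dens: "\<And>e. 0 < e \<Longrightarrow> \<exists>\<eta>>0. \<forall>r. 0 < r \<longrightarrow> r < \<eta> \<longrightarrow> measure (H1_on K) (cball x r) \<le> (1 + e) * (2 * r)"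
  shows "approx_normal K x (- rot ((1 / norm v) *\<^sub>R v))"
proof -
  \<comment> \<open>The sign makes \<open>rot \<nu>\<close> point along \<open>v\<close>.\<close>
  define \<nu> where "\<nu> = - rot ((1 / norm v) *\<^sub>R v)"
  have \<nu>: "norm \<nu> = 1" using v by (simp add: \<nu>_def)
  have v': "v = norm v *\<^sub>R rot \<nu>" "0 < norm v" using v by (simp_all add: \<nu>_def)
  have "((\<lambda>\<rho>. integral\<^sup>L (H1_on (blow_up x \<rho> ` K)) f) \<longlongrightarrow> integral\<^sup>L (H1_on {y. y \<bullet> \<nu> = 0}) f) (at_right 0)"
    if f: "continuous_on UNIV f" "compact (closure {y. f y \<noteq> 0})" for f :: "real^2 \<Rightarrow> real"
  proof -
    have [measurable]: "f \<in> borel_measurable borel" using f(1) by (rule borel_measurable_continuous_onI)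
    have "bounded {y. f y \<noteq> 0}" using f(2) by (meson bounded_subset closure_subset compact_imp_bounded)
    then obtain R where R: "0 < R" "\<And>y. f y \<noteq> 0 \<Longrightarrow> norm y \<le> R" unfolding bounded_pos by blast
    have "bounded (f ` cball 0 R)"
      using f(1) by (intro compact_imp_bounded compact_continuous_image) (auto intro: continuous_on_subset)
    then obtain B where B: "0 < B" "\<And>y. y \<in> cball 0 R \<Longrightarrow> \<bar>f y\<bar> \<le> B" unfolding bounded_pos by auto
    have fB: "\<bar>f y\<bar> \<le> B" for y using B(2)[of y] R(2)[of y] B(1) by (cases "f y = 0") auto
    define I where "I = (\<integral>t. f (t *\<^sub>R rot \<nu>) \<partial>lborel)"
    have I: "integral\<^sup>L (H1_on {y. y \<bullet> \<nu> = 0}) f = I"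
      unfolding I_def by (rule integral_H1_on_line[OF \<nu>]) measurable
    have fl: "f (t *\<^sub>R rot \<nu>) = f (t *\<^sub>R rot \<nu>) * indicator {-R..R} t" for t
      using R(2)[of "t *\<^sub>R rot \<nu>"] \<nu> by (auto simp: indicator_def abs_le_iff)
    have int_f: "integrable lborel (\<lambda>t. f (t *\<^sub>R rot \<nu>))"
    proof -
      have "continuous_on {-R..R} (\<lambda>t. f (t *\<^sub>R rot \<nu>))"
        by (intro continuous_on_compose2[OF f(1)] continuous_intros) auto
      then have "integrable lborel (\<lambda>t. f (t *\<^sub>R rot \<nu>) * indicator {-R..R} t)"
        using borel_integrable_compact[of "{-R..R}" "\<lambda>t. f (t *\<^sub>R rot \<nu>)"]
        by (auto simp: set_integrable_def mult.commute)
      then show ?thesis using fl by simp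
    qed
    have intB: "integrable lborel (\<lambda>t. B * indicator {-R..R} t :: real)"
      by (intro integrable_mult_right integrable_real_indicator) (auto simp: emeasure_lborel_Icc_eq)
    have split: "(\<integral>t. (B + s * f (t *\<^sub>R rot \<nu>)) * indicator {-R..R} t \<partial>lborel) = B * (2 * R) + s * I" for s
    proof -
      have "(\<integral>t. (B + s * f (t *\<^sub>R rot \<nu>)) * indicator {-R..R} t \<partial>lborel) =
        (\<integral>t. B * indicator {-R..R} t + s * f (t *\<^sub>R rot \<nu>) \<partial>lborel)"
        by (intro Bochner_Integration.integral_cong refl) (subst (2) fl, simp add: algebra_simps)
      also have "\<dots> = B * (2 * R) + s * I"
        using int_f intB R(1) by (subst Bochner_Integration.integral_add) (auto simp: I_def)
      finally show ?thesis .
    qed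
    show ?thesis
      unfolding I
    proof (rule tendstoI)
      fix e :: real assume e: "0 < e"
      \<comment> \<open>The surplus mass allowed by the density bound, weighted by \<open>B\<close>,
        then costs \<open>e / 4\<close>.\<close>
      define e' where "e' = e / (8 * B * R)"
      have e': "0 < e'" "B * (e' * (2 * R)) = e / 4" using e B(1) R(1) by (simp_all add: e'_def field_simps)
      from dens[OF e'(1)] obtain \<eta> where \<eta>: "0 < \<eta>"
        "\<And>r. 0 < r \<Longrightarrow> r < \<eta> \<Longrightarrow> measure (H1_on K) (cball x r) \<le> (1 + e') * (2 * r)" by blast
      have "\<forall>\<^sub>F \<rho> in at_right 0. \<rho> \<in> {0<..<\<eta> / R}"
        using \<eta>(1) R(1) by (intro eventually_at_right_real) simp
      moreover have "\<forall>\<^sub>F \<rho> in at_right 0. (\<integral>t. (B + 1 * f (t *\<^sub>R rot \<nu>)) * indicator {-R..R} t \<partial>lborel) - e / 4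
        \<le> (\<integral>y. (B + 1 * f y) * indicator (cball 0 R) y \<partial>H1_on (blow_up x \<rho> ` K))"
        by (rule blow_up_integral_cball_ge[OF K g v' \<nu> _ _ R(1)])
          (use fB e f(1) in \<open>auto intro!: continuous_intros simp: abs_le_iff\<close>, smt (verit))
      moreover have "\<forall>\<^sub>F \<rho> in at_right 0. (\<integral>t. (B + (- 1) * f (t *\<^sub>R rot \<nu>)) * indicator {-R..R} t \<partial>lborel) - e / 4
        \<le> (\<integral>y. (B + (- 1) * f y) * indicator (cball 0 R) y \<partial>H1_on (blow_up x \<rho> ` K))"
        by (rule blow_up_integral_cball_ge[OF K g v' \<nu> _ _ R(1)])
          (use fB e f(1) in \<open>auto intro!: continuous_intros simp: abs_le_iff\<close>)
      ultimately show "\<forall>\<^sub>F \<rho> in at_right 0. dist (integral\<^sup>L (H1_on (blow_up x \<rho> ` K)) f) I < e"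
      proof eventually_elim
        case (elim \<rho>)
        let ?K = "blow_up x \<rho> ` K"
        have \<rho>: "0 < \<rho>" "\<rho> * R < \<eta>" using elim(1) R(1) by (auto simp: field_simps)
        interpret M: finite_measure "H1_on ?K" by (rule finite_measure_blow_up[OF \<rho>(1) K])
        have m: "B * measure (H1_on ?K) (cball 0 R) \<le> B * (2 * R) + e / 4"
        proof -
          have "measure (H1_on ?K) (cball 0 R) \<le> (1 + e') * (2 * (\<rho> * R)) / \<rho>"
            unfolding measure_blow_up_cball[OF \<rho>(1) K(1)] using \<eta>(2)[of "\<rho> * R"] \<rho> R(1)
            by (intro divide_right_mono) auto
          also have "\<dots> = (1 + e') * (2 * R)" using \<rho>(1) by simp
          finally have "B * measure (H1_on ?K) (cball 0 R) \<le> B * ((1 + e') * (2 * R))"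
            using B(1) by (intro mult_left_mono) auto
          then show ?thesis using e'(2) by (simp add: algebra_simps)
        qed
        have int_fM: "integrable (H1_on ?K) f" by (rule M.integrable_const_bound[where B = B]) (use fB in auto)
        have fK: "f y * indicator (cball 0 R) y = f y" for y using R(2)[of y] by (auto simp: indicator_def)
        have splitM: "(\<integral>y. (B + s * f y) * indicator (cball 0 R) y \<partial>H1_on ?K) =
          B * measure (H1_on ?K) (cball 0 R) + s * integral\<^sup>L (H1_on ?K) f" for s
        proof -
          have "(\<integral>y. (B + s * f y) * indicator (cball 0 R) y \<partial>H1_on ?K) =
            (\<integral>y. B * indicator (cball 0 R) y + s * f y \<partial>H1_on ?K)"
            by (intro Bochner_Integration.integral_cong refl) (subst (2) fK[symmetric], simp add: algebra_simps)
          also have "\<dots> = B * measure (H1_on ?K) (cball 0 R) + s * integral\<^sup>L (H1_on ?K) f"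
          proof (subst Bochner_Integration.integral_add)
            show "integrable (H1_on ?K) (\<lambda>y. B * indicator (cball 0 R) y)"
              by (intro integrable_mult_right integrable_real_indicator) (auto simp: less_top[symmetric])
            have "(\<integral>y. indicator (cball 0 R) y \<partial>H1_on ?K) = measure (H1_on ?K) (cball 0 R)"
              by (subst Bochner_Integration.integral_indicator) simp
            then show "(\<integral>y. B * indicator (cball 0 R) y \<partial>H1_on ?K) + (\<integral>y. s * f y \<partial>H1_on ?K) =
              B * measure (H1_on ?K) (cball 0 R) + s * integral\<^sup>L (H1_on ?K) f"
              by (simp only: integral_mult_right_zero)
          qed (use int_fM in auto)
          finally show ?thesis .
        qed
        show ?case using elim(2,3) m e unfolding split splitM dist_real_def by (simp add: abs_less_iff)
      qed
    qed
  qed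
  then show ?thesis using \<nu> unfolding approx_normal_def loc_weak_star_def \<nu>_def[symmetric] by blast
qed

lemma hausdorff1_outer_eq_measure:
  assumes "K \<in> sets borel" "hausdorff1_outer K < \<infinity>" "B \<in> sets borel"
  shows "hausdorff1_outer (K \<inter> B) = ennreal (measure (H1_on K) B)"
  using emeasure_H1_on[OF assms(1,3)]
    finite_measure.emeasure_eq_measure[OF finite_measure_H1_on[OF assms(1,2)], of B] by simp

lemma hausdorff1_outer_singleton [simp]: "hausdorff1_outer {x} = 0"
proof -
  have "hausdorff1_outer {x} \<le> 0"
  proof (rule hausdorff1_outer_leI)
    fix \<delta> :: real assume "0 < \<delta>"
    then have "hausdorff1_pre \<delta> {x} \<le> (\<Sum>i::nat. ennreal (diameter {x}))" by (intro hausdorff1_pre_le) auto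
    then show "hausdorff1_pre \<delta> {x} \<le> 0" by simp
  qed
  then show ?thesis by simp
qed

lemma hausdorff1_outer_subset_null: "A \<subseteq> B \<Longrightarrow> hausdorff1_outer B = 0 \<Longrightarrow> hausdorff1_outer A = 0"
  using hausdorff1_outer_mono[of A B] by simp

lemma hausdorff1_outer_finite:
  assumes "finite A"
  shows "hausdorff1_outer A = 0"
  using hausdorff1_outer_finite_UN[OF assms, of "\<lambda>x. {x}"] by simp

lemma finite_subsingleton:
  assumes "\<And>p q. p \<in> C \<Longrightarrow> q \<in> C \<Longrightarrow> p = q"
  shows "finite C"
proof (cases "C = {}")
  case False
  then obtain a where "a \<in> C" by auto
  then have "C = {a}" using assms by blast
  then show ?thesis by simp
qed simp

text \<open>Argued on each component: a nondegenerate one is a Lipschitz curve, and almost all its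
  points are passed with nonzero velocity; a degenerate one is a single point, hence null.\<close>

theorem AE_approx_normal:
  fixes K :: "(real^2) set"
  assumes K: "compact K" "finite (components K)" "hausdorff1_outer K < \<infinity>"
  shows "AE x in H1_on K. approx_normal K x (normal_at K x)"
proof -
  have Kb: "K \<in> sets borel" using K(1) by (rule borel_compact)
  define reg where "reg x \<longleftrightarrow> (\<exists>g t v. continuous_on UNIV g \<and> range g \<subseteq> K \<and> g t = x \<and> v \<noteq> 0 \<and>
    (g has_vector_derivative v) (at t))" for x
  have "hausdorff1_outer {x \<in> C. \<not> reg x} = 0" if C: "C \<in> components K" for C
  proof (cases "\<exists>p\<in>C. \<exists>q\<in>C. p \<noteq> q")
    case True
    then obtain p q where pq: "p \<in> C" "q \<in> C" "p \<noteq> q" by blast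
    have C': "compact C" "connected C" "C \<subseteq> K"
      using compact_components[OF K(1) C] in_components_connected[OF C] in_components_subset[OF C] by auto
    have "hausdorff1_outer C < \<infinity>" using hausdorff1_outer_mono[OF C'(3)] K(3) by (rule le_less_trans)
    then obtain g :: "real \<Rightarrow> real^2" where g: "range g = C" "\<And>s t. dist (g s) (g t) \<le> 2 * dist s t"
      using continuum_lipschitz_curve[OF C'(1,2) _ pq] by metis
    have "continuous_on UNIV g"
    proof (rule lipschitz_on_continuous_on)
      show "2-lipschitz_on UNIV g" by (rule lipschitz_onI) (use g in auto)
    qed
    have "range g \<subseteq> K" using g(1) C'(3) by simp
    with \<open>continuous_on UNIV g\<close>
    have "reg x" if "\<exists>t v. g t = x \<and> v \<noteq> 0 \<and> (g has_vector_derivative v) (at t)" for x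
      using that unfolding reg_def by (intro exI[of _ g]) simp
    then have "{x \<in> C. \<not> reg x} \<subseteq> {x \<in> range g. \<not> (\<exists>t v. g t = x \<and> v \<noteq> 0 \<and> (g has_vector_derivative v) (at t))}"
      using g(1) by blast
    then show ?thesis
      by (rule hausdorff1_outer_subset_null) (rule hausdorff1_outer_not_regular_value[where L = 2], rule g(2), simp)
  next
    case False
    then have "finite C" by (intro finite_subsingleton) blast
    then show ?thesis by (intro hausdorff1_outer_finite) auto
  qed
  then have "(\<Sum>C\<in>components K. hausdorff1_outer {x \<in> C. \<not> reg x}) = 0" by (intro sum.neutral) blast
  then have "hausdorff1_outer (\<Union>C\<in>components K. {x \<in> C. \<not> reg x}) = 0"
    using hausdorff1_outer_finite_UN[OF K(2), of "\<lambda>C. {x \<in> C. \<not> reg x}"] by simp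
  moreover have "{x \<in> K. \<not> reg x} \<subseteq> (\<Union>C\<in>components K. {x \<in> C. \<not> reg x})"
    using Union_components[of K] by blast
  ultimately have "hausdorff1_outer {x \<in> K. \<not> reg x} = 0" by (rule hausdorff1_outer_subset_null[rotated])
  then have "AE x in H1_on K. reg x" by (rule AE_H1_onI[OF Kb])
  with AE_upper_density_le_1[OF Kb K(3)] show ?thesis
  proof eventually_elim
    case (elim x)
    then obtain g t v where "continuous_on UNIV g" "range g \<subseteq> K" "g t = x" "v \<noteq> 0"
      "(g has_vector_derivative v) (at t)" unfolding reg_def by blast
    then have "approx_normal K x (- rot ((1 / norm v) *\<^sub>R v))"
      using elim(1) by (intro approx_normal_of_tangent[OF Kb K(3)]) auto
    then show ?case unfolding normal_at_def by (rule someI)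
  qed
qed

text \<open>The bound is demanded at all points of \<open>K\<close> near \<open>x\<close>, with a
  common range of radii, since it is applied at points off the tangent line and not only at the
  centre.\<close>

definition lower_density_near :: "'a::metric_space set \<Rightarrow> 'a \<Rightarrow> bool" where
  "lower_density_near K x \<longleftrightarrow> (\<exists>\<eta>>0. \<forall>y\<in>K \<inter> ball x \<eta>. \<forall>r. 0 < r \<longrightarrow> r < \<eta> \<longrightarrow>
     ennreal r \<le> hausdorff1_outer (K \<inter> cball y r))"

text \<open>The other components form a closed set, so near a point of a nondegenerate component
  \<open>C\<close> the set \<open>K\<close> is just the connected \<open>C\<close>. The bound can
  fail in a component only if that component is a single point.\<close>

lemma AE_lower_density_near:
  fixes K :: "(real^2) set"
  assumes K: "compact K" "finite (components K)"
  shows "AE x in H1_on K. lower_density_near K x"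
proof (rule AE_H1_onI)
  show "K \<in> sets borel" using K(1) by (rule borel_compact)
  have "lower_density_near K x" if C: "C \<in> components K" "x \<in> C" and pq: "p \<in> C" "q \<in> C" "p \<noteq> q" for C x p q
  proof -
    let ?D = "\<Union>(components K - {C})"
    have "x \<notin> ?D" using C components_nonoverlap[of C K] by blast
    moreover have "closed ?D"
      using K compact_imp_closed[OF K(1)] by (intro closed_Union) (auto intro: closed_components)
    ultimately obtain e where e: "e > 0" "ball x e \<subseteq> - ?D"
      by (metis ComplI openE open_Compl)
    then have Ce: "K \<inter> ball x e \<subseteq> C" using Union_components[of K] by blast
    have CK: "C \<subseteq> K" "connected C" using C by (auto dest: in_components_subset in_components_connected)
    define \<eta> where "\<eta> = min e (dist p q / 2)"
    have \<eta>: "0 < \<eta>" "\<eta> \<le> e" "\<eta> \<le> dist p q / 2" using e pq by (auto simp: \<eta>_def)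
    have "ennreal r \<le> hausdorff1_outer (K \<inter> cball y r)" if y: "y \<in> K \<inter> ball x \<eta>" and r: "0 < r" "r < \<eta>" for y r
    proof -
      have "y \<in> C" using Ce y \<eta> by auto
      have "\<exists>z\<in>C. r \<le> dist y z"
      proof (rule ccontr)
        assume "\<not> ?thesis"
        then have "dist y p < r" "dist y q < r" using pq by (auto simp: not_le)
        then show False using dist_triangle3[of p q y] r \<eta> by linarith
      qed
      then obtain z where "z \<in> C" "r \<le> dist y z" by blast
      then have "ennreal r \<le> hausdorff1_outer (C \<inter> cball y r)"
        by (intro hausdorff1_outer_connected_ge[OF CK(2) \<open>y \<in> C\<close>])
      also have "\<dots> \<le> hausdorff1_outer (K \<inter> cball y r)" using CK by (intro hausdorff1_outer_mono) auto
      finally show ?thesis .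
    qed
    with \<eta>(1) show ?thesis unfolding lower_density_near_def by blast
  qed
  then have "finite {x \<in> C. \<not> lower_density_near K x}" if "C \<in> components K" for C
    using that by (intro finite_subsingleton) blast
  then have "hausdorff1_outer {x \<in> C. \<not> lower_density_near K x} = 0" if "C \<in> components K" for C
    using that by (intro hausdorff1_outer_finite)
  then have "(\<Sum>C\<in>components K. hausdorff1_outer {x \<in> C. \<not> lower_density_near K x}) = 0" by (intro sum.neutral) blast
  then have "hausdorff1_outer (\<Union>C\<in>components K. {x \<in> C. \<not> lower_density_near K x}) = 0"
    using hausdorff1_outer_finite_UN[OF K(2), of "\<lambda>C. {x \<in> C. \<not> lower_density_near K x}"] by simp
  moreover have "{x \<in> K. \<not> lower_density_near K x} \<subseteq> (\<Union>C\<in>components K. {x \<in> C. \<not> lower_density_near K x})"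
    using Union_components[of K] by blast
  ultimately show "hausdorff1_outer {x \<in> K. \<not> lower_density_near K x} = 0"
    by (rule hausdorff1_outer_subset_null[rotated])
qed

section \<open>Consequences of an approximate normal at small scales\<close>

lemma compact_closure_support:
  fixes f :: "'a::heine_borel \<Rightarrow> real"
  assumes "\<And>y. f y \<noteq> 0 \<Longrightarrow> y \<in> cball a R"
  shows "compact (closure {y. f y \<noteq> 0})"
  using assms by (intro bounded_subset[OF bounded_cball[of a R], THEN compact_closure[THEN iffD2]]) blast

lemma integrable_line:
  fixes f :: "real^2 \<Rightarrow> real"
  assumes f: "continuous_on UNIV f" "\<And>y. f y \<noteq> 0 \<Longrightarrow> norm y \<le> R" and \<tau>: "norm \<tau> = 1"
  shows "integrable lborel (\<lambda>t. f (t *\<^sub>R \<tau>))"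
proof -
  have "continuous_on {-R..R} (\<lambda>t. f (t *\<^sub>R \<tau>))"
    by (intro continuous_on_compose2[OF f(1)] continuous_intros) auto
  then have "integrable lborel (\<lambda>t. f (t *\<^sub>R \<tau>) * indicator {-R..R} t)"
    using borel_integrable_compact[of "{-R..R}" "\<lambda>t. f (t *\<^sub>R \<tau>)"]
    by (auto simp: set_integrable_def mult.commute)
  moreover have "f (t *\<^sub>R \<tau>) * indicator {-R..R} t = f (t *\<^sub>R \<tau>)" for t
    using f(2)[of "t *\<^sub>R \<tau>"] \<tau> by (auto simp: indicator_def abs_le_iff)
  ultimately show ?thesis by simp
qed

lemma line_integral_ge:
  fixes f :: "real^2 \<Rightarrow> real"
  assumes f: "continuous_on UNIV f" "\<And>y. f y \<noteq> 0 \<Longrightarrow> norm y \<le> R" and \<tau>: "norm \<tau> = 1"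
    and nonneg: "\<And>y. 0 \<le> f y" and ge: "\<And>t. a \<le> t \<Longrightarrow> t \<le> b \<Longrightarrow> c \<le> f (t *\<^sub>R \<tau>)" and ab: "a \<le> b"
  shows "c * (b - a) \<le> (\<integral>t. f (t *\<^sub>R \<tau>) \<partial>lborel)"
proof -
  have "c * (b - a) = (\<integral>t. c * indicator {a..b} t \<partial>lborel)" using ab by simp
  also have "\<dots> \<le> (\<integral>t. f (t *\<^sub>R \<tau>) \<partial>lborel)"
  proof (rule integral_mono)
    show "integrable lborel (\<lambda>t. c * indicator {a..b} t)"
      by (intro integrable_mult_right integrable_real_indicator) (auto simp: emeasure_lborel_Icc_eq)
    show "c * indicator {a..b} t \<le> f (t *\<^sub>R \<tau>)" for t
      using ge[of t] nonneg[of "t *\<^sub>R \<tau>"] by (auto simp: indicator_def)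
  qed (rule integrable_line[OF f \<tau>])
  finally show ?thesis .
qed

lemma approx_normal_tendsto:
  assumes "approx_normal K x \<nu>" "K \<in> sets borel"
    and f: "continuous_on UNIV f" "\<And>y. f y \<noteq> 0 \<Longrightarrow> norm y \<le> R"
  shows "((\<lambda>\<rho>. (\<integral>y. f (blow_up x \<rho> y) \<partial>H1_on K) / \<rho>) \<longlongrightarrow> (\<integral>t. f (t *\<^sub>R rot \<nu>) \<partial>lborel)) (at_right 0)"
proof -
  have [measurable]: "f \<in> borel_measurable borel" using f(1) by (rule borel_measurable_continuous_onI)
  have \<nu>: "norm \<nu> = 1" using assms(1) by (simp add: approx_normal_def)
  have "compact (closure {y. f y \<noteq> 0})" by (rule compact_closure_support[of f 0 R]) (use f in auto)
  then have "((\<lambda>\<rho>. integral\<^sup>L (H1_on (blow_up x \<rho> ` K)) f) \<longlongrightarrow> integral\<^sup>L (H1_on {y. y \<bullet> \<nu> = 0}) f) (at_right 0)"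
    using assms(1) f(1) unfolding approx_normal_def loc_weak_star_def by blast
  moreover have "integral\<^sup>L (H1_on {y. y \<bullet> \<nu> = 0}) f = (\<integral>t. f (t *\<^sub>R rot \<nu>) \<partial>lborel)"
    by (rule integral_H1_on_line[OF \<nu>]) measurable
  moreover have "\<forall>\<^sub>F \<rho> in at_right 0. integral\<^sup>L (H1_on (blow_up x \<rho> ` K)) f = (\<integral>y. f (blow_up x \<rho> y) \<partial>H1_on K) / \<rho>"
    using eventually_at_right_less[of 0]
  proof eventually_elim
    case (elim \<rho>)
    show ?case using integral_H1_on_blow_up[OF elim assms(2), of f x] by simp
  qed
  ultimately show ?thesis using Lim_transform_eventually by fastforce
qed

text \<open>The test function lies below the indicator of the unit ball and equals 1 up to radius
  \<open>1 - e / 2\<close>; its integral over the line is at least \<open>2 - e\<close>, which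
  exceeds \<open>(1 - e) * 2\<close>.\<close>

lemma approx_normal_lower_density:
  assumes K: "K \<in> sets borel" "hausdorff1_outer K < \<infinity>" and nx: "approx_normal K x \<nu>" and e: "0 < e"
  shows "\<forall>\<^sub>F r in at_right 0. (1 - e) * (2 * r) \<le> measure (H1_on K) (cball x r)"
proof (cases "1 \<le> e")
  case True
  show ?thesis using eventually_at_right_less[of 0]
  proof eventually_elim
    case (elim r)
    have "(1 - e) * (2 * r) \<le> 0" using True elim by (intro mult_nonpos_nonneg) auto
    then show ?case using measure_nonneg order_trans by blast
  qed
next
  case False
  interpret M: finite_measure "H1_on K" by (rule finite_measure_H1_on[OF K])
  have \<nu>: "norm \<nu> = 1" using nx by (simp add: approx_normal_def)
  define e2 where "e2 = e / 2"
  have e2: "0 < e2" "e2 < 1" using e False by (auto simp: e2_def)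
  define f :: "real^2 \<Rightarrow> real" where "f y = max 0 (min 1 ((1 - norm y) / e2))" for y
  have f: "continuous_on UNIV f" "\<And>y. f y \<noteq> 0 \<Longrightarrow> norm y \<le> 1" "\<And>y. 0 \<le> f y" "\<And>y. f y \<le> indicator (cball 0 1) y"
  proof -
    show "continuous_on UNIV f" unfolding f_def using e2 by (intro continuous_intros) auto
    have neg: "f y = 0" if "1 < norm y" for y
      using that e2 by (simp add: f_def min_def max_def divide_less_0_iff not_le)
    then show "norm y \<le> 1" if "f y \<noteq> 0" for y using that by (meson not_le)
    show "0 \<le> f y" "f y \<le> indicator (cball 0 1) y" for y
      using neg[of y] by (auto simp: f_def indicator_def)
  qed
  have [measurable]: "f \<in> borel_measurable borel" using f(1) by (rule borel_measurable_continuous_onI)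
  have "1 * ((1 - e2) - (-(1 - e2))) \<le> (\<integral>t. f (t *\<^sub>R rot \<nu>) \<partial>lborel)"
    by (rule line_integral_ge[OF f(1,2)]) (use \<nu> e2 f(3) in \<open>auto simp: f_def field_simps\<close>)
  moreover have "(1 - e) * 2 < 1 * ((1 - e2) - (-(1 - e2)))" using e by (simp add: e2_def)
  ultimately have "(1 - e) * 2 < (\<integral>t. f (t *\<^sub>R rot \<nu>) \<partial>lborel)" by linarith
  moreover have "((\<lambda>\<rho>. (\<integral>y. f (blow_up x \<rho> y) \<partial>H1_on K) / \<rho>) \<longlongrightarrow> (\<integral>t. f (t *\<^sub>R rot \<nu>) \<partial>lborel)) (at_right 0)"
    by (rule approx_normal_tendsto[OF nx K(1) f(1)]) (rule f(2))
  ultimately have "\<forall>\<^sub>F r in at_right 0. (1 - e) * 2 < (\<integral>y. f (blow_up x r y) \<partial>H1_on K) / r"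
    by (intro order_tendstoD(1))
  from this eventually_at_right_less[of 0] show ?thesis
  proof eventually_elim
    case (elim r)
    have "(\<integral>y. f (blow_up x r y) \<partial>H1_on K) \<le> (\<integral>y. indicator (cball x r) y \<partial>H1_on K)"
    proof (rule integral_mono)
      show "integrable (H1_on K) (\<lambda>y. f (blow_up x r y))"
        by (rule M.integrable_const_bound[where B = 1]) (use f(3) in \<open>auto simp: f_def\<close>)
      show "integrable (H1_on K) (\<lambda>y. indicat_real (cball x r) y)"
        by (rule integrable_real_indicator) (auto simp: less_top[symmetric])
      show "f (blow_up x r y) \<le> indicator (cball x r) y" for y
        using f(4)[of "blow_up x r y"] elim(2) by (auto simp: indicator_def norm_blow_up split: if_splits)
    qed
    also have "\<dots> = measure (H1_on K) (cball x r)" by (subst Bochner_Integration.integral_indicator) simp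
    finally show ?case using elim by (simp add: field_simps)
  qed
qed

text \<open>Weak convergence leaves little mass away from the line. A point of \<open>K\<close> at
  distance more than \<open>c * r\<close> from it would bring along the mass
  \<open>c * r / 2\<close>, by the lower density bound at that point, and this is too much.\<close>

lemma approx_normal_strip:
  assumes K: "K \<in> sets borel" "hausdorff1_outer K < \<infinity>" and nx: "approx_normal K x \<nu>"
    and ld: "lower_density_near K x" and e: "0 < e"
  shows "\<forall>\<^sub>F r in at_right 0. \<forall>y\<in>K \<inter> cball x r. \<bar>(y - x) \<bullet> \<nu>\<bar> \<le> e * r"
proof -
  interpret M: finite_measure "H1_on K" by (rule finite_measure_H1_on[OF K])
  have \<nu>: "norm \<nu> = 1" using nx by (simp add: approx_normal_def)
  obtain \<eta> where \<eta>: "0 < \<eta>" "\<And>y r. y \<in> K \<Longrightarrow> dist x y < \<eta> \<Longrightarrow> 0 < r \<Longrightarrow> r < \<eta> \<Longrightarrow> ennreal r \<le> hausdorff1_outer (K \<inter> cball y r)"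
    using ld unfolding lower_density_near_def by auto
  \<comment> \<open>The cap keeps the auxiliary ball of radius \<open>c * r / 2\<close> inside the
    ball of radius \<open>2 * r\<close> around \<open>x\<close>.\<close>
  define c where "c = min e 1"
  have c: "0 < c" "c \<le> 1" "c \<le> e" using e by (auto simp: c_def)
  \<comment> \<open>Zero on the line, and at least \<open>c / 4\<close> at points of norm at most 2
    with normal component at least \<open>c / 2\<close>. Integrated over a ball of mass
    \<open>c * r / 2\<close> and divided by \<open>r\<close>, this gives the threshold
    \<open>c\<^sup>2 / 8\<close>.\<close>
  define f :: "real^2 \<Rightarrow> real" where "f y = max 0 (\<bar>y \<bullet> \<nu>\<bar> - c / 4) * max 0 (3 - norm y)" for y
  have f: "continuous_on UNIV f" "\<And>y. f y \<noteq> 0 \<Longrightarrow> norm y \<le> 3"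
    by (auto simp: f_def intro!: continuous_intros)
  have f0: "0 \<le> f y" for y by (simp add: f_def)
  have [measurable]: "f \<in> borel_measurable borel" using f(1) by (rule borel_measurable_continuous_onI)
  have f9: "f y \<le> 9" for y
  proof (cases "norm y \<le> 3")
    case True
    have "\<bar>y \<bullet> \<nu>\<bar> \<le> 3" using Cauchy_Schwarz_ineq2[of y \<nu>] True \<nu> by simp
    then have "f y \<le> 3 * 3" unfolding f_def using c True by (intro mult_mono) auto
    then show ?thesis by simp
  qed (simp add: f_def)
  have "(\<integral>t. f (t *\<^sub>R rot \<nu>) \<partial>lborel) = 0" using c by (simp add: f_def)
  moreover have "0 < c\<^sup>2 / 8" using c by simp
  ultimately have lim: "\<forall>\<^sub>F r in at_right 0. (\<integral>y. f (blow_up x r y) \<partial>H1_on K) / r < c\<^sup>2 / 8"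
    by (intro order_tendstoD(2)[OF approx_normal_tendsto[OF nx K(1) f]]) simp_all
  have "\<forall>\<^sub>F r in at_right 0. r \<in> {0<..<\<eta>}" by (rule eventually_at_right_real[OF \<eta>(1)])
  with lim show ?thesis
  proof eventually_elim
    case (elim r)
    then have r: "0 < r" "r < \<eta>" by auto
    show ?case
    proof (rule ballI, rule ccontr)
      fix y assume y: "y \<in> K \<inter> cball x r" and "\<not> \<bar>(y - x) \<bullet> \<nu>\<bar> \<le> e * r"
      then have far: "c * r < \<bar>(y - x) \<bullet> \<nu>\<bar>" using c(3) r(1) by (meson less_le_not_le mult_right_mono not_le order_trans less_imp_le)
      have "c * r / 2 < \<eta>" using c(2) r mult_right_mono[of c 1 r] by linarith
      then have "ennreal (c * r / 2) \<le> hausdorff1_outer (K \<inter> cball y (c * r / 2))"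
        using \<eta>(2)[of y "c * r / 2"] y r c by auto
      then have m: "c * r / 2 \<le> measure (H1_on K) (cball y (c * r / 2))"
        using hausdorff1_outer_eq_measure[OF K, of "cball y (c * r / 2)"]
        by (simp add: ennreal_le_iff[OF measure_nonneg])
      have low: "c / 4 * indicator (cball y (c * r / 2)) z \<le> f (blow_up x r z)" for z
      proof (cases "z \<in> cball y (c * r / 2)")
        case True
        then have dz: "norm (z - y) \<le> c * r / 2" by (simp add: dist_norm norm_minus_commute)
        have "\<bar>(z - y) \<bullet> \<nu>\<bar> \<le> c * r / 2" using Cauchy_Schwarz_ineq2[of "z - y" \<nu>] \<nu> dz by simp
        moreover have "(z - x) \<bullet> \<nu> = (z - y) \<bullet> \<nu> + (y - x) \<bullet> \<nu>" by (simp add: inner_diff_left)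
        ultimately have "c * r / 2 \<le> \<bar>(z - x) \<bullet> \<nu>\<bar>" using far by linarith
        then have a: "c / 2 \<le> \<bar>blow_up x r z \<bullet> \<nu>\<bar>"
          using r(1) unfolding blow_up_def inner_scaleR_left by (simp add: abs_mult field_simps)
        have "dist x z \<le> dist x y + dist y z" by (rule dist_triangle)
        also have "\<dots> \<le> r + c * r / 2" using y True by auto
        also have "\<dots> \<le> 2 * r" using c(2) r(1) mult_right_mono[of c 1 r] by linarith
        finally have b: "norm (blow_up x r z) \<le> 2" using r(1) by (simp add: norm_blow_up field_simps)
        have "c / 4 * 1 \<le> f (blow_up x r z)"
          unfolding f_def using a b c by (intro mult_mono) auto
        then show ?thesis using True by simp
      qed (use f0 in simp)
      have "c / 4 * (c * r / 2) \<le> c / 4 * measure (H1_on K) (cball y (c * r / 2))"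
        using m c by (intro mult_left_mono) auto
      also have "\<dots> = (\<integral>z. c / 4 * indicator (cball y (c * r / 2)) z \<partial>H1_on K)"
        by (subst integral_mult_right_zero, subst Bochner_Integration.integral_indicator) simp
      also have "\<dots> \<le> (\<integral>z. f (blow_up x r z) \<partial>H1_on K)"
      proof (rule integral_mono)
        show "integrable (H1_on K) (\<lambda>z. c / 4 * indicator (cball y (c * r / 2)) z)"
          by (intro integrable_mult_right integrable_real_indicator) (auto simp: less_top[symmetric])
        show "integrable (H1_on K) (\<lambda>z. f (blow_up x r z))"
          by (rule M.integrable_const_bound[where B = 9]) (use f0 f9 in auto)
      qed (rule low)
      finally have "c\<^sup>2 / 8 \<le> (\<integral>z. f (blow_up x r z) \<partial>H1_on K) / r"
        using r(1) by (simp add: field_simps power2_eq_square)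
      then show False using elim(1) by simp
    qed
  qed
qed

text \<open>A bump of radius \<open>e / 2\<close> at a point of the line has a positive integral
  along it, so \<open>K\<close> eventually meets the support of the rescaled bump; finitely many
  bumps serve the whole segment.\<close>

lemma approx_normal_line_near:
  assumes K: "K \<in> sets borel" and nx: "approx_normal K x \<nu>" and e: "0 < e"
  shows "\<forall>\<^sub>F r in at_right 0. \<forall>t\<in>{-1..1}. \<exists>y\<in>K. dist y (x + (r * t) *\<^sub>R rot \<nu>) \<le> e * r"
proof -
  have \<nu>: "norm \<nu> = 1" using nx by (simp add: approx_normal_def)
  obtain T where T: "finite T" "{-1..1::real} \<subseteq> (\<Union>s\<in>T. ball s (e / 2))"
  proof -
    have "\<exists>k. finite k \<and> k \<subseteq> {-1..1} \<and> {-1..1::real} \<subseteq> (\<Union>x\<in>k. ball x (e / 2))"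
      using seq_compact_imp_totally_bounded[OF compact_imp_seq_compact[OF compact_Icc[of "-1::real" 1]]] e by simp
    then obtain k where "finite k" "{-1..1::real} \<subseteq> (\<Union>x\<in>k. ball x (e / 2))" by (elim exE conjE)
    then show ?thesis by (rule that)
  qed
  have "\<forall>\<^sub>F r in at_right 0. \<exists>y\<in>K. dist y (x + (r * s) *\<^sub>R rot \<nu>) \<le> e / 2 * r" for s
  proof -
    define f :: "real^2 \<Rightarrow> real" where "f y = max 0 (e / 2 - norm (y - s *\<^sub>R rot \<nu>))" for y
    have f: "continuous_on UNIV f" "0 \<le> f y" for y
      by (auto simp: f_def intro!: continuous_intros)
    have fR: "norm y \<le> \<bar>s\<bar> + e / 2" if "f y \<noteq> 0" for y
    proof -
      have "norm (y - s *\<^sub>R rot \<nu>) \<le> e / 2" using that by (auto simp: f_def max_def split: if_splits)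
      then show ?thesis using norm_triangle_sub[of y "s *\<^sub>R rot \<nu>"] \<nu> by simp
    qed
    have "e / 4 * ((s + e / 4) - (s - e / 4)) \<le> (\<integral>t. f (t *\<^sub>R rot \<nu>) \<partial>lborel)"
    proof (rule line_integral_ge[OF f(1) fR])
      fix t assume t: "s - e / 4 \<le> t" "t \<le> s + e / 4"
      have "norm (t *\<^sub>R rot \<nu> - s *\<^sub>R rot \<nu>) = \<bar>t - s\<bar>" using \<nu> by (simp add: scaleR_diff_left[symmetric])
      moreover have "\<bar>t - s\<bar> \<le> e / 4" using t by linarith
      ultimately show "e / 4 \<le> f (t *\<^sub>R rot \<nu>)" by (simp add: f_def le_max_iff_disj)
    qed (use \<nu> f(2) e in auto)
    moreover have "0 < e / 4 * ((s + e / 4) - (s - e / 4))" using e by simp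
    ultimately have "0 < (\<integral>t. f (t *\<^sub>R rot \<nu>) \<partial>lborel)" by linarith
    moreover have "((\<lambda>\<rho>. (\<integral>y. f (blow_up x \<rho> y) \<partial>H1_on K) / \<rho>) \<longlongrightarrow> (\<integral>t. f (t *\<^sub>R rot \<nu>) \<partial>lborel)) (at_right 0)"
      by (rule approx_normal_tendsto[OF nx K f(1)]) (rule fR)
    ultimately have "\<forall>\<^sub>F r in at_right 0. 0 < (\<integral>y. f (blow_up x r y) \<partial>H1_on K) / r"
      by (intro order_tendstoD(1))
    from this eventually_at_right_less[of 0] show ?thesis
    proof eventually_elim
      case (elim r)
      show ?case
      proof (rule ccontr)
        assume neg: "\<not> ?thesis"
        have "f (blow_up x r y) = 0" if "y \<in> K" for y
        proof -
          have "e / 2 * r < dist y (x + (r * s) *\<^sub>R rot \<nu>)" using neg that by auto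
          also have "\<dots> = norm (r *\<^sub>R (blow_up x r y - s *\<^sub>R rot \<nu>))"
            using elim(2) by (simp add: dist_norm blow_up_def scaleR_diff_right algebra_simps)
          finally have "e / 2 < norm (blow_up x r y - s *\<^sub>R rot \<nu>)" using elim(2) by (simp add: mult.commute)
          then show ?thesis by (simp add: f_def)
        qed
        then have "AE y in H1_on K. f (blow_up x r y) = 0" using K by (simp add: AE_measure_restr)
        then have "(\<integral>y. f (blow_up x r y) \<partial>H1_on K) = 0" by (rule integral_eq_zero_AE)
        then show False using elim(1) by simp
      qed
    qed
  qed
  then have "\<forall>\<^sub>F r in at_right 0. \<forall>s\<in>T. \<exists>y\<in>K. dist y (x + (r * s) *\<^sub>R rot \<nu>) \<le> e / 2 * r"
    using T(1) by (intro eventually_ball_finite) auto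
  then show ?thesis using eventually_at_right_less[of 0]
  proof eventually_elim
    case (elim r)
    show ?case
    proof
      fix t :: real assume "t \<in> {-1..1}"
      then obtain s where s: "s \<in> T" "dist s t < e / 2" using T(2) by auto
      then obtain y where y: "y \<in> K" "dist y (x + (r * s) *\<^sub>R rot \<nu>) \<le> e / 2 * r" using elim(1) by blast
      have "dist (x + (r * s) *\<^sub>R rot \<nu>) (x + (r * t) *\<^sub>R rot \<nu>) = r * dist s t"
        using \<nu> elim(2) by (simp add: dist_norm scaleR_diff_left[symmetric] abs_mult right_diff_distrib[symmetric])
      also have "\<dots> \<le> r * (e / 2)" using s(2) elim(2) by (intro mult_left_mono) auto
      finally have "dist y (x + (r * t) *\<^sub>R rot \<nu>) \<le> e * r"
        using dist_triangle[of y "x + (r * t) *\<^sub>R rot \<nu>" "x + (r * s) *\<^sub>R rot \<nu>"] y(2) by (simp add: algebra_simps)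
      then show "\<exists>y\<in>K. dist y (x + (r * t) *\<^sub>R rot \<nu>) \<le> e * r" using y(1) by blast
    qed
  qed
qed

subsection \<open>Riemann sums and projections\<close>

lemma eventually_compact_separated:
  fixes A B :: "'a::heine_borel set"
  assumes "compact A" "compact B" "A \<inter> B = {}"
  shows "\<forall>\<^sub>F d in at_right 0. \<forall>x\<in>A. \<forall>y\<in>B. d \<le> dist x y"
proof -
  obtain d0 where d0: "0 < d0" "\<forall>x\<in>A. \<forall>y\<in>B. d0 \<le> dist x y"
    using separate_compact_closed[OF assms(1) compact_imp_closed[OF assms(2)] assms(3)] by blast
  then show ?thesis
    by (intro eventually_at_rightI[of 0 d0]) (auto intro: order_trans less_imp_le)
qed

text \<open>Finitely many level sets of height \<open>\<epsilon>\<close> are exhausted from inside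
  by compact sets. These have positive mutual distances, so nearby points of their union belong to
  the same level.\<close>

lemma lusin_approx:
  fixes M :: "'a::euclidean_space measure"
  assumes M: "finite_measure M" "sets M = sets borel"
    and h: "h \<in> borel_measurable borel" "\<And>x. 0 \<le> h x" "\<And>x. h x \<le> (B::real)"
    and \<epsilon>: "0 < \<epsilon>" and \<eta>: "0 < \<eta>"
  obtains K \<delta> where "compact K" "0 < \<delta>" "measure M (UNIV - K) \<le> \<eta>"
    "\<And>x y. x \<in> K \<Longrightarrow> y \<in> K \<Longrightarrow> dist x y < \<delta> \<Longrightarrow> \<bar>h x - h y\<bar> \<le> \<epsilon>"
proof -
  interpret finite_measure M by (rule M)
  note h(1)[measurable] M(2)[measurable_cong]
  define N where "N = nat \<lfloor>B / \<epsilon>\<rfloor>"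
  define L where "L j = {x. real j * \<epsilon> \<le> h x \<and> h x < (real j + 1) * \<epsilon>}" for j :: nat
  have L: "L j \<in> sets borel" for j unfolding L_def by measurable
  have cover: "x \<in> (\<Union>j\<le>N. L j)" for x
  proof -
    define j where "j = nat \<lfloor>h x / \<epsilon>\<rfloor>"
    have "real j \<le> h x / \<epsilon>" "h x / \<epsilon> < real j + 1" using h(2)[of x] \<epsilon> unfolding j_def by (auto intro!: of_nat_floor)
    then have "x \<in> L j" using \<epsilon> by (auto simp: L_def field_simps)
    moreover have "j \<le> N" unfolding j_def N_def using h(3)[of x] \<epsilon> by (intro nat_mono floor_mono divide_right_mono) auto
    ultimately show ?thesis by blast
  qed
  have "\<exists>C. compact C \<and> C \<subseteq> L j \<and> measure M (L j - C) \<le> \<eta> / (N + 1)" for j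
  proof -
    have \<eta>': "0 < \<eta> / (N + 1)" using \<eta> by simp
    have "\<exists>C. C \<subseteq> L j \<and> compact C \<and> measure M (L j) \<le> measure M C + \<eta> / (N + 1)"
    proof (cases "emeasure M (L j) = 0")
      case True
      then show ?thesis using \<eta>' by (intro exI[of _ "{}"]) (auto simp: measure_def)
    next
      case False
      have "emeasure M (L j) = (SUP C\<in>{C. C \<subseteq> L j \<and> compact C}. emeasure M C)"
        by (rule inner_regular[OF M(2)]) (use L in auto)
      moreover have "emeasure M (L j) - ennreal (\<eta> / (N + 1)) < emeasure M (L j)"
      proof (rule ennreal_between)
        have "emeasure M (L j) \<noteq> top" by simp
        then show "emeasure M (L j) < top" by (simp only: less_top)
      qed (use \<eta>' False in \<open>auto simp: zero_less_iff_neq_zero\<close>)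
      ultimately obtain C where C: "C \<subseteq> L j" "compact C" "emeasure M (L j) - ennreal (\<eta> / (N + 1)) < emeasure M C"
        by (auto simp: less_SUP_iff)
      then have "ennreal (measure M (L j) - \<eta> / (N + 1)) < ennreal (measure M C)"
        using \<eta>' by (simp add: emeasure_eq_measure ennreal_minus)
      then have "measure M (L j) - \<eta> / (N + 1) < measure M C"
        by (meson ennreal_leI not_le)
      then show ?thesis using C by (intro exI[of _ C]) auto
    qed
    then obtain C where C: "C \<subseteq> L j" "compact C" "measure M (L j) \<le> measure M C + \<eta> / (N + 1)" by blast
    moreover have "measure M (L j - C) = measure M (L j) - measure M C"
      using C L by (intro finite_measure_Diff) (auto simp: M(2) borel_compact)
    ultimately show ?thesis using C by (intro exI[of _ C]) auto
  qed
  then obtain C where C: "\<And>j. compact (C j)" "\<And>j. C j \<subseteq> L j" "\<And>j. measure M (L j - C j) \<le> \<eta> / (N + 1)" by metis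
  have disj: "L i \<inter> L j = {}" if "i < j" for i j
  proof -
    have "(real i + 1) * \<epsilon> \<le> real j * \<epsilon>" using that \<epsilon> by (intro mult_right_mono) auto
    then show ?thesis by (auto simp: L_def)
  qed
  have "\<forall>\<^sub>F d in at_right 0. \<forall>i\<in>{..N}. \<forall>j\<in>{..N}. i \<noteq> j \<longrightarrow> (\<forall>x\<in>C i. \<forall>y\<in>C j. d \<le> dist x y)"
  proof (intro eventually_ball_finite ballI finite_atMost)
    fix i j
    show "\<forall>\<^sub>F d in at_right 0. i \<noteq> j \<longrightarrow> (\<forall>x\<in>C i. \<forall>y\<in>C j. d \<le> dist x y)"
    proof (cases "i = j")
      case False
      then have "C i \<inter> C j = {}" using disj[of i j] disj[of j i] C(2) by (meson disjoint_iff linorder_neqE_nat subsetD)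
      from eventually_compact_separated[OF C(1) C(1) this] show ?thesis by (rule eventually_mono) blast
    qed simp
  qed
  moreover have "\<forall>\<^sub>F d::real in at_right 0. 0 < d" by (rule eventually_at_right_less)
  ultimately have "\<forall>\<^sub>F d in at_right 0. 0 < d \<and> (\<forall>i\<in>{..N}. \<forall>j\<in>{..N}. i \<noteq> j \<longrightarrow> (\<forall>x\<in>C i. \<forall>y\<in>C j. d \<le> dist x y))"
    by eventually_elim blast
  from eventually_happens'[OF trivial_limit_at_right_real this]
  obtain d where "0 < d \<and> (\<forall>i\<in>{..N}. \<forall>j\<in>{..N}. i \<noteq> j \<longrightarrow> (\<forall>x\<in>C i. \<forall>y\<in>C j. d \<le> dist x y))" ..
  then have d: "0 < d" "\<And>i j x y. i \<le> N \<Longrightarrow> j \<le> N \<Longrightarrow> i \<noteq> j \<Longrightarrow> x \<in> C i \<Longrightarrow> y \<in> C j \<Longrightarrow> d \<le> dist x y"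
    by simp_all
  show ?thesis
  proof (rule that[of "\<Union>j\<le>N. C j" d])
    show "compact (\<Union>j\<le>N. C j)" using C(1) by auto
    show "0 < d" by fact
    have LC: "L j - C j \<in> sets M" for j
      unfolding M(2) by (intro sets.Diff L borel_compact C(1))
    have "UNIV - (\<Union>j\<le>N. C j) \<subseteq> (\<Union>j\<le>N. L j - C j)" using cover by blast
    then have "measure M (UNIV - (\<Union>j\<le>N. C j)) \<le> measure M (\<Union>j\<le>N. L j - C j)"
      using LC by (intro finite_measure_mono sets.finite_UN) auto
    also have "\<dots> \<le> (\<Sum>j\<le>N. measure M (L j - C j))"
      using LC by (intro finite_measure_subadditive_finite) auto
    also have "\<dots> \<le> (\<Sum>j\<le>N. \<eta> / (N + 1))" by (rule sum_mono) (rule C(3))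
    finally show "measure M (UNIV - (\<Union>j\<le>N. C j)) \<le> \<eta>" by simp
    fix x y assume xy: "x \<in> (\<Union>j\<le>N. C j)" "y \<in> (\<Union>j\<le>N. C j)" "dist x y < d"
    then obtain i j where ij: "i \<le> N" "j \<le> N" "x \<in> C i" "y \<in> C j" by auto
    then have "i = j" using d(2)[of i j x y] xy(3) by force
    then have "x \<in> L i" "y \<in> L i" using ij C(2) by auto
    then show "\<bar>h x - h y\<bar> \<le> \<epsilon>" by (auto simp: L_def algebra_simps abs_le_iff)
  qed
qed

text \<open>For a merely measurable \<open>h\<close> the value at a centre may say nothing about the
  ball. Balls are therefore centred in a compact set on which \<open>h\<close> hardly varies at
  small scale, and whose complement has small mass.\<close>

theorem vitali_riemann_sum:
  fixes K :: "'a::euclidean_space set" and F :: "('a \<times> real) set"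
  assumes K: "K \<in> sets borel" "hausdorff1_outer K < \<infinity>"
    and h: "h \<in> borel_measurable borel" "\<And>x. 0 \<le> h x" "\<And>x. h x \<le> (B::real)"
    and V: "open V"
    and F: "\<And>x r. (x, r) \<in> F \<Longrightarrow> 0 < r \<and> ennreal r \<le> hausdorff1_outer (K \<inter> cball x r)"
    and fine: "AE x in H1_on K. \<forall>\<eta>>0. \<exists>r<\<eta>. (x, r) \<in> F"
    and \<epsilon>: "0 < \<epsilon>"
  obtains C where "finite C" "C \<subseteq> F"
    "pairwise (\<lambda>p q. disjnt (cball (fst p) (snd p)) (cball (fst q) (snd q))) C"
    "\<And>p. p \<in> C \<Longrightarrow> cball (fst p) (snd p) \<subseteq> V"
    "\<bar>(\<integral>y. h y * indicator V y \<partial>H1_on K) - (\<Sum>p\<in>C. h (fst p) * measure (H1_on K) (cball (fst p) (snd p)))\<bar> \<le> \<epsilon>"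
    "hausdorff1_outer (K \<inter> V - (\<Union>p\<in>C. cball (fst p) (snd p))) \<le> ennreal \<epsilon>"
proof -
  interpret M: finite_measure "H1_on K" by (rule finite_measure_H1_on[OF K])
  note h(1)[measurable]
  let ?m = "measure (H1_on K)"
  have B: "0 \<le> B" using h(2,3) order_trans by blast
  \<comment> \<open>The errors are \<open>\<epsilon>0\<close> per unit of mass,
    \<open>B * \<epsilon>0\<close> off \<open>K'\<close> and \<open>B * (2 * \<epsilon>0)\<close>
    off the balls. The summand 2 keeps the uncovered length, at most \<open>2 * \<epsilon>0\<close>,
    below \<open>\<epsilon>\<close>.\<close>
  define \<epsilon>0 where "\<epsilon>0 = \<epsilon> / (?m UNIV + 3 * B + 2)"
  have den: "0 < ?m UNIV + 3 * B + 2" using B measure_nonneg[of "H1_on K" UNIV] by linarith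
  have \<epsilon>0: "0 < \<epsilon>0" "\<epsilon>0 * (?m UNIV + 3 * B + 2) = \<epsilon>" using \<epsilon> den by (simp_all add: \<epsilon>0_def)
  obtain K' \<delta> where K': "compact K'" "0 < \<delta>" "?m (UNIV - K') \<le> \<epsilon>0"
    "\<And>x y. x \<in> K' \<Longrightarrow> y \<in> K' \<Longrightarrow> dist x y < \<delta> \<Longrightarrow> \<bar>h x - h y\<bar> \<le> \<epsilon>0"
    using lusin_approx[of "H1_on K" h B \<epsilon>0 \<epsilon>0] M.finite_measure_axioms h \<epsilon>0(1) by auto
  obtain N where N: "{x \<in> space (H1_on K). \<not> (\<forall>\<eta>>0. \<exists>r<\<eta>. (x, r) \<in> F)} \<subseteq> N" "N \<in> null_sets (H1_on K)"
    using fine by (auto elim: AE_E simp: null_sets_def)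
  define E where "E = K \<inter> K' \<inter> V - N"
  have Eb: "E \<in> sets borel" "N \<in> sets borel" "K' \<in> sets borel"
  proof -
    show "N \<in> sets borel" using N(2) by (auto simp: null_sets_def)
    moreover show "K' \<in> sets borel" using K'(1) by (rule borel_compact)
    ultimately show "E \<in> sets borel" unfolding E_def using K(1) borel_open[OF V] by (intro sets.Diff sets.Int)
  qed
  define F' where "F' = {p \<in> F. fst p \<in> K' \<and> snd p < \<delta> \<and> cball (fst p) (snd p) \<subseteq> V}"
  obtain C where C: "finite C" "C \<subseteq> F'"
    "pairwise (\<lambda>p q. disjnt (cball (fst p) (snd p)) (cball (fst q) (snd q))) C"
    "hausdorff1_outer (E - (\<Union>p\<in>C. cball (fst p) (snd p))) < ennreal \<epsilon>0"
  proof (rule vitali_hausdorff1[OF K, of E F' \<epsilon>0])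
    show "E \<subseteq> K" by (auto simp: E_def)
    show "0 < r \<and> ennreal r \<le> hausdorff1_outer (K \<inter> cball x r)" if "(x, r) \<in> F'" for x r
      using that F by (auto simp: F'_def)
    fix x and \<eta> :: real assume x: "x \<in> E" and \<eta>: "0 < \<eta>"
    then have "x \<in> V" "x \<in> K'" and fx: "\<forall>\<eta>>0. \<exists>r<\<eta>. (x, r) \<in> F" using N(1) by (auto simp: E_def)
    then obtain e where e: "0 < e" "ball x e \<subseteq> V" using V by (meson openE)
    have "0 < min \<eta> (min \<delta> e)" using \<eta> K'(2) e(1) by simp
    with fx obtain r where r: "r < min \<eta> (min \<delta> e)" "(x, r) \<in> F" by blast
    then have "cball x r \<subseteq> V" using e(2) by (auto simp: subset_iff)
    then show "\<exists>r<\<eta>. (x, r) \<in> F'" using r \<open>x \<in> K'\<close> by (intro exI[of _ r]) (auto simp: F'_def)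
  qed (use \<epsilon>0 in auto)
  let ?B = "\<lambda>p. cball (fst p) (snd p)"
  let ?U = "\<Union>p\<in>C. ?B p"
  have CF: "p \<in> F" "fst p \<in> K'" "snd p < \<delta>" "?B p \<subseteq> V" if "p \<in> C" for p
    using C(2) that by (auto simp: F'_def)
  have Ub: "?U \<in> sets borel" using C(1) by auto
  have rest: "?m (V - ?U) \<le> 2 * \<epsilon>0"
  proof -
    have "E - ?U \<in> sets borel" using Eb(1) Ub by auto
    then have "ennreal (?m (E - ?U)) = hausdorff1_outer (K \<inter> (E - ?U))"
      by (rule hausdorff1_outer_eq_measure[OF K, symmetric])
    also have "K \<inter> (E - ?U) = E - ?U" by (auto simp: E_def)
    also note C(4)
    finally have "?m (E - ?U) < \<epsilon>0" by (simp only: ennreal_less_iff[OF measure_nonneg])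
    moreover have "?m (V - ?U) \<le> ?m (UNIV - K') + ?m (E - ?U)"
    proof -
      have "?m (V - ?U) = ?m (K \<inter> (V - ?U))"
        using K(1) V Ub by (intro measure_eq_AE) (auto simp: AE_measure_restr)
      also have "\<dots> \<le> ?m ((UNIV - K') \<union> N \<union> (E - ?U))"
        using Eb Ub by (intro M.finite_measure_mono) (auto simp: E_def)
      also have "\<dots> \<le> ?m ((UNIV - K') \<union> N) + ?m (E - ?U)"
        using Eb Ub by (intro measure_Un_le) auto
      also have "?m ((UNIV - K') \<union> N) = ?m (UNIV - K')"
        using Eb N(2) by (intro measure_Un_null_set) auto
      finally show ?thesis .
    qed
    ultimately show ?thesis using K'(3) by linarith
  qed
  show ?thesis
  proof (rule that[of C])
    show "finite C" by fact
    show "C \<subseteq> F" using CF(1) by blast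
    show "pairwise (\<lambda>p q. disjnt (?B p) (?B q)) C" by fact
    show "?B p \<subseteq> V" if "p \<in> C" for p using CF(4)[OF that] .
    have "hausdorff1_outer (K \<inter> V - ?U) = ennreal (?m (V - ?U))"
      using V Ub by (subst hausdorff1_outer_eq_measure[OF K, symmetric]) (auto simp: Int_Diff)
    also have "\<dots> \<le> ennreal \<epsilon>"
    proof (rule ennreal_leI)
      have "\<epsilon>0 * 2 \<le> \<epsilon>0 * (?m UNIV + 3 * B + 2)"
        using B \<epsilon>0(1) measure_nonneg[of "H1_on K" UNIV] by (intro mult_left_mono) auto
      then show "?m (V - ?U) \<le> \<epsilon>" using rest \<epsilon>0(2) by linarith
    qed
    finally show "hausdorff1_outer (K \<inter> V - ?U) \<le> ennreal \<epsilon>" .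
    \<comment> \<open>\<open>D\<close> is the pointwise error of the sum. \<open>W\<close> allows
      \<open>\<epsilon>0\<close> everywhere and \<open>B\<close> at points off \<open>K'\<close> or
      outside the balls.\<close>
    define D where "D y = h y * indicator V y - (\<Sum>p\<in>C. h (fst p) * indicator (?B p) y)" for y
    define W where "W y = \<epsilon>0 + B * indicator (UNIV - K') y + B * indicator (V - ?U) y" for y
    have abs_h: "\<bar>h y - h z\<bar> \<le> B" for y z using h(2,3)[of y] h(2,3)[of z] by (auto simp: abs_le_iff)
    have DW: "\<bar>D y\<bar> \<le> W y" for y
    proof (cases "y \<in> ?U")
      case True
      then obtain p where p: "p \<in> C" "y \<in> ?B p" by auto
      have "(\<Sum>q\<in>C. h (fst q) * indicator (?B q) y) = h (fst p) * indicator (?B p) y + (\<Sum>q\<in>C - {p}. h (fst q) * indicator (?B q) y)"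
        by (rule sum.remove[OF C(1) p(1)])
      also have "(\<Sum>q\<in>C - {p}. h (fst q) * indicator (?B q) y) = 0"
      proof (rule sum.neutral, rule ballI)
        fix q assume q: "q \<in> C - {p}"
        then have "disjnt (?B p) (?B q)" using C(3) p(1) by (auto simp: pairwise_def)
        then have "y \<notin> ?B q" using p(2) by (auto simp: disjnt_def)
        then show "h (fst q) * indicator (?B q) y = 0" by simp
      qed
      finally have "D y = h y - h (fst p)" using p CF(4)[OF p(1)] by (auto simp: D_def indicator_def)
      moreover have "\<bar>h y - h (fst p)\<bar> \<le> \<epsilon>0 + B * indicator (UNIV - K') y"
      proof (cases "y \<in> K'")
        case True
        have "dist y (fst p) < \<delta>" using p(2) CF(3)[OF p(1)] by (auto simp: dist_commute)
        then show ?thesis using K'(4)[OF True CF(2)[OF p(1)]] True by simp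
      qed (use abs_h[of y "fst p"] \<epsilon>0(1) in simp)
      ultimately show ?thesis using B by (simp add: W_def add_increasing2)
    next
      case False
      then have "(\<Sum>p\<in>C. h (fst p) * indicator (?B p) y) = 0" by (intro sum.neutral) auto
      then show ?thesis using False h(2,3)[of y] \<epsilon>0(1) B
        by (auto simp: D_def W_def indicator_def)
    qed
    have intV: "integrable (H1_on K) (\<lambda>y. h y * indicator V y)"
    proof (rule M.integrable_const_bound[where B = B])
      have [measurable]: "V \<in> sets borel" using V by simp
      show "(\<lambda>y. h y * indicator V y) \<in> borel_measurable (H1_on K)" by measurable
    qed (use h(2,3) B in \<open>auto simp: indicator_def\<close>)
    have intI: "integrable (H1_on K) (\<lambda>y. c * indicator A y)" if "A \<in> sets borel" for c :: real and A
      using that by (intro integrable_mult_right integrable_real_indicator) (auto simp: less_top[symmetric])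
    have vI: "(\<integral>y. c * indicator A y \<partial>H1_on K) = c * ?m A" if "A \<in> sets borel" for c :: real and A
      using that by (subst integral_mult_right_zero, subst Bochner_Integration.integral_indicator) simp
    have sets: "UNIV - K' \<in> sets borel" "V - ?U \<in> sets borel" using Eb V Ub by auto
    have intS: "integrable (H1_on K) (\<lambda>y. \<Sum>p\<in>C. h (fst p) * indicator (?B p) y)"
      by (intro Bochner_Integration.integrable_sum intI) auto
    have intW1: "integrable (H1_on K) (\<lambda>y. \<epsilon>0 + B * indicator (UNIV - K') y)"
      using sets by (intro Bochner_Integration.integrable_add intI) auto
    have intW: "integrable (H1_on K) W" unfolding W_def
      using sets by (intro Bochner_Integration.integrable_add intW1 intI)
    have "(\<integral>y. h y * indicator V y \<partial>H1_on K) - (\<Sum>p\<in>C. h (fst p) * ?m (?B p)) = (\<integral>y. D y \<partial>H1_on K)"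
      unfolding D_def Bochner_Integration.integral_diff[OF intV intS]
      by (subst Bochner_Integration.integral_sum, rule intI, simp) (simp only: vI[OF borel_closed[OF closed_cball]])
    also have "\<bar>\<dots>\<bar> \<le> (\<integral>y. \<bar>D y\<bar> \<partial>H1_on K)"
      using integral_norm_bound[of "H1_on K" D] by simp
    also have "\<dots> \<le> (\<integral>y. W y \<partial>H1_on K)"
      using intV intS intW DW by (intro integral_mono) (auto simp: D_def)
    also have "\<dots> = \<epsilon>0 * ?m UNIV + B * ?m (UNIV - K') + B * ?m (V - ?U)"
      unfolding W_def Bochner_Integration.integral_add[OF intW1 intI[OF sets(2)]] vI[OF sets(2)]
      by (subst Bochner_Integration.integral_add) (use intI[OF sets(1)] vI[OF sets(1)] in \<open>simp_all add: mult.commute\<close>)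
    also have "\<dots> \<le> \<epsilon>0 * ?m UNIV + B * \<epsilon>0 + B * (2 * \<epsilon>0)"
      using rest K'(3) B \<epsilon>0(1) by (intro add_mono mult_left_mono) auto
    also have "\<dots> \<le> \<epsilon>" using \<epsilon>0 by (simp add: algebra_simps)
    finally show "\<bar>(\<integral>y. h y * indicator V y \<partial>H1_on K) - (\<Sum>p\<in>C. h (fst p) * ?m (?B p))\<bar> \<le> \<epsilon>" .
  qed
qed

text \<open>The constant \<open>norm w + 1\<close> is positive also for
  \<open>w = 0\<close>.\<close>

lemma hausdorff1_outer_inner_image_le:
  fixes w :: "'a::real_inner"
  shows "hausdorff1_outer ((\<lambda>y. y \<bullet> w) ` A) \<le> ennreal (norm w + 1) * hausdorff1_outer A"
proof (rule hausdorff1_outer_lipschitz_image)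
  fix x y :: 'a
  have "\<bar>(x - y) \<bullet> w\<bar> \<le> norm (x - y) * norm w" by (rule Cauchy_Schwarz_ineq2)
  also have "\<dots> \<le> norm (x - y) * (norm w + 1)" by (intro mult_left_mono) auto
  finally show "dist (x \<bullet> w) (y \<bullet> w) \<le> (norm w + 1) * dist x y"
    by (simp add: dist_norm inner_diff_left mult.commute)
qed (use norm_ge_zero[of w] in linarith)

lemma hausdorff1_outer_subset_interval:
  fixes S :: "real set"
  assumes "\<And>s. s \<in> S \<Longrightarrow> \<bar>s - a\<bar> \<le> r" "0 \<le> r"
  shows "hausdorff1_outer S \<le> ennreal (2 * r)"
proof -
  have "S \<subseteq> {a - r..a + r}" using assms(1) by (auto simp: abs_le_iff) (smt (verit))+
  then have "hausdorff1_outer S \<le> ennreal ((a + r) - (a - r))"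
    using assms(2) by (intro order_trans[OF hausdorff1_outer_mono hausdorff1_outer_Icc_le]) auto
  then show ?thesis by simp
qed

text \<open>The strip confines the projection to an interval of half length
  \<open>r * (h + e * norm w)\<close>, where \<open>h\<close> is
  \<open>\<bar>rot \<nu> \<bullet> w\<bar>\<close>, while the ball has mass nearly
  \<open>2 * r\<close>.\<close>

lemma local_projection_le:
  assumes K: "K \<in> sets borel" "hausdorff1_outer K < \<infinity>" and nx: "approx_normal K x \<nu>"
    and ld: "lower_density_near K x" and \<epsilon>: "0 < \<epsilon>"
  shows "\<forall>\<^sub>F r in at_right 0. hausdorff1_outer ((\<lambda>y. y \<bullet> w) ` (K \<inter> cball x r))
    \<le> ennreal ((\<bar>rot \<nu> \<bullet> w\<bar> + \<epsilon>) * measure (H1_on K) (cball x r))"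
proof -
  have \<nu>: "norm \<nu> = 1" using nx by (simp add: approx_normal_def)
  define h where "h = \<bar>rot \<nu> \<bullet> w\<bar>"
  \<comment> \<open>Solves \<open>h + e * norm w = (h + \<epsilon>) * (1 - e)\<close>, which
    balances the width of the strip against the defect of the density.\<close>
  define e where "e = \<epsilon> / (h + \<epsilon> + norm w)"
  have h0: "0 \<le> h" by (simp add: h_def)
  have den: "0 < h + \<epsilon> + norm w" using h0 \<epsilon> norm_ge_zero[of w] by linarith
  have e: "0 < e" "e * (h + \<epsilon> + norm w) = \<epsilon>" using \<epsilon> den by (simp_all add: e_def)
  from approx_normal_strip[OF K nx ld e(1)] approx_normal_lower_density[OF K nx e(1)] eventually_at_right_less[of 0]
  show ?thesis
  proof eventually_elim
    case (elim r)
    have "hausdorff1_outer ((\<lambda>y. y \<bullet> w) ` (K \<inter> cball x r)) \<le> ennreal (2 * (r * (h + e * norm w)))"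
    proof (rule hausdorff1_outer_subset_interval[of _ "x \<bullet> w"])
      fix s assume "s \<in> (\<lambda>y. y \<bullet> w) ` (K \<inter> cball x r)"
      then obtain y where y: "y \<in> K \<inter> cball x r" "s = y \<bullet> w" by auto
      have n: "norm (y - x) \<le> r" using y(1) by (simp add: dist_norm norm_minus_commute)
      have a: "\<bar>(y - x) \<bullet> \<nu>\<bar> \<le> e * r" using elim(1) y(1) by blast
      have b: "\<bar>(y - x) \<bullet> rot \<nu>\<bar> \<le> r" using Cauchy_Schwarz_ineq2[of "y - x" "rot \<nu>"] n \<nu> by simp
      have c: "\<bar>w \<bullet> \<nu>\<bar> \<le> norm w" using Cauchy_Schwarz_ineq2[of w \<nu>] \<nu> by simp
      have "s - x \<bullet> w = ((y - x) \<bullet> \<nu>) * (w \<bullet> \<nu>) + ((y - x) \<bullet> rot \<nu>) * (w \<bullet> rot \<nu>)"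
        unfolding y(2) inner_diff_left[symmetric] by (rule inner_orthonormal[OF \<nu>])
      also have "\<bar>\<dots>\<bar> \<le> \<bar>(y - x) \<bullet> \<nu>\<bar> * \<bar>w \<bullet> \<nu>\<bar> + \<bar>(y - x) \<bullet> rot \<nu>\<bar> * \<bar>w \<bullet> rot \<nu>\<bar>"
        by (rule order_trans[OF abs_triangle_ineq]) (simp add: abs_mult)
      also have "\<dots> \<le> (e * r) * norm w + r * h"
        using a b c e elim(3) by (intro add_mono mult_mono) (auto simp: h_def inner_commute)
      finally show "\<bar>s - x \<bullet> w\<bar> \<le> r * (h + e * norm w)" by (simp add: algebra_simps)
    next
      show "0 \<le> r * (h + e * norm w)" using elim(3) h0 e by (intro mult_nonneg_nonneg add_nonneg_nonneg) auto
    qed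
    also have "\<dots> \<le> ennreal ((h + \<epsilon>) * measure (H1_on K) (cball x r))"
    proof (rule ennreal_leI)
      have "h + e * norm w = (h + \<epsilon>) * (1 - e)" using e(2) by (simp add: algebra_simps)
      then have "2 * (r * (h + e * norm w)) = (h + \<epsilon>) * ((1 - e) * (2 * r))" by simp
      also have "\<dots> \<le> (h + \<epsilon>) * measure (H1_on K) (cball x r)"
        using elim(2) h0 \<epsilon> by (intro mult_left_mono) auto
      finally show "2 * (r * (h + e * norm w)) \<le> (h + \<epsilon>) * measure (H1_on K) (cball x r)" .
    qed
    finally show ?case by (simp add: h_def)
  qed
qed

text \<open>An area-formula inequality with \<open>h\<close> as Borel version of the Jacobian. The
  local estimates are summed over a Vitali family, and the uncovered part is short, so its
  projection is short as well.\<close>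

theorem projection_le_integral:
  assumes K: "compact K" "finite (components K)" "hausdorff1_outer K < \<infinity>"
    and V: "open V" and h: "h \<in> borel_measurable borel" "\<And>x. 0 \<le> h x" "\<And>x. h x \<le> B"
    and hAE: "AE x in H1_on K. h x = \<bar>rot (normal_at K x) \<bullet> w\<bar>"
  shows "hausdorff1_outer ((\<lambda>y. y \<bullet> w) ` (K \<inter> V)) \<le> ennreal (\<integral>y. h y * indicator V y \<partial>H1_on K)"
proof (rule ennreal_le_epsilon)
  fix e :: real assume e: "0 < e"
  have Kb: "K \<in> sets borel" using K(1) by (rule borel_compact)
  interpret M: finite_measure "H1_on K" by (rule finite_measure_H1_on[OF Kb K(3)])
  let ?m = "measure (H1_on K)"
  let ?\<pi> = "\<lambda>y. y \<bullet> w"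
  \<comment> \<open>Collects \<open>\<epsilon>\<close> per unit of mass, \<open>\<epsilon>\<close>
    from the Riemann sum and \<open>(norm w + 1) * \<epsilon>\<close> from projecting the uncovered
    part.\<close>
  define d where "d = ?m UNIV + norm w + 2"
  have d: "0 < d" unfolding d_def using measure_nonneg[of "H1_on K" UNIV] norm_ge_zero[of w] by linarith
  define \<epsilon> where "\<epsilon> = e / d"
  have \<epsilon>: "0 < \<epsilon>" "\<epsilon> * d = e" using e d by (simp_all add: \<epsilon>_def)
  define F where "F = {(x, r). 0 < r \<and> ennreal r \<le> hausdorff1_outer (K \<inter> cball x r) \<and>
    hausdorff1_outer (?\<pi> ` (K \<inter> cball x r)) \<le> ennreal ((h x + \<epsilon>) * ?m (cball x r))}"
  have inK: "AE x in H1_on K. x \<in> K" using Kb by (simp add: AE_measure_restr)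
  from AE_approx_normal[OF K] AE_lower_density_near[OF K(1,2)] hAE inK
  have fine: "AE x in H1_on K. \<forall>\<eta>>0. \<exists>r<\<eta>. (x, r) \<in> F"
  proof eventually_elim
    case (elim x)
    show ?case
    proof (intro allI impI)
      fix \<eta> :: real assume \<eta>: "0 < \<eta>"
      obtain \<eta>0 where \<eta>0: "0 < \<eta>0" "\<And>r. 0 < r \<Longrightarrow> r < \<eta>0 \<Longrightarrow> ennreal r \<le> hausdorff1_outer (K \<inter> cball x r)"
        using elim(2,4) unfolding lower_density_near_def by (metis IntI centre_in_ball)
      have "\<forall>\<^sub>F r in at_right 0. r \<in> {0<..<min \<eta> \<eta>0}"
        using \<eta> \<eta>0(1) by (intro eventually_at_right_real) simp
      with local_projection_le[OF Kb K(3) elim(1,2) \<epsilon>(1), of w]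
      have "\<forall>\<^sub>F r in at_right 0. r < \<eta> \<and> (x, r) \<in> F"
      proof eventually_elim
        case (elim r)
        then show ?case using \<eta>0(2)[of r] hAE by (auto simp: F_def \<open>h x = _\<close>)
      qed
      then show "\<exists>r<\<eta>. (x, r) \<in> F" using eventually_happens'[OF trivial_limit_at_right_real] by blast
    qed
  qed
  obtain C where C: "finite C" "C \<subseteq> F"
    "pairwise (\<lambda>p q. disjnt (cball (fst p) (snd p)) (cball (fst q) (snd q))) C"
    "\<And>p. p \<in> C \<Longrightarrow> cball (fst p) (snd p) \<subseteq> V"
    "\<bar>(\<integral>y. h y * indicator V y \<partial>H1_on K) - (\<Sum>p\<in>C. h (fst p) * ?m (cball (fst p) (snd p)))\<bar> \<le> \<epsilon>"
    "hausdorff1_outer (K \<inter> V - (\<Union>p\<in>C. cball (fst p) (snd p))) \<le> ennreal \<epsilon>"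
    by (rule vitali_riemann_sum[OF Kb K(3) h V _ fine \<epsilon>(1)]) (auto simp: F_def)
  let ?B = "\<lambda>p. cball (fst p) (snd p)"
  let ?U = "\<Union>p\<in>C. ?B p"
  have "?\<pi> ` (K \<inter> V) \<subseteq> (\<Union>p\<in>C. ?\<pi> ` (K \<inter> ?B p)) \<union> ?\<pi> ` (K \<inter> V - ?U)" by blast
  then have "hausdorff1_outer (?\<pi> ` (K \<inter> V)) \<le> hausdorff1_outer (\<Union>p\<in>C. ?\<pi> ` (K \<inter> ?B p)) + hausdorff1_outer (?\<pi> ` (K \<inter> V - ?U))"
    by (rule order_trans[OF hausdorff1_outer_mono hausdorff1_outer_Un])
  also have "\<dots> \<le> (\<Sum>p\<in>C. hausdorff1_outer (?\<pi> ` (K \<inter> ?B p))) + ennreal (norm w + 1) * ennreal \<epsilon>"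
    by (intro add_mono hausdorff1_outer_finite_UN C(1)
        order_trans[OF hausdorff1_outer_inner_image_le mult_left_mono[OF C(6)]]) auto
  also have "\<dots> \<le> (\<Sum>p\<in>C. ennreal ((h (fst p) + \<epsilon>) * ?m (?B p))) + ennreal (norm w + 1) * ennreal \<epsilon>"
    using C(2) by (intro add_mono sum_mono) (auto simp: F_def)
  also have "(\<Sum>p\<in>C. ennreal ((h (fst p) + \<epsilon>) * ?m (?B p))) = ennreal (\<Sum>p\<in>C. (h (fst p) + \<epsilon>) * ?m (?B p))"
    using h(2) \<epsilon>(1) by (intro sum_ennreal) (auto intro!: mult_nonneg_nonneg add_nonneg_nonneg)
  also have "\<dots> + ennreal (norm w + 1) * ennreal \<epsilon> = ennreal ((\<Sum>p\<in>C. (h (fst p) + \<epsilon>) * ?m (?B p)) + (norm w + 1) * \<epsilon>)"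
    using h(2) \<epsilon>(1) by (subst ennreal_mult[symmetric], simp, simp, subst ennreal_plus[symmetric])
      (auto intro!: sum_nonneg mult_nonneg_nonneg add_nonneg_nonneg)
  also have "\<dots> \<le> ennreal ((\<integral>y. h y * indicator V y \<partial>H1_on K) + e)"
  proof (rule ennreal_leI)
    have "(\<Sum>p\<in>C. ?m (?B p)) = ?m ?U"
      using C(1,3) by (intro M.finite_measure_finite_Union[symmetric])
        (auto simp: disjoint_family_on_def pairwise_def disjnt_def)
    also have "\<dots> \<le> ?m UNIV" by (rule M.finite_measure_mono) auto
    finally have "\<epsilon> * (\<Sum>p\<in>C. ?m (?B p)) \<le> \<epsilon> * ?m UNIV" using \<epsilon>(1) by (intro mult_left_mono) auto
    moreover have "(\<Sum>p\<in>C. (h (fst p) + \<epsilon>) * ?m (?B p)) = (\<Sum>p\<in>C. h (fst p) * ?m (?B p)) + \<epsilon> * (\<Sum>p\<in>C. ?m (?B p))"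
      by (simp add: distrib_right sum.distrib sum_distrib_left)
    moreover have "\<epsilon> * ?m UNIV + \<epsilon> * norm w + 2 * \<epsilon> = e" using \<epsilon>(2) by (simp add: d_def algebra_simps)
    ultimately show "(\<Sum>p\<in>C. (h (fst p) + \<epsilon>) * ?m (?B p)) + (norm w + 1) * \<epsilon> \<le> (\<integral>y. h y * indicator V y \<partial>H1_on K) + e"
      using C(5) by (simp add: algebra_simps abs_le_iff)
  qed
  also have "\<dots> = ennreal (\<integral>y. h y * indicator V y \<partial>H1_on K) + ennreal e"
    using e h(2) by (intro ennreal_plus integral_nonneg_AE) auto
  finally show "hausdorff1_outer (?\<pi> ` (K \<inter> V)) \<le> ennreal (\<integral>y. h y * indicator V y \<partial>H1_on K) + ennreal e" .
qed

subsection \<open>Projections of sets close to a line\<close>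

text \<open>A greedy choice: a point just above the infimum is taken and everything up to
  \<open>g\<close> beyond it is discarded. This costs measure at most \<open>\<eta> + g\<close>, and
  the slack \<open>\<eta>\<close> comes from the strict inequality.\<close>

lemma separated_chain:
  fixes S :: "real set"
  assumes "S \<in> sets borel" "bdd_below S" "ennreal (real k * g) < emeasure lborel S" "0 \<le> g"
  shows "\<exists>s. (\<forall>i\<le>k. s i \<in> S) \<and> (\<forall>i<k. s i + g < s (Suc i))"
  using assms(1-3)
proof (induction k arbitrary: S)
  case 0
  then have "S \<noteq> {}" by auto
  then show ?case by auto
next
  case (Suc k)
  \<comment> \<open>An intermediate finite value, since \<open>S\<close> may have infinite
    measure.\<close>
  obtain \<mu> where \<mu>: "ennreal (real (Suc k) * g) < \<mu>" "\<mu> < emeasure lborel S" using Suc.prems(3) dense by blast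
  have "\<mu> \<noteq> top" using \<mu>(2) by (auto simp: top_unique)
  then obtain c where c: "\<mu> = ennreal c" "0 \<le> c" by (cases \<mu>) auto
  define \<eta> where "\<eta> = c - real (Suc k) * g"
  have \<eta>: "0 < \<eta>" using \<mu>(1) c assms(4) by (simp add: \<eta>_def ennreal_less_iff)
  have "S \<noteq> {}" using Suc.prems(3) by auto
  then have "Inf S < Inf S + \<eta> \<longrightarrow> (\<exists>s\<in>S. s < Inf S + \<eta>)" using cInf_less_iff[OF _ Suc.prems(2)] by blast
  then obtain s0 where s0: "s0 \<in> S" "s0 < Inf S + \<eta>" using \<eta> by auto
  define S' where "S' = S \<inter> {s0 + g<..}"
  have S': "S' \<in> sets borel" "bdd_below S'" using Suc.prems(1,2) by (auto simp: S'_def intro: bdd_below_mono)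
  have "S \<subseteq> {Inf S..s0 + g} \<union> S'" using Suc.prems(2) by (auto simp: S'_def intro: cInf_lower)
  then have "emeasure lborel S \<le> emeasure lborel {Inf S..s0 + g} + emeasure lborel S'"
    using S'(1) by (intro order_trans[OF emeasure_mono emeasure_subadditive]) auto
  also have "emeasure lborel {Inf S..s0 + g} \<le> ennreal (\<eta> + g)"
    using s0 assms(4) by (auto simp: emeasure_lborel_Icc_eq intro: ennreal_leI)
  finally have le: "emeasure lborel S \<le> ennreal (\<eta> + g) + emeasure lborel S'" by (simp add: add_right_mono)
  have "ennreal (real k * g) < emeasure lborel S'"
  proof (rule ccontr)
    assume "\<not> ?thesis"
    then have "emeasure lborel S' \<le> ennreal (real k * g)" by (simp add: not_less)
    with le have "emeasure lborel S \<le> ennreal (\<eta> + g) + ennreal (real k * g)"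
      by (meson add_left_mono order_trans)
    also have "\<dots> = ennreal (\<eta> + g + real k * g)" using \<eta> assms(4) by (intro ennreal_plus[symmetric]) auto
    also have "\<eta> + g + real k * g = c" by (simp add: \<eta>_def algebra_simps)
    finally show False using \<mu>(2) c by simp
  qed
  from Suc.IH[OF S' this] obtain s where s: "\<forall>i\<le>k. s i \<in> S'" "\<forall>i<k. s i + g < s (Suc i)" by blast
  define s' where "s' i = (case i of 0 \<Rightarrow> s0 | Suc j \<Rightarrow> s j)" for i
  have "\<forall>i\<le>Suc k. s' i \<in> S" using s(1) s0(1) by (auto simp: s'_def S'_def split: nat.split)
  moreover have "\<forall>i<Suc k. s' i + g < s' (Suc i)" using s by (auto simp: s'_def S'_def split: nat.split)
  ultimately show ?case by blast
qed

text \<open>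
  If two values at distance more than \<open>g\<close> are missed by the projection of \<open>K\<close>, the part of \<open>K\<close>
  projected between them is nonempty and relatively clopen, so it contains a whole component; as
  there are at most \<open>m\<close> components, the missed set has measure at most \<open>(m + 1) * g\<close>.
\<close>

theorem projection_ge_near_line:
  fixes K :: "(real^2) set"
  assumes K: "compact K" "finite (components K)" "card (components K) \<le> m"
    and \<nu>: "norm \<nu> = 1" and \<alpha>: "\<alpha> = rot \<nu> \<bullet> w" "0 < \<alpha>" and r: "0 < r" and e: "0 < e"
    and strip: "\<And>y. y \<in> K \<Longrightarrow> y \<in> cball x r \<Longrightarrow> \<bar>(y - x) \<bullet> \<nu>\<bar> \<le> e * r"
    and near: "\<And>t. t \<in> {-1..1} \<Longrightarrow> \<exists>y\<in>K. dist y (x + (r * t) *\<^sub>R rot \<nu>) \<le> e * r"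
    and \<kappa>: "\<kappa> = e * (2 * norm w / \<alpha> + 1)" "\<kappa> \<le> 1"
  shows "ennreal (2 * \<alpha> * r * (1 - \<kappa>) - real (m + 1) * (2 * norm w * e * r))
    \<le> hausdorff1_outer ((\<lambda>y. y \<bullet> w) ` (K \<inter> ball x r))"
proof -
  let ?\<pi> = "\<lambda>y. y \<bullet> w"
  have w: "0 < norm w" using \<alpha> by auto
  \<comment> \<open>Projection moves a point within \<open>e * r\<close> of the line by at most
    \<open>g / 2\<close> from its companion. A point near the middle of a gap longer than
    \<open>g\<close> therefore projects strictly inside the gap.\<close>
  define g where "g = 2 * norm w * e * r"
  have g: "0 < g" using w e r by (simp add: g_def)
  \<comment> \<open>Bounds the distance from \<open>x\<close> of a strip point over
    \<open>J\<close>: the tangential part is at most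
    \<open>r * (1 - \<kappa>) + e * r * norm w / \<alpha>\<close>, the normal part at most
    \<open>e * r\<close>. The value of \<open>\<kappa>\<close> is such that
    \<open>r - r' = e * r * norm w / \<alpha>\<close> is positive, so the boundary of the large ball
    is never met.\<close>
  define r' where "r' = r * (1 - \<kappa>) + e * r * (norm w / \<alpha> + 1)"
  have r': "r' < r"
  proof -
    have "r - r' = e * r * norm w / \<alpha>" using \<alpha>(2) by (simp add: r'_def \<kappa>(1) field_simps)
    also have "\<dots> > 0" using e r w \<alpha>(2) by simp
    finally show ?thesis by simp
  qed
  define J where "J = {?\<pi> x - \<alpha> * r * (1 - \<kappa>)..?\<pi> x + \<alpha> * r * (1 - \<kappa>)}"
  define P where "P = ?\<pi> ` (K \<inter> cball x r')"
  have P: "compact P" unfolding P_def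
    by (intro compact_continuous_image continuous_intros compact_Int_closed K(1)) auto
  have w\<nu>: "\<bar>w \<bullet> \<nu>\<bar> \<le> norm w" using Cauchy_Schwarz_ineq2[of w \<nu>] \<nu> by simp
  have split: "?\<pi> y - ?\<pi> x = ((y - x) \<bullet> \<nu>) * (w \<bullet> \<nu>) + ((y - x) \<bullet> rot \<nu>) * \<alpha>" for y
    unfolding inner_diff_left[symmetric] \<alpha>(1) inner_commute[of "rot \<nu>" w] by (rule inner_orthonormal[OF \<nu>])
  have inside: "y \<in> cball x r'" if y: "y \<in> K" "y \<in> cball x r" "?\<pi> y \<in> J" for y
  proof -
    have b: "\<bar>(y - x) \<bullet> \<nu>\<bar> \<le> e * r" by (rule strip[OF y(1,2)])
    have "\<bar>((y - x) \<bullet> rot \<nu>) * \<alpha>\<bar> \<le> \<bar>?\<pi> y - ?\<pi> x\<bar> + \<bar>((y - x) \<bullet> \<nu>) * (w \<bullet> \<nu>)\<bar>"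
      unfolding split[of y] by linarith
    also have "\<dots> \<le> \<alpha> * r * (1 - \<kappa>) + (e * r) * norm w"
      using y(3) b w\<nu> e r unfolding abs_mult by (intro add_mono mult_mono) (auto simp: J_def abs_le_iff)
    finally have "\<bar>(y - x) \<bullet> rot \<nu>\<bar> \<le> (\<alpha> * r * (1 - \<kappa>) + (e * r) * norm w) / \<alpha>"
      using \<alpha>(2) by (simp add: abs_mult field_simps)
    also have "\<dots> = r * (1 - \<kappa>) + e * r * (norm w / \<alpha>)" using \<alpha>(2) by (simp add: field_simps)
    finally have "norm (y - x) \<le> r'"
      using norm_le_orthonormal[OF \<nu>, of "y - x"] b by (simp add: r'_def algebra_simps)
    then show ?thesis by (simp add: dist_norm norm_minus_commute)
  qed
  have comp: "\<exists>C\<in>components K. \<forall>y\<in>C. s1 < ?\<pi> y \<and> ?\<pi> y < s2"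
    if s: "s1 \<in> J - P" "s2 \<in> J - P" "s1 + g < s2" for s1 s2
  proof -
    define \<sigma> where "\<sigma> = (s1 + s2) / 2 - ?\<pi> x"
    define t where "t = \<sigma> / (\<alpha> * r)"
    have mid: "\<bar>(a + b) / 2 - c\<bar> \<le> A" if "\<bar>a - c\<bar> \<le> A" "\<bar>b - c\<bar> \<le> A" for a b c A :: real
      using that unfolding abs_le_iff by (auto simp: field_simps)
    have "\<bar>s1 - ?\<pi> x\<bar> \<le> \<alpha> * r * (1 - \<kappa>)" "\<bar>s2 - ?\<pi> x\<bar> \<le> \<alpha> * r * (1 - \<kappa>)"
      using s(1,2) by (auto simp: J_def abs_le_iff)
    then have \<sigma>: "\<bar>\<sigma>\<bar> \<le> \<alpha> * r * (1 - \<kappa>)" unfolding \<sigma>_def by (rule mid)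
    have t: "\<bar>t\<bar> \<le> 1 - \<kappa>" "r * t * \<alpha> = \<sigma>" using \<sigma> \<alpha>(2) r by (auto simp: t_def abs_mult field_simps)
    have "0 \<le> \<kappa>" using e \<alpha>(2) by (simp add: \<kappa>(1))
    then have "t \<in> {-1..1}" using t(1) by (auto simp: abs_le_iff)
    then obtain y where y: "y \<in> K" "dist y (x + (r * t) *\<^sub>R rot \<nu>) \<le> e * r" using near by blast
    have eq: "?\<pi> (x + (r * t) *\<^sub>R rot \<nu>) = (s1 + s2) / 2"
      using t(2) by (simp add: inner_add_left \<alpha>(1) \<sigma>_def)
    have "\<bar>?\<pi> y - (s1 + s2) / 2\<bar> \<le> norm (y - (x + (r * t) *\<^sub>R rot \<nu>)) * norm w"
      using Cauchy_Schwarz_ineq2[of "y - (x + (r * t) *\<^sub>R rot \<nu>)" w] by (simp only: inner_diff_left eq)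
    also have "\<dots> \<le> (e * r) * norm w" using y(2) w by (intro mult_right_mono) (auto simp: dist_norm)
    finally have "\<bar>?\<pi> y - (s1 + s2) / 2\<bar> \<le> g / 2" by (simp add: g_def algebra_simps)
    then have ys: "s1 < ?\<pi> y" "?\<pi> y < s2" using s(3) by (auto simp: abs_le_iff field_simps)
    have "dist x (x + (r * t) *\<^sub>R rot \<nu>) = r * \<bar>t\<bar>" using r \<nu> by (simp add: dist_norm abs_mult)
    also have "\<dots> \<le> r * (1 - \<kappa>)" using t(1) r by (intro mult_left_mono) auto
    finally have "dist x y \<le> r * (1 - \<kappa>) + e * r"
      using y(2) dist_triangle[of x y "x + (r * t) *\<^sub>R rot \<nu>"] by (simp add: dist_commute)
    also have "\<dots> \<le> r'" using e r w \<alpha>(2) by (simp add: r'_def algebra_simps)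
    finally have yr: "dist x y < r" using r' by simp
    define C where "C = connected_component_set K y"
    have C: "C \<in> components K" "y \<in> C" "connected C" "C \<subseteq> K"
      using y(1) connected_component_subset[of K y] by (auto simp: C_def components_def connected_component_refl)
    \<comment> \<open>On \<open>C\<close> the set \<open>U\<close> is the complement of
      \<open>V\<close>: points over the open gap lie in the smaller ball, and points of the smaller
      ball never project to an end of the gap. So \<open>U\<close> and \<open>V\<close> would split
      \<open>C\<close>, and the whole component stays in \<open>U\<close>.\<close>
    define U where "U = ball x r \<inter> {z. s1 < ?\<pi> z} \<inter> {z. ?\<pi> z < s2}"
    define V where "V = - (cball x r' \<inter> {z. s1 \<le> ?\<pi> z} \<inter> {z. ?\<pi> z \<le> s2})"
    have "open U" unfolding U_def
      by (intro open_Int open_ball open_Collect_less continuous_intros)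
    moreover have "open V" unfolding V_def
      by (intro open_Compl closed_Int closed_cball closed_Collect_le continuous_intros)
    moreover have "U \<inter> V \<inter> C = {}"
    proof -
      have "z \<notin> V" if z: "z \<in> U" "z \<in> C" for z
      proof -
        have "?\<pi> z \<in> J" using z(1) s(1,2) by (auto simp: U_def J_def)
        then have "z \<in> cball x r'" using inside[of z] z C(4) by (auto simp: U_def)
        then show ?thesis using z(1) by (auto simp: U_def V_def)
      qed
      then show ?thesis by blast
    qed
    moreover have "C \<subseteq> U \<union> V"
    proof
      fix z assume z: "z \<in> C"
      show "z \<in> U \<union> V"
      proof (cases "z \<in> V")
        case False
        then have zr: "z \<in> cball x r'" "s1 \<le> ?\<pi> z" "?\<pi> z \<le> s2" by (auto simp: V_def)
        then have "?\<pi> z \<in> P" using z C(4) by (auto simp: P_def)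
        then have "?\<pi> z \<noteq> s1" "?\<pi> z \<noteq> s2" using s(1,2) by auto
        then show ?thesis using zr r' by (auto simp: U_def)
      qed simp
    qed
    ultimately have "U \<inter> C = {} \<or> V \<inter> C = {}" using connectedD[OF C(3)] by blast
    moreover have "y \<in> U" using ys yr by (simp add: U_def)
    ultimately have "C \<subseteq> U" using C(2) \<open>C \<subseteq> U \<union> V\<close> by blast
    then show ?thesis using C(1) by (intro bexI[of _ C]) (auto simp: U_def)
  qed
  have miss: "emeasure lborel (J - P) \<le> ennreal (real (m + 1) * g)"
  proof (rule ccontr)
    assume "\<not> ?thesis"
    then have "ennreal (real (m + 1) * g) < emeasure lborel (J - P)" by (simp add: not_le)
    moreover have "J - P \<in> sets borel" using P by (auto simp: J_def intro: borel_compact)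
    moreover have "bdd_below (J - P)" by (rule bdd_below_mono[of J]) (auto simp: J_def)
    ultimately obtain s where s: "\<forall>i\<le>m + 1. s i \<in> J - P" "\<forall>i<m + 1. s i + g < s (Suc i)"
      using separated_chain[of "J - P" "m + 1" g] g by auto
    have "\<exists>C\<in>components K. \<forall>y\<in>C. s i < ?\<pi> y \<and> ?\<pi> y < s (Suc i)" if "i < m + 1" for i
      using comp[of "s i" "s (Suc i)"] s that by auto
    then obtain C where C: "\<And>i. i < m + 1 \<Longrightarrow> C i \<in> components K"
      "\<And>i y. i < m + 1 \<Longrightarrow> y \<in> C i \<Longrightarrow> s i < ?\<pi> y \<and> ?\<pi> y < s (Suc i)" by metis
    have mono: "s i \<le> s j" if "i \<le> j" "j \<le> m + 1" for i j
      using that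
    proof (induction j rule: dec_induct)
      case (step n)
      then show ?case using s(2)[rule_format, of n] g by simp
    qed simp
    have "inj_on C {..<m + 1}"
    proof (rule linorder_inj_onI')
      fix i j assume ij: "i \<in> {..<m + 1}" "j \<in> {..<m + 1}" "i < j"
      show "C i \<noteq> C j"
      proof
        assume eq: "C i = C j"
        obtain y where "y \<in> C i" using in_components_nonempty[OF C(1)] ij(1) by fastforce
        then have "?\<pi> y < s (Suc i)" "s j < ?\<pi> y" using C(2)[of i y] C(2)[of j y] eq ij by auto
        moreover have "s (Suc i) \<le> s j" using mono[of "Suc i" j] ij by auto
        ultimately show False by simp
      qed
    qed
    then have "card (C ` {..<m + 1}) = m + 1" by (simp add: card_image)
    moreover have "card (C ` {..<m + 1}) \<le> card (components K)"
      using C(1) by (intro card_mono K(2)) auto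
    ultimately show False using K(3) by simp
  qed
  have "emeasure lborel J \<le> emeasure lborel (J - P) + emeasure lborel P"
    using P by (intro order_trans[OF emeasure_mono emeasure_subadditive]) (auto simp: J_def intro: borel_compact)
  also have "\<dots> \<le> ennreal (real (m + 1) * g) + emeasure lborel P" by (intro add_right_mono miss)
  finally have "emeasure lborel J \<le> ennreal (real (m + 1) * g) + emeasure lborel P" .
  moreover have "emeasure lborel J = ennreal (2 * \<alpha> * r * (1 - \<kappa>))"
    using \<alpha>(2) r \<kappa>(2) by (simp add: J_def)
  ultimately have "ennreal (2 * \<alpha> * r * (1 - \<kappa>)) - ennreal (real (m + 1) * g) \<le> emeasure lborel P"
    by (simp add: ennreal_minus_le_iff)
  then have "ennreal (2 * \<alpha> * r * (1 - \<kappa>) - real (m + 1) * g) \<le> emeasure lborel P"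
    using g by (subst ennreal_minus[symmetric]) auto
  also have "\<dots> = hausdorff1_outer P" using P by (intro hausdorff1_outer_real[symmetric] borel_compact)
  also have "\<dots> \<le> hausdorff1_outer (?\<pi> ` (K \<inter> ball x r))"
    unfolding P_def using r' by (intro hausdorff1_outer_mono image_mono) auto
  finally show ?thesis by (simp add: g_def)
qed

text \<open>A supporting line of \<open>f\<close> along \<open>\<nu> + s *\<^sub>R rot \<nu>\<close>
  extends by homogeneity to the half plane \<open>0 < w \<bullet> \<nu>\<close> and by subadditivity
  to the plane; evenness yields the absolute value.\<close>

lemma even_sublinear_support:
  fixes f :: "real^2 \<Rightarrow> real"
  assumes conv: "convex_on UNIV f" and hom: "\<And>t y. 0 < t \<Longrightarrow> f (t *\<^sub>R y) = t * f y"
    and even: "\<And>y. f (- y) = f y" and \<nu>: "norm \<nu> = 1"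
  obtains p where "p \<bullet> \<nu> = f \<nu>" "\<And>w. \<bar>p \<bullet> w\<bar> \<le> f w"
proof -
  have sub: "f (x + y) \<le> f x + f y" for x y
  proof -
    have "f ((1 - 1/2) *\<^sub>R (2 *\<^sub>R x) + (1/2) *\<^sub>R (2 *\<^sub>R y)) \<le> (1 - 1/2) * f (2 *\<^sub>R x) + (1/2) * f (2 *\<^sub>R y)"
      by (rule convex_onD[OF conv]) auto
    then show ?thesis by (simp add: hom)
  qed
  define u where "u s = f (\<nu> + s *\<^sub>R rot \<nu>)" for s
  have "convex_on UNIV u"
  proof (rule convex_onI)
    fix t a b :: real assume t: "0 < t" "t < 1"
    have "\<nu> + ((1 - t) *\<^sub>R a + t *\<^sub>R b) *\<^sub>R rot \<nu> = (1 - t) *\<^sub>R (\<nu> + a *\<^sub>R rot \<nu>) + t *\<^sub>R (\<nu> + b *\<^sub>R rot \<nu>)"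
      by (simp add: algebra_simps)
    then show "u ((1 - t) *\<^sub>R a + t *\<^sub>R b) \<le> (1 - t) * u a + t * u b"
      unfolding u_def using convex_onD[OF conv, of t "\<nu> + a *\<^sub>R rot \<nu>" "\<nu> + b *\<^sub>R rot \<nu>"] t by simp
  qed simp
  \<comment> \<open>The right derivative of \<open>u\<close> at 0.\<close>
  define q where "q = Inf ((\<lambda>t. (u 0 - u t) / (0 - t)) ` ({0<..} \<inter> UNIV))"
  have "u 0 + q * (s - 0) \<le> u s" for s
    unfolding q_def by (rule convex_le_Inf_differential[OF \<open>convex_on UNIV u\<close>]) auto
  then have q: "u 0 + q * s \<le> u s" for s by simp
  define p where "p = f \<nu> *\<^sub>R \<nu> + q *\<^sub>R rot \<nu>"
  have \<nu>\<nu>: "\<nu> \<bullet> \<nu> = 1" using \<nu> by (simp add: norm_eq_1)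
  have p\<nu>: "p \<bullet> \<nu> = f \<nu>" by (simp add: p_def inner_add_left \<nu>\<nu>)
  have pos: "p \<bullet> w \<le> f w" if a: "0 < w \<bullet> \<nu>" for w
  proof -
    let ?a = "w \<bullet> \<nu>" and ?b = "w \<bullet> rot \<nu>"
    have "w = ?a *\<^sub>R (\<nu> + (?b / ?a) *\<^sub>R rot \<nu>)"
      using orthonormal_decomposition[OF \<nu>, of w] a by (simp add: scaleR_add_right)
    then have "f w = ?a * u (?b / ?a)" using hom[OF a] by (metis u_def)
    moreover have "?a * (f \<nu> + q * (?b / ?a)) \<le> ?a * u (?b / ?a)"
      using q[of "?b / ?a"] a by (intro mult_left_mono) (auto simp: u_def)
    moreover have "p \<bullet> w = ?a * (f \<nu> + q * (?b / ?a))"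
    proof -
      have "p \<bullet> w = f \<nu> * ?a + q * ?b" unfolding p_def inner_add_left by (simp add: inner_commute)
      then show ?thesis using a by (simp add: field_simps)
    qed
    ultimately show ?thesis by simp
  qed
  have all: "p \<bullet> w \<le> f w" for w
  proof -
    \<comment> \<open>Adding \<open>l *\<^sub>R \<nu>\<close> moves \<open>w\<close> into the half
      plane, and the extra term \<open>l * f \<nu>\<close> appears on both sides and
      cancels.\<close>
    define l where "l = \<bar>w \<bullet> \<nu>\<bar> + 1"
    have l: "0 < l" by (simp add: l_def)
    have "0 < (w + l *\<^sub>R \<nu>) \<bullet> \<nu>" by (simp add: inner_add_left \<nu>\<nu> l_def)
    then have "p \<bullet> (w + l *\<^sub>R \<nu>) \<le> f (w + l *\<^sub>R \<nu>)" by (rule pos)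
    also have "\<dots> \<le> f w + l * f \<nu>" using sub[of w "l *\<^sub>R \<nu>"] by (simp add: hom[OF l])
    finally show ?thesis by (simp add: inner_add_right p\<nu>)
  qed
  show ?thesis
  proof (rule that[OF p\<nu>])
    show "\<bar>p \<bullet> w\<bar> \<le> f w" for w using all[of w] all[of "- w"] by (simp add: even)
  qed
qed

subsection \<open>Lower semicontinuity\<close>

text \<open>Avoids a measurable choice of normals. Blow-up integrals of a suitable test function are
  Borel in \<open>x\<close> by Fubini, and at points with a normal \<open>\<nu>\<close> they
  converge to a fixed multiple of \<open>\<psi> x \<nu>\<close>.\<close>

lemma measurable_normal_integrand:
  fixes \<psi> :: "real^2 \<Rightarrow> real^2 \<Rightarrow> real"
  assumes K: "compact K" "finite (components K)" "hausdorff1_outer K < \<infinity>"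
    and S: "closed S" "K \<subseteq> S" and cont: "continuous_on (S \<times> UNIV) (\<lambda>(x, \<nu>). \<psi> x \<nu>)"
    and hom: "\<And>x \<nu> t. x \<in> S \<Longrightarrow> 0 < t \<Longrightarrow> \<psi> x (t *\<^sub>R \<nu>) = t * \<psi> x \<nu>"
    and even: "\<And>x \<nu>. x \<in> S \<Longrightarrow> \<psi> x (- \<nu>) = \<psi> x \<nu>"
    and bound: "\<And>x \<nu>. x \<in> S \<Longrightarrow> 0 \<le> \<psi> x \<nu> \<and> \<psi> x \<nu> \<le> c * norm \<nu>" and c: "0 \<le> c"
  obtains h where "h \<in> borel_measurable borel" "\<And>x. 0 \<le> h x" "\<And>x. h x \<le> c"
    "AE x in H1_on K. h x = \<psi> x (normal_at K x)"
proof -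
  have Kb: "K \<in> sets borel" using K(1) by (rule borel_compact)
  interpret M: finite_measure "H1_on K" by (rule finite_measure_H1_on[OF Kb K(3)])
  have cx: "continuous_on UNIV (\<psi> x)" if "x \<in> S" for x
  proof -
    have "continuous_on UNIV (\<lambda>\<nu>. (x, \<nu>))" by (intro continuous_intros)
    from continuous_on_compose2[OF cont this] show ?thesis using that by auto
  qed
  \<comment> \<open>At the tangent vector \<open>z = t *\<^sub>R rot \<nu>\<close> the argument
    \<open>rot z\<close> is \<open>- t *\<^sub>R \<nu>\<close>, so homogeneity and evenness produce
    \<open>\<bar>t\<bar> * \<psi> x \<nu>\<close>.\<close>
  define f where "f x z = \<psi> x (rot z) * max 0 (1 - norm z)" for x z
  \<comment> \<open>The blow-up at radius \<open>1 / (k + 1)\<close>. The indicator keeps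
    \<open>x\<close> in \<open>S\<close>, where \<open>\<psi>\<close> is continuous, and so makes
    \<open>G k\<close> jointly Borel.\<close>
  define G where "G k x y = indicator S x * f x (real (Suc k) *\<^sub>R (y - x))" for k :: nat and x y :: "real^2"
  define J where "J k x = real (Suc k) * (\<integral>y. G k x y \<partial>H1_on K)" for k x
  have [measurable]: "J k \<in> borel_measurable borel" for k
  proof -
    have "continuous_on (S \<times> UNIV) (\<lambda>p. (fst p, rot (real (Suc k) *\<^sub>R (snd p - fst p))))"
      by (intro continuous_intros)
    from continuous_on_compose2[OF cont this]
    have "continuous_on (S \<times> UNIV) (\<lambda>p. \<psi> (fst p) (rot (real (Suc k) *\<^sub>R (snd p - fst p))))"
      by (simp add: image_subset_iff mem_Times_iff)
    then have "continuous_on (S \<times> UNIV) (\<lambda>p. \<psi> (fst p) (rot (real (Suc k) *\<^sub>R (snd p - fst p))) *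
      max 0 (1 - norm (real (Suc k) *\<^sub>R (snd p - fst p))))"
      by (intro continuous_on_mult continuous_intros)
    then have "(\<lambda>p. indicator (S \<times> UNIV) p *\<^sub>R (\<psi> (fst p) (rot (real (Suc k) *\<^sub>R (snd p - fst p))) *
      max 0 (1 - norm (real (Suc k) *\<^sub>R (snd p - fst p))))) \<in> borel_measurable borel"
      using S(1) by (intro borel_measurable_continuous_on_indicator borel_closed closed_Times closed_UNIV)
    also have "(\<lambda>p. indicator (S \<times> UNIV) p *\<^sub>R (\<psi> (fst p) (rot (real (Suc k) *\<^sub>R (snd p - fst p))) *
      max 0 (1 - norm (real (Suc k) *\<^sub>R (snd p - fst p))))) = case_prod (G k)"
      by (auto simp: fun_eq_iff G_def f_def indicator_def)
    finally have meas: "case_prod (G k) \<in> borel_measurable borel" .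
    have "sets (borel \<Otimes>\<^sub>M H1_on K) = sets (borel \<Otimes>\<^sub>M borel :: ((real^2) \<times> (real^2)) measure)"
      by (intro sets_pair_measure_cong) simp_all
    then have "sets (borel \<Otimes>\<^sub>M H1_on K) = sets (borel :: ((real^2) \<times> (real^2)) measure)"
      by (simp only: borel_prod)
    from measurable_cong_sets[OF this refl] meas
    have "case_prod (G k) \<in> borel_measurable (borel \<Otimes>\<^sub>M H1_on K)" by (rule equalityD2[THEN subsetD])
    then have "(\<lambda>x. \<integral>y. G k x y \<partial>H1_on K) \<in> borel_measurable borel"
      by (rule M.borel_measurable_lebesgue_integral)
    then show ?thesis unfolding J_def by simp
  qed
  define c0 :: real where "c0 = (\<integral>t. \<bar>t\<bar> * max 0 (1 - \<bar>t\<bar>) \<partial>lborel)"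
  have c0: "0 < c0"
  proof -
    let ?e = "axis 1 1 :: real^2"
    have "1 / 8 * (1 / 2 - 1 / 4) \<le> (\<integral>t. (\<lambda>z. norm z * max 0 (1 - norm z)) (t *\<^sub>R ?e) \<partial>lborel)"
    proof (rule line_integral_ge[of _ 1])
      fix t :: real assume "1 / 4 \<le> t" "t \<le> 1 / 2"
      then have "1 / 4 * (1 / 2) \<le> t * max 0 (1 - t)" by (intro mult_mono) auto
      then show "1 / 8 \<le> norm (t *\<^sub>R ?e) * max 0 (1 - norm (t *\<^sub>R ?e))"
        using \<open>1 / 4 \<le> t\<close> by simp
    next
      show "continuous_on UNIV (\<lambda>z :: real^2. norm z * max 0 (1 - norm z))" by (intro continuous_intros)
    qed (auto simp: max_def split: if_splits)
    then have "1 / 32 \<le> c0" by (simp add: c0_def)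
    then show ?thesis by linarith
  qed
  have lim: "(\<lambda>k. J k x) \<longlonglongrightarrow> c0 * \<psi> x \<nu>" if x: "x \<in> S" and nx: "approx_normal K x \<nu>" for x \<nu>
  proof -
    have \<nu>: "norm \<nu> = 1" using nx by (simp add: approx_normal_def)
    have "\<psi> x 0 = 0" using hom[OF x, of 2 0] by simp
    have f: "continuous_on UNIV (f x)" "\<And>z. f x z \<noteq> 0 \<Longrightarrow> norm z \<le> 1"
      unfolding f_def
      by (intro continuous_intros continuous_on_compose2[OF cx[OF x]]) (auto simp: max_def split: if_splits)
    have "f x (t *\<^sub>R rot \<nu>) = \<psi> x \<nu> * (\<bar>t\<bar> * max 0 (1 - \<bar>t\<bar>))" for t
    proof -
      have "\<psi> x (- (t *\<^sub>R \<nu>)) = \<bar>t\<bar> * \<psi> x \<nu>"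
      proof (cases t "0 :: real" rule: linorder_cases)
        case less
        then show ?thesis using hom[OF x, of "- t" \<nu>] by simp
      qed (use hom[OF x, of t \<nu>] even[OF x] \<open>\<psi> x 0 = 0\<close> in auto)
      then show ?thesis by (simp add: f_def \<nu>)
    qed
    then have I: "(\<integral>t. f x (t *\<^sub>R rot \<nu>) \<partial>lborel) = c0 * \<psi> x \<nu>" by (simp add: c0_def)
    have "((\<lambda>\<rho>. (\<integral>y. f x (blow_up x \<rho> y) \<partial>H1_on K) / \<rho>) \<longlongrightarrow> (\<integral>t. f x (t *\<^sub>R rot \<nu>) \<partial>lborel)) (at_right 0)"
      by (rule approx_normal_tendsto[OF nx Kb f(1)]) (rule f(2))
    moreover have "filterlim (\<lambda>k. inverse (real (Suc k))) (at_right 0) sequentially"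
      by (intro filterlim_inverse_at_right_top[THEN filterlim_compose] filterlim_compose[OF filterlim_real_sequentially filterlim_Suc])
    ultimately have "(\<lambda>k. (\<integral>y. f x (blow_up x (inverse (real (Suc k))) y) \<partial>H1_on K) / inverse (real (Suc k)))
      \<longlonglongrightarrow> (\<integral>t. f x (t *\<^sub>R rot \<nu>) \<partial>lborel)"
      by (rule filterlim_compose)
    moreover have "(\<integral>y. f x (blow_up x (inverse (real (Suc k))) y) \<partial>H1_on K) / inverse (real (Suc k)) = J k x" for k
      using x by (simp add: J_def G_def blow_up_def divide_inverse mult.commute)
    ultimately show ?thesis by (simp add: I)
  qed
  \<comment> \<open>\<open>lim\<close> is unspecified where the sequence diverges; the clamp secures
    the bounds everywhere and leaves the value unchanged at points of \<open>K\<close> with a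
    normal.\<close>
  define h where "h x = max 0 (min c (lim (\<lambda>k. J k x) / c0))" for x
  show ?thesis
  proof (rule that)
    show "h \<in> borel_measurable borel" unfolding h_def by measurable
    show "0 \<le> h x" "h x \<le> c" for x using c by (auto simp: h_def)
    have "AE x in H1_on K. x \<in> K" using Kb by (simp add: AE_measure_restr)
    with AE_approx_normal[OF K] show "AE x in H1_on K. h x = \<psi> x (normal_at K x)"
    proof eventually_elim
      case (elim x)
      then have x: "x \<in> S" using S(2) by blast
      have "lim (\<lambda>k. J k x) = c0 * \<psi> x (normal_at K x)" using lim[OF x elim(1)] by (rule limI)
      moreover have "norm (normal_at K x) = 1" using elim(1) by (simp add: approx_normal_def)
      ultimately show ?case using bound[OF x, of "normal_at K x"] c0 by (simp add: h_def)
    qed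
  qed
qed

section \<open>Hausdorff convergence as mutual nearness\<close>

lemma diameter_open_pos:
  fixes \<Omega> :: "(real^2) set"
  assumes "open \<Omega>" "bounded \<Omega>" "\<Omega> \<noteq> {}"
  shows "0 < diameter \<Omega>"
proof -
  obtain x where "x \<in> \<Omega>" using assms(3) by auto
  then obtain e where e: "0 < e" "ball x e \<subseteq> \<Omega>" using assms(1) by (meson openE)
  have "diameter (ball x e) \<le> diameter \<Omega>" by (rule diameter_subset[OF e(2) assms(2)])
  then show ?thesis using e(1) by simp
qed

text \<open>By the convention for the empty set, the excess of a nonempty \<open>A\<close> over an
  empty \<open>B\<close> is \<open>diameter \<Omega>\<close>; a smaller excess forces
  \<open>B\<close> to be nonempty, and then the distance is attained.\<close>

lemma excess_less_near:
  assumes "compact A" "compact B" "excess \<Omega> A B < \<delta>" "\<delta> \<le> diameter \<Omega>" "a \<in> A"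
  shows "\<exists>b\<in>B. dist a b < \<delta>"
proof -
  have "bdd_above ((\<lambda>x. dist_set \<Omega> x B) ` A)"
  proof (cases "B = {}")
    case False
    have "compact ((\<lambda>x. infdist x B) ` A)" by (intro compact_continuous_image continuous_intros assms)
    then show ?thesis using False by (simp add: dist_set_def bounded_imp_bdd_above compact_imp_bounded)
  qed (auto simp: dist_set_def)
  then have le: "dist_set \<Omega> a B \<le> excess \<Omega> A B" using assms(5) by (auto simp: excess_def intro: cSUP_upper)
  then have "B \<noteq> {}" using assms(3,4) by (auto simp: dist_set_def)
  then obtain b where "b \<in> B" "infdist a B = dist a b"
    using infdist_attains_inf[OF compact_imp_closed[OF assms(2)]] by blast
  then show ?thesis using le assms(3) \<open>B \<noteq> {}\<close> by (intro bexI[of _ b]) (auto simp: dist_set_def)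
qed

lemma hausdorff_dist_near:
  assumes \<Omega>: "open \<Omega>" "bounded \<Omega>" "\<Omega> \<noteq> {}" and cpt: "\<And>n. compact (Kn n)" "compact K"
    and lim: "(\<lambda>n. hausdorff_dist \<Omega> (Kn n) K) \<longlonglongrightarrow> 0" and \<delta>: "0 < \<delta>"
  shows "\<forall>\<^sub>F n in sequentially. (\<forall>y\<in>Kn n. \<exists>z\<in>K. dist y z < \<delta>) \<and> (\<forall>z\<in>K. \<exists>y\<in>Kn n. dist z y < \<delta>)"
proof -
  define d where "d = min \<delta> (diameter \<Omega>)"
  have d: "0 < d" "d \<le> \<delta>" "d \<le> diameter \<Omega>" using \<delta> diameter_open_pos[OF \<Omega>] by (auto simp: d_def)
  from order_tendstoD(2)[OF lim d(1)] show ?thesis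
  proof eventually_elim
    case (elim n)
    then have "excess \<Omega> (Kn n) K < d" "excess \<Omega> K (Kn n) < d" by (auto simp: hausdorff_dist_def)
    then show ?case
      using excess_less_near[OF cpt(1)[of n] cpt(2) _ d(3)] excess_less_near[OF cpt(2) cpt(1)[of n] _ d(3)] d(2)
      by (meson less_le_trans)
  qed
qed

lemma surface_energy_eq_integral:
  assumes K: "compact K" "hausdorff1_outer K < \<infinity>"
    and h: "h \<in> borel_measurable borel" "\<And>x. 0 \<le> h x" "\<And>x. h x \<le> c"
    and hAE: "AE x in H1_on K. h x = \<phi> x (normal_at K x)"
  shows "surface_energy \<phi> K = ennreal (\<integral>x. h x \<partial>H1_on K)"
proof -
  have Kb: "K \<in> sets borel" using K(1) by (rule borel_compact)
  interpret M: finite_measure "H1_on K" by (rule finite_measure_H1_on[OF Kb K(2)])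
  have "AE x in hausdorff1. x \<in> K \<longrightarrow> h x = \<phi> x (normal_at K x)"
    using hAE Kb by (simp add: AE_measure_restr)
  then have "surface_energy \<phi> K = (\<integral>\<^sup>+x. ennreal (h x) * indicator K x \<partial>hausdorff1)"
    unfolding surface_energy_def by (intro nn_integral_cong_AE) (auto simp: indicator_def)
  also have "\<dots> = (\<integral>\<^sup>+x. ennreal (h x) \<partial>H1_on K)"
    using h(1) by (intro nn_integral_H1_on[OF Kb, symmetric]) auto
  also have "\<dots> = ennreal (\<integral>x. h x \<partial>H1_on K)"
    by (intro nn_integral_eq_integral M.integrable_const_bound[where B = c]) (use h in auto)
  finally show ?thesis .
qed

text \<open>\<open>S\<close> stands for the closed domain; its compactness makes the continuity of
  \<open>\<phi>\<close> uniform over unit vectors.\<close>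

locale sublinear_integrand =
  fixes S :: "(real^2) set" and \<phi> :: "real^2 \<Rightarrow> real^2 \<Rightarrow> real" and c1 c2 :: real
  assumes compact_S: "compact S"
    and cont: "continuous_on (S \<times> UNIV) (\<lambda>(x, \<nu>). \<phi> x \<nu>)"
    and hom: "\<And>x \<nu> t. x \<in> S \<Longrightarrow> 0 < t \<Longrightarrow> \<phi> x (t *\<^sub>R \<nu>) = t * \<phi> x \<nu>"
    and even: "\<And>x \<nu>. x \<in> S \<Longrightarrow> \<phi> x (- \<nu>) = \<phi> x \<nu>"
    and conv: "\<And>x. x \<in> S \<Longrightarrow> convex_on UNIV (\<phi> x)"
    and c1: "0 < c1" and c2: "0 < c2"
    and lower: "\<And>x \<nu>. x \<in> S \<Longrightarrow> c1 * norm \<nu> \<le> \<phi> x \<nu>"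
    and upper: "\<And>x \<nu>. x \<in> S \<Longrightarrow> \<phi> x \<nu> \<le> c2 * norm \<nu>"
begin

text \<open>A Borel representative of the integrand on \<open>K\<close>, bounded everywhere so that
  it is integrable against the finite measure \<open>H1_on K\<close>.\<close>

definition energy_density :: "(real^2) set \<Rightarrow> (real^2 \<Rightarrow> real) \<Rightarrow> bool" where
  "energy_density K h \<longleftrightarrow> h \<in> borel_measurable borel \<and> (\<forall>x. 0 \<le> h x \<and> h x \<le> c2) \<and>
    (AE x in H1_on K. h x = \<phi> x (normal_at K x))"

lemma energy_density_exists:
  assumes "compact K" "finite (components K)" "hausdorff1_outer K < \<infinity>" "K \<subseteq> S"
  shows "\<exists>h. energy_density K h"
proof -
  have bound: "0 \<le> \<phi> x \<nu> \<and> \<phi> x \<nu> \<le> c2 * norm \<nu>" if "x \<in> S" for x \<nu>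
    using order_trans[OF mult_nonneg_nonneg[OF less_imp_le[OF c1] norm_ge_zero] lower[OF that]] upper[OF that]
    by blast
  obtain h where "h \<in> borel_measurable borel" "\<And>x. 0 \<le> h x" "\<And>x. h x \<le> c2"
    "AE x in H1_on K. h x = \<phi> x (normal_at K x)"
    by (rule measurable_normal_integrand[OF assms(1-3) compact_imp_closed[OF compact_S] assms(4)
        cont hom even bound less_imp_le[OF c2]]) (assumption | rule that)+
  then show ?thesis unfolding energy_density_def by blast
qed

lemma uniform_modulus:
  assumes "0 < e"
  obtains d where "0 < d" "\<And>x y u. x \<in> S \<Longrightarrow> y \<in> S \<Longrightarrow> dist x y < d \<Longrightarrow> norm u = 1 \<Longrightarrow> \<phi> x u \<le> \<phi> y u + e"
proof -
  have "uniformly_continuous_on (S \<times> sphere 0 1) (\<lambda>(x, \<nu>). \<phi> x \<nu>)"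
    by (intro compact_uniformly_continuous continuous_on_subset[OF cont] compact_Times compact_S) auto
  then obtain d where d: "0 < d"
    "\<And>p q. p \<in> S \<times> sphere 0 1 \<Longrightarrow> q \<in> S \<times> sphere 0 1 \<Longrightarrow> dist q p < d \<Longrightarrow>
      dist ((\<lambda>(x, \<nu>). \<phi> x \<nu>) q) ((\<lambda>(x, \<nu>). \<phi> x \<nu>) p) < e"
    unfolding uniformly_continuous_on_def using assms by metis
  show ?thesis
  proof (rule that[OF d(1)])
    fix x y u :: "real^2" assume "x \<in> S" "y \<in> S" "dist x y < d" "norm u = 1"
    then show "\<phi> x u \<le> \<phi> y u + e"
      using d(2)[of "(x, u)" "(y, u)"] by (simp add: dist_Pair_Pair dist_commute dist_real_def abs_less_iff)
  qed
qed

text \<open>The Jacobian of the projection is \<open>\<bar>rot \<nu> \<bullet> rot p\<bar> = \<bar>p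
  \<bullet> \<nu>\<bar>\<close>, at most \<open>\<phi> x \<nu>\<close> with \<open>x\<close> frozen
  at the centre. Passing to \<open>\<phi> y \<nu>\<close> costs \<open>\<epsilon> * c1\<close>,
  which coercivity bounds by \<open>\<epsilon> * \<phi> y \<nu>\<close>; hence the factor
  \<open>1 + \<epsilon>\<close>.\<close>

lemma projection_le_energy:
  assumes K: "compact K" "finite (components K)" "hausdorff1_outer K < \<infinity>" "K \<subseteq> S"
    and h: "energy_density K h"
    and p: "\<And>v. \<bar>p \<bullet> v\<bar> \<le> \<phi> x v"
    and mod: "\<And>y u. y \<in> S \<Longrightarrow> dist x y < r \<Longrightarrow> norm u = 1 \<Longrightarrow> \<phi> x u \<le> \<phi> y u + \<epsilon> * c1" and \<epsilon>: "0 < \<epsilon>"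
  shows "hausdorff1_outer ((\<lambda>y. y \<bullet> rot p) ` (K \<inter> ball x r)) \<le> ennreal ((1 + \<epsilon>) * (\<integral>y. h y * indicator (ball x r) y \<partial>H1_on K))"
proof -
  have Kb: "K \<in> sets borel" using K(1) by (rule borel_compact)
  interpret M: finite_measure "H1_on K" by (rule finite_measure_H1_on[OF Kb K(3)])
  have hb [measurable]: "h \<in> borel_measurable borel" and h0: "\<And>x. 0 \<le> h x" "\<And>x. h x \<le> c2"
    and hAE: "AE x in H1_on K. h x = \<phi> x (normal_at K x)" using h by (auto simp: energy_density_def)
  obtain g where g: "g \<in> borel_measurable borel" "\<And>x. 0 \<le> g x" "\<And>x. g x \<le> norm p"
    "AE x in H1_on K. g x = \<bar>rot (normal_at K x) \<bullet> rot p\<bar>"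
  proof (rule measurable_normal_integrand[OF K(1-3), of UNIV "\<lambda>x \<nu>. \<bar>rot \<nu> \<bullet> rot p\<bar>" "norm p"])
    show "continuous_on (UNIV \<times> UNIV) (\<lambda>(x::real^2, \<nu>). \<bar>rot \<nu> \<bullet> rot p\<bar>)"
      unfolding case_prod_beta by (intro continuous_intros)
    show "0 \<le> \<bar>rot \<nu> \<bullet> rot p\<bar> \<and> \<bar>rot \<nu> \<bullet> rot p\<bar> \<le> norm p * norm \<nu>" for \<nu>
      using Cauchy_Schwarz_ineq2[of \<nu> p] by (simp add: mult.commute)
  qed (auto simp: abs_mult)
  note g(1)[measurable]
  have "hausdorff1_outer ((\<lambda>y. y \<bullet> rot p) ` (K \<inter> ball x r)) \<le> ennreal (\<integral>y. g y * indicator (ball x r) y \<partial>H1_on K)"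
    by (rule projection_le_integral[OF K(1-3) open_ball g])
  also have "\<dots> \<le> ennreal (\<integral>y. (1 + \<epsilon>) * (h y * indicator (ball x r) y) \<partial>H1_on K)"
  proof (intro ennreal_leI integral_mono_AE)
    have [measurable]: "ball x r \<in> sets borel" by simp
    show "integrable (H1_on K) (\<lambda>y. g y * indicator (ball x r) y)"
    proof (rule M.integrable_const_bound[where B = "norm p"])
      show "(\<lambda>y. g y * indicator (ball x r) y) \<in> borel_measurable (H1_on K)" by measurable
    qed (use g in \<open>auto simp: indicator_def\<close>)
    have "integrable (H1_on K) (\<lambda>y. h y * indicator (ball x r) y)"
    proof (rule M.integrable_const_bound[where B = c2])
      show "(\<lambda>y. h y * indicator (ball x r) y) \<in> borel_measurable (H1_on K)" by measurable
    qed (use h0 c2 in \<open>auto simp: indicator_def\<close>)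
    then show "integrable (H1_on K) (\<lambda>y. (1 + \<epsilon>) * (h y * indicator (ball x r) y))" by (rule integrable_mult_right)
    have "AE y in H1_on K. y \<in> K" using Kb by (simp add: AE_measure_restr)
    with g(4) hAE AE_approx_normal[OF K(1-3)]
    show "AE y in H1_on K. g y * indicator (ball x r) y \<le> (1 + \<epsilon>) * (h y * indicator (ball x r) y)"
    proof eventually_elim
      case (elim y)
      show ?case
      proof (cases "y \<in> ball x r")
        case True
        let ?\<nu> = "normal_at K y"
        have y: "y \<in> S" using elim(4) K(4) by blast
        have n: "norm ?\<nu> = 1" using elim(3) by (simp add: approx_normal_def)
        have "g y \<le> \<phi> x ?\<nu>" using elim(1) p[of ?\<nu>] by (simp add: inner_commute)
        also have "\<dots> \<le> \<phi> y ?\<nu> + \<epsilon> * c1" using mod[OF y _ n] True by simp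
        also have "\<epsilon> * c1 \<le> \<epsilon> * \<phi> y ?\<nu>" using lower[OF y, of ?\<nu>] n \<epsilon> by (intro mult_left_mono) auto
        finally show ?thesis using True elim(2) by (simp add: algebra_simps)
      qed simp
    qed
  qed
  finally show ?thesis by simp
qed

text \<open>The length of the projection of \<open>Kn n\<close> along \<open>rot p\<close> is almost
  \<open>2 * r * \<phi> x \<nu>\<close> from below and almost the energy in the ball from above. The
  upper density of \<open>K\<close> then exchanges \<open>2 * r\<close> for the mass of the
  ball.\<close>

lemma local_lower_bound:
  assumes K: "K \<in> sets borel" "hausdorff1_outer K < \<infinity>" "K \<subseteq> S" "x \<in> K"
    and nx: "approx_normal K x \<nu>" and ld: "lower_density_near K x"
    and ud: "\<And>e. 0 < e \<Longrightarrow> \<exists>\<eta>>0. \<forall>r. 0 < r \<longrightarrow> r < \<eta> \<longrightarrow> measure (H1_on K) (cball x r) \<le> (1 + e) * (2 * r)"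
    and Kn: "\<And>n. compact (Kn n)" "\<And>n. finite (components (Kn n))" "\<And>n. card (components (Kn n)) \<le> m"
      "\<And>n. hausdorff1_outer (Kn n) < \<infinity>" "\<And>n. Kn n \<subseteq> S"
    and hn: "\<And>n. energy_density (Kn n) (hn n)"
    and near: "\<And>\<delta>. 0 < \<delta> \<Longrightarrow> \<forall>\<^sub>F n in sequentially. (\<forall>y\<in>Kn n. \<exists>z\<in>K. dist y z < \<delta>) \<and> (\<forall>z\<in>K. \<exists>y\<in>Kn n. dist z y < \<delta>)"
    and \<epsilon>: "0 < \<epsilon>"
  shows "\<forall>\<^sub>F r in at_right 0. \<forall>\<^sub>F n in sequentially. \<phi> x \<nu> * measure (H1_on K) (cball x r)
    \<le> (1 + \<epsilon>) * (\<integral>y. hn n y * indicator (ball x r) y \<partial>H1_on (Kn n)) + \<epsilon> * measure (H1_on K) (cball x r)"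
proof -
  have xS: "x \<in> S" using K(3,4) by blast
  have \<nu>: "norm \<nu> = 1" using nx by (simp add: approx_normal_def)
  obtain p where p: "p \<bullet> \<nu> = \<phi> x \<nu>" "\<And>v. \<bar>p \<bullet> v\<bar> \<le> \<phi> x v"
    using even_sublinear_support[OF conv[OF xS] hom[OF xS] even[OF xS] \<nu>] by metis
  define \<alpha> where "\<alpha> = \<phi> x \<nu>"
  have \<alpha>: "c1 \<le> \<alpha>" "\<alpha> \<le> c2" using lower[OF xS, of \<nu>] upper[OF xS, of \<nu>] \<nu> by (auto simp: \<alpha>_def)
  then have \<alpha>0: "0 < \<alpha>" using c1 by simp
  have \<alpha>p: "\<alpha> = rot \<nu> \<bullet> rot p" using p(1) by (simp add: \<alpha>_def inner_commute)
  have np: "norm p \<le> c2"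
  proof -
    have "norm p * norm p \<le> c2 * norm p"
      using p(2)[of p] upper[OF xS, of p] by (simp add: dot_square_norm power2_eq_square)
    then show ?thesis using c2 by (cases "p = 0") auto
  qed
  \<comment> \<open>The total error is \<open>e * A * r\<close>: the first summand collects the
    density surplus \<open>e\<close> and the shrinking \<open>\<kappa>\<close>, the second the
    \<open>m + 1\<close> gaps.\<close>
  define A where "A = 2 * c2 * (2 + 2 * c2 / c1) + real (m + 1) * (2 * c2)"
  have A: "0 < A" unfolding A_def using c1 c2 by (intro add_pos_nonneg mult_pos_pos) auto
  \<comment> \<open>The second bound ensures \<open>\<kappa> \<le> 1\<close>.\<close>
  define e where "e = min (\<epsilon> / A) (1 / (2 * c2 / c1 + 1))"
  have q: "0 < 2 * c2 / c1 + 1" using c1 c2 by (simp add: add_pos_pos)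
  have e: "0 < e" "e * A \<le> \<epsilon>" "e * (2 * c2 / c1 + 1) \<le> 1"
  proof -
    show "0 < e" using \<epsilon> A q by (simp add: e_def)
    have "e \<le> \<epsilon> / A" "e \<le> 1 / (2 * c2 / c1 + 1)" by (auto simp: e_def)
    then show "e * A \<le> \<epsilon>" "e * (2 * c2 / c1 + 1) \<le> 1"
      using A q by (simp_all only: pos_le_divide_eq)
  qed
  define \<kappa> where "\<kappa> = e * (2 * norm (rot p) / \<alpha> + 1)"
  have \<kappa>: "\<kappa> \<le> e * (2 * c2 / c1 + 1)"
  proof -
    have "2 * norm p / \<alpha> \<le> 2 * c2 / c1" using np \<alpha> c1 c2 by (intro frac_le) auto
    then show ?thesis unfolding \<kappa>_def using e(1) by (intro mult_left_mono) auto
  qed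
  obtain d where d: "0 < d" "\<And>x y u. x \<in> S \<Longrightarrow> y \<in> S \<Longrightarrow> dist x y < d \<Longrightarrow> norm u = 1 \<Longrightarrow> \<phi> x u \<le> \<phi> y u + \<epsilon> * c1"
    using uniform_modulus[of "\<epsilon> * c1"] \<epsilon> c1 by (metis mult_pos_pos)
  obtain \<eta>1 where \<eta>1: "0 < \<eta>1" "\<And>r. 0 < r \<Longrightarrow> r < \<eta>1 \<Longrightarrow> measure (H1_on K) (cball x r) \<le> (1 + e) * (2 * r)"
    using ud[OF e(1)] by blast
  obtain \<eta>2 where \<eta>2: "0 < \<eta>2" "\<And>r. 0 < r \<Longrightarrow> r < \<eta>2 \<Longrightarrow> ennreal r \<le> hausdorff1_outer (K \<inter> cball x r)"
    using ld K(4) unfolding lower_density_near_def by (metis IntI centre_in_ball)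
  have e4: "0 < e / 4" "0 < e / 2" using e(1) by auto
  \<comment> \<open>A point of \<open>K\<close> close to a point of \<open>Kn n\<close> in the ball
    may lie outside that ball, so the strip is taken at radius \<open>2 * r\<close>. The constant
    \<open>e / 4\<close> gives \<open>e * r / 2\<close> there and leaves the other half for the
    distance between the two points.\<close>
  have "filterlim (\<lambda>r::real. 2 * r) (at_right 0) (at_right 0)"
    by (rule filterlim_at_withinI) (auto intro!: tendsto_eq_intros eventually_at_rightI[of 0 1])
  from eventually_compose_filterlim[OF approx_normal_strip[OF K(1,2) nx ld e4(1)] this]
  have strip: "\<forall>\<^sub>F r in at_right 0. \<forall>y\<in>K \<inter> cball x (2 * r). \<bar>(y - x) \<bullet> \<nu>\<bar> \<le> e / 4 * (2 * r)" .
  have "\<forall>\<^sub>F r in at_right 0. r \<in> {0<..<min d (min \<eta>1 \<eta>2)}"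
    using d(1) \<eta>1(1) \<eta>2(1) by (intro eventually_at_right_real) simp
  with strip approx_normal_line_near[OF K(1) nx e4(2)] show ?thesis
  proof eventually_elim
    case (elim r)
    then have r: "0 < r" "r < d" "r < \<eta>1" "r < \<eta>2" by auto
    let ?m = "measure (H1_on K) (cball x r)"
    have mr: "r \<le> ?m"
      using \<eta>2(2)[OF r(1,4)] hausdorff1_outer_eq_measure[OF K(1,2), of "cball x r"]
      by (simp add: ennreal_le_iff[OF measure_nonneg])
    have er: "0 < min (e * r / 2) r" using e(1) r(1) by simp
    from near[OF this] show ?case
    proof eventually_elim
      case (elim n)
      let ?I = "\<integral>y. hn n y * indicator (ball x r) y \<partial>H1_on (Kn n)"
      have "ennreal (2 * \<alpha> * r * (1 - \<kappa>) - real (m + 1) * (2 * norm (rot p) * e * r))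
        \<le> hausdorff1_outer ((\<lambda>y. y \<bullet> rot p) ` (Kn n \<inter> ball x r))"
      proof (rule projection_ge_near_line[OF Kn(1-3) \<nu> \<alpha>p \<alpha>0 r(1) e(1) _ _ \<kappa>_def])
        fix y assume y: "y \<in> Kn n" "y \<in> cball x r"
        then obtain z where z: "z \<in> K" "dist y z < e * r / 2" "dist y z < r" using elim by force
        have "z \<in> cball x (2 * r)" using y(2) z(3) dist_triangle[of x z y] by simp
        then have "\<bar>(z - x) \<bullet> \<nu>\<bar> \<le> e / 4 * (2 * r)" using z(1) \<open>\<forall>y\<in>K \<inter> cball x (2 * r). _ y\<close> by blast
        moreover have "\<bar>(y - z) \<bullet> \<nu>\<bar> \<le> e * r / 2"
          using Cauchy_Schwarz_ineq2[of "y - z" \<nu>] \<nu> z(2) by (simp add: dist_norm)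
        moreover have "(y - x) \<bullet> \<nu> = (y - z) \<bullet> \<nu> + (z - x) \<bullet> \<nu>" by (simp add: inner_diff_left)
        ultimately show "\<bar>(y - x) \<bullet> \<nu>\<bar> \<le> e * r" by linarith
      next
        fix t :: real assume "t \<in> {-1..1}"
        then obtain z where z: "z \<in> K" "dist z (x + (r * t) *\<^sub>R rot \<nu>) \<le> e / 2 * r"
          using \<open>\<forall>t\<in>{-1..1}. _ t\<close> by blast
        then obtain y where y: "y \<in> Kn n" "dist z y < e * r / 2" using elim by force
        have "dist y (x + (r * t) *\<^sub>R rot \<nu>) \<le> dist z y + dist z (x + (r * t) *\<^sub>R rot \<nu>)"
          by (rule dist_triangle3)
        then show "\<exists>y\<in>Kn n. dist y (x + (r * t) *\<^sub>R rot \<nu>) \<le> e * r" using y z(2) by (intro bexI[of _ y]) auto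
      next
        show "\<kappa> \<le> 1" using \<kappa> e(3) by linarith
      qed
      also have "\<dots> \<le> ennreal ((1 + \<epsilon>) * ?I)"
        by (rule projection_le_energy[OF Kn(1,2,4,5) hn p(2) d(2)[OF xS] \<epsilon>]) (use r in auto)
      finally have "ennreal (2 * \<alpha> * r * (1 - \<kappa>) - real (m + 1) * (2 * norm (rot p) * e * r)) \<le> ennreal ((1 + \<epsilon>) * ?I)" .
      moreover have "0 \<le> (1 + \<epsilon>) * ?I"
        using hn[of n] \<epsilon> by (intro mult_nonneg_nonneg integral_nonneg_AE) (auto simp: energy_density_def)
      ultimately have *: "2 * \<alpha> * r * (1 - \<kappa>) - real (m + 1) * (2 * norm p * e * r) \<le> (1 + \<epsilon>) * ?I"
        by (simp add: ennreal_le_iff)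
      have "\<alpha> * ?m \<le> \<alpha> * ((1 + e) * (2 * r))" using \<eta>1(2)[OF r(1,3)] \<alpha>0 by (intro mult_left_mono) auto
      also have "\<dots> = (2 * \<alpha> * r * (1 - \<kappa>) - real (m + 1) * (2 * norm p * e * r))
        + (2 * \<alpha> * (e + \<kappa>) + real (m + 1) * (2 * norm p * e)) * r" by (simp add: algebra_simps)
      also have "\<dots> \<le> (1 + \<epsilon>) * ?I + (e * A) * r"
      proof (intro add_mono * mult_right_mono)
        have "2 * \<alpha> * (e + \<kappa>) \<le> 2 * c2 * (e + e * (2 * c2 / c1 + 1))"
          using \<alpha>(2) \<kappa> c2 e(1) \<alpha>0 by (intro mult_mono) (auto simp: \<kappa>_def)
        moreover have "real (m + 1) * (2 * norm p * e) \<le> real (m + 1) * (2 * c2 * e)"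
          using np e(1) by (intro mult_left_mono mult_right_mono) auto
        ultimately show "2 * \<alpha> * (e + \<kappa>) + real (m + 1) * (2 * norm p * e) \<le> e * A"
          by (simp add: A_def algebra_simps)
      qed (use r in simp)
      \<comment> \<open>The lower density bound \<open>r \<le> ?m\<close> turns an error in the
        radius into an error in the mass.\<close>
      also have "(e * A) * r \<le> \<epsilon> * ?m" using e(2) mr r(1) \<epsilon> by (intro mult_mono) auto
      finally show ?case by (simp add: \<alpha>_def)
    qed
  qed
qed

text \<open>One finite family of balls, chosen for \<open>K\<close>, carries nearly the whole
  integral of \<open>h\<close>. The local inequalities hold on all of them for large
  \<open>n\<close>, and disjointness makes the local energies add up to at most the total.\<close>

theorem energy_lower_semicontinuous:
  assumes K: "compact K" "finite (components K)" "hausdorff1_outer K < \<infinity>" "K \<subseteq> S" and h: "energy_density K h"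
    and Kn: "\<And>n. compact (Kn n)" "\<And>n. finite (components (Kn n))" "\<And>n. card (components (Kn n)) \<le> m"
      "\<And>n. hausdorff1_outer (Kn n) < \<infinity>" "\<And>n. Kn n \<subseteq> S"
    and hn: "\<And>n. energy_density (Kn n) (hn n)"
    and near: "\<And>\<delta>. 0 < \<delta> \<Longrightarrow> \<forall>\<^sub>F n in sequentially. (\<forall>y\<in>Kn n. \<exists>z\<in>K. dist y z < \<delta>) \<and> (\<forall>z\<in>K. \<exists>y\<in>Kn n. dist z y < \<delta>)"
    and e: "0 < e"
  shows "\<forall>\<^sub>F n in sequentially. (\<integral>x. h x \<partial>H1_on K) - e \<le> (\<integral>x. hn n x \<partial>H1_on (Kn n))"
proof -
  have Kb: "K \<in> sets borel" using K(1) by (rule borel_compact)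
  interpret M: finite_measure "H1_on K" by (rule finite_measure_H1_on[OF Kb K(3)])
  have hb: "h \<in> borel_measurable borel" and h0: "\<And>x. 0 \<le> h x" "\<And>x. h x \<le> c2"
    and hAE: "AE x in H1_on K. h x = \<phi> x (normal_at K x)" using h by (auto simp: energy_density_def)
  let ?m = "measure (H1_on K)"
  let ?A = "\<integral>x. h x \<partial>H1_on K"
  have A0: "0 \<le> ?A" using h0(1) by (intro integral_nonneg_AE) auto
  define \<epsilon> where "\<epsilon> = e / (?A + ?m UNIV + 1)"
  have den: "0 < ?A + ?m UNIV + 1" using A0 measure_nonneg[of "H1_on K" UNIV] by linarith
  have \<epsilon>: "0 < \<epsilon>" "\<epsilon> * (?A + ?m UNIV + 1) = e" using e den by (simp_all add: \<epsilon>_def)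
  let ?I = "\<lambda>n x r. \<integral>y. hn n y * indicator (ball x r) y \<partial>H1_on (Kn n)"
  define F where "F = {(x, r). 0 < r \<and> ennreal r \<le> hausdorff1_outer (K \<inter> cball x r) \<and>
    (\<forall>\<^sub>F n in sequentially. h x * ?m (cball x r) \<le> (1 + \<epsilon>) * ?I n x r + \<epsilon> * ?m (cball x r))}"
  have "AE x in H1_on K. x \<in> K" using Kb by (simp add: AE_measure_restr)
  with AE_approx_normal[OF K(1-3)] AE_lower_density_near[OF K(1,2)] AE_upper_density_le_1[OF Kb K(3)] hAE
  have fine: "AE x in H1_on K. \<forall>\<eta>>0. \<exists>r<\<eta>. (x, r) \<in> F"
  proof eventually_elim
    case (elim x)
    show ?case
    proof (intro allI impI)
      fix \<eta> :: real assume \<eta>: "0 < \<eta>"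
      obtain \<eta>0 where \<eta>0: "0 < \<eta>0" "\<And>r. 0 < r \<Longrightarrow> r < \<eta>0 \<Longrightarrow> ennreal r \<le> hausdorff1_outer (K \<inter> cball x r)"
        using elim(2,5) unfolding lower_density_near_def by (metis IntI centre_in_ball)
      have "\<forall>\<^sub>F r in at_right 0. r \<in> {0<..<min \<eta> \<eta>0}"
        using \<eta> \<eta>0(1) by (intro eventually_at_right_real) simp
      moreover have "\<forall>\<^sub>F r in at_right 0. \<forall>\<^sub>F n in sequentially. \<phi> x (normal_at K x) * ?m (cball x r)
        \<le> (1 + \<epsilon>) * ?I n x r + \<epsilon> * ?m (cball x r)"
        by (rule local_lower_bound[OF Kb K(3,4) elim(5,1,2) _ Kn hn _ \<epsilon>(1)]) (use elim(3) in blast, rule near)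
      ultimately have "\<forall>\<^sub>F r in at_right 0. r < \<eta> \<and> (x, r) \<in> F"
      proof eventually_elim
        case (elim r)
        then show ?case using \<eta>0(2)[of r] by (simp add: F_def \<open>h x = _\<close>)
      qed
      then show "\<exists>r<\<eta>. (x, r) \<in> F" using eventually_happens'[OF trivial_limit_at_right_real] by blast
    qed
  qed
  obtain C where C: "finite C" "C \<subseteq> F"
    "pairwise (\<lambda>p q. disjnt (cball (fst p) (snd p)) (cball (fst q) (snd q))) C"
    "\<bar>(\<integral>y. h y * indicator UNIV y \<partial>H1_on K) - (\<Sum>p\<in>C. h (fst p) * ?m (cball (fst p) (snd p)))\<bar> \<le> \<epsilon>"
    by (rule vitali_riemann_sum[OF Kb K(3) hb h0 open_UNIV _ fine \<epsilon>(1)]) (auto simp: F_def)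
  let ?B = "\<lambda>p. cball (fst p) (snd p)"
  have msum: "(\<Sum>p\<in>C. ?m (?B p)) \<le> ?m UNIV"
  proof -
    have "(\<Sum>p\<in>C. ?m (?B p)) = ?m (\<Union>p\<in>C. ?B p)"
      using C(1,3) by (intro M.finite_measure_finite_Union[symmetric])
        (auto simp: disjoint_family_on_def pairwise_def disjnt_def)
    also have "\<dots> \<le> ?m UNIV" by (rule M.finite_measure_mono) auto
    finally show ?thesis .
  qed
  have Isum: "(\<Sum>p\<in>C. ?I n (fst p) (snd p)) \<le> (\<integral>x. hn n x \<partial>H1_on (Kn n))" for n
  proof -
    have Knb: "Kn n \<in> sets borel" using Kn(1) by (rule borel_compact)
    interpret N: finite_measure "H1_on (Kn n)" by (rule finite_measure_H1_on[OF Knb Kn(4)])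
    have hnb [measurable]: "hn n \<in> borel_measurable borel" and hn0: "\<And>x. 0 \<le> hn n x" "\<And>x. hn n x \<le> c2"
      using hn[of n] by (auto simp: energy_density_def)
    have int: "integrable (H1_on (Kn n)) (\<lambda>y. hn n y * indicator (ball (fst p) (snd p)) y)" for p
    proof (rule N.integrable_const_bound[where B = c2])
      have [measurable]: "ball (fst p) (snd p) \<in> sets borel" by simp
      show "(\<lambda>y. hn n y * indicator (ball (fst p) (snd p)) y) \<in> borel_measurable (H1_on (Kn n))" by measurable
    qed (use hn0 c2 in \<open>auto simp: indicator_def\<close>)
    have "(\<Sum>p\<in>C. ?I n (fst p) (snd p)) = (\<integral>y. (\<Sum>p\<in>C. hn n y * indicator (ball (fst p) (snd p)) y) \<partial>H1_on (Kn n))"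
      by (rule Bochner_Integration.integral_sum[symmetric]) (rule int)
    also have "\<dots> \<le> (\<integral>y. hn n y \<partial>H1_on (Kn n))"
    proof (rule integral_mono)
      show "integrable (H1_on (Kn n)) (\<lambda>y. \<Sum>p\<in>C. hn n y * indicator (ball (fst p) (snd p)) y)"
        by (rule Bochner_Integration.integrable_sum) (rule int)
      show "integrable (H1_on (Kn n)) (hn n)"
        by (rule N.integrable_const_bound[where B = c2]) (use hn0 in auto)
      fix y
      have "disjoint_family_on (\<lambda>p. ball (fst p) (snd p)) C"
        unfolding disjoint_family_on_def
      proof (intro ballI impI)
        fix p q assume "p \<in> C" "q \<in> C" "p \<noteq> q"
        then have "disjnt (?B p) (?B q)" using C(3) by (auto simp: pairwise_def)
        then show "ball (fst p) (snd p) \<inter> ball (fst q) (snd q) = {}"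
          using ball_subset_cball unfolding disjnt_def by blast
      qed
      then have "(\<Sum>p\<in>C. indicator (ball (fst p) (snd p)) y :: real) = indicator (\<Union>p\<in>C. ball (fst p) (snd p)) y"
        by (intro indicator_UN_disjoint[symmetric] C(1))
      then show "(\<Sum>p\<in>C. hn n y * indicator (ball (fst p) (snd p)) y) \<le> hn n y"
        using hn0(1)[of y] by (simp add: sum_distrib_left[symmetric] indicator_def)
    qed
    finally show ?thesis .
  qed
  have "\<forall>\<^sub>F n in sequentially. \<forall>p\<in>C. h (fst p) * ?m (?B p) \<le> (1 + \<epsilon>) * ?I n (fst p) (snd p) + \<epsilon> * ?m (?B p)"
    using C(2) by (intro eventually_ball_finite C(1)) (auto simp: F_def)
  then show ?thesis
  proof eventually_elim
    case (elim n)
    let ?E = "\<integral>x. hn n x \<partial>H1_on (Kn n)"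
    have "?A \<le> (\<Sum>p\<in>C. h (fst p) * ?m (?B p)) + \<epsilon>" using C(4) by (simp add: abs_le_iff)
    also have "(\<Sum>p\<in>C. h (fst p) * ?m (?B p)) \<le> (\<Sum>p\<in>C. (1 + \<epsilon>) * ?I n (fst p) (snd p) + \<epsilon> * ?m (?B p))"
      using elim by (intro sum_mono) blast
    also have "\<dots> = (1 + \<epsilon>) * (\<Sum>p\<in>C. ?I n (fst p) (snd p)) + \<epsilon> * (\<Sum>p\<in>C. ?m (?B p))"
      by (simp add: sum.distrib sum_distrib_left)
    also have "\<dots> \<le> (1 + \<epsilon>) * ?E + \<epsilon> * ?m UNIV"
      using Isum[of n] msum \<epsilon>(1) by (intro add_mono mult_left_mono) auto
    finally have *: "?A \<le> (1 + \<epsilon>) * ?E + \<epsilon> * ?m UNIV + \<epsilon>" by simp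
    show ?case
    \<comment> \<open>The energies of the sequence need not be bounded. In the nontrivial case
      \<open>?E\<close> is below \<open>?A\<close>, so the factor \<open>1 + \<epsilon>\<close>
      costs at most \<open>\<epsilon> * ?A\<close>.\<close>
    proof (cases "?A \<le> ?E")
      case False
      then have "\<epsilon> * ?E \<le> \<epsilon> * ?A" using \<epsilon>(1) by (intro mult_left_mono) auto
      then show ?thesis using * \<epsilon>(2) by (simp add: algebra_simps)
    qed (use e in simp)
  qed
qed

end

theorem theorem3p1:
  fixes \<Omega> :: "(real^2) set" and \<phi> :: "real^2 \<Rightarrow> real^2 \<Rightarrow> real"
    and c1 c2 :: real and m :: nat
  assumes "open \<Omega>" and "bounded \<Omega>" and "lipschitz_boundary \<Omega>"
    and "continuous_on (closure \<Omega> \<times> UNIV) (\<lambda>(x, \<nu>). \<phi> x \<nu>)"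
    and "\<And>x \<nu>. x \<in> closure \<Omega> \<Longrightarrow> 0 \<le> \<phi> x \<nu>"
    and "\<And>x \<nu> t. x \<in> closure \<Omega> \<Longrightarrow> 0 < t \<Longrightarrow> \<phi> x (t *\<^sub>R \<nu>) = t * \<phi> x \<nu>"
    and "\<And>x \<nu>. x \<in> closure \<Omega> \<Longrightarrow> \<phi> x (- \<nu>) = \<phi> x \<nu>"
    and "\<And>x. x \<in> closure \<Omega> \<Longrightarrow> convex_on UNIV (\<phi> x)"
    and "0 < c1" and "0 < c2"
    and "\<And>x \<nu>. x \<in> closure \<Omega> \<Longrightarrow> c1 * norm \<nu> \<le> \<phi> x \<nu> \<and> \<phi> x \<nu> \<le> c2 * norm \<nu>"
    and "1 \<le> m"
  shows "(\<forall>K \<in> Kmf m \<Omega>. surface_energy \<phi> K < \<infinity>) \<and>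
    (\<forall>Kn K. (\<forall>n::nat. Kn n \<in> Kmf m \<Omega>) \<longrightarrow> K \<in> Kmf m \<Omega> \<longrightarrow>
       (\<lambda>n. hausdorff_dist \<Omega> (Kn n) K) \<longlonglongrightarrow> 0 \<longrightarrow>
       surface_energy \<phi> K \<le> liminf (\<lambda>n. surface_energy \<phi> (Kn n)))"
proof -
  interpret sublinear_integrand "closure \<Omega>" \<phi> c1 c2
    by unfold_locales (use assms in auto)
  have Kmf: "compact K" "finite (components K)" "card (components K) \<le> m" "hausdorff1_outer K < \<infinity>" "K \<subseteq> closure \<Omega>"
    if "K \<in> Kmf m \<Omega>" for K
    using that by (auto simp: Kmf_def emeasure_hausdorff1 borel_compact)
  have rep: "\<exists>h. energy_density K h \<and> surface_energy \<phi> K = ennreal (\<integral>x. h x \<partial>H1_on K)" if K: "K \<in> Kmf m \<Omega>" for K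
  proof -
    obtain h where h: "energy_density K h" using energy_density_exists[OF Kmf(1,2,4,5)[OF K]] by blast
    then have "surface_energy \<phi> K = ennreal (\<integral>x. h x \<partial>H1_on K)"
      by (intro surface_energy_eq_integral[OF Kmf(1,4)[OF K], of h c2]) (auto simp: energy_density_def)
    with h show ?thesis by blast
  qed
  have "surface_energy \<phi> K \<le> liminf (\<lambda>n. surface_energy \<phi> (Kn n))"
    if Kn: "\<And>n. Kn n \<in> Kmf m \<Omega>" and K: "K \<in> Kmf m \<Omega>"
      and lim: "(\<lambda>n. hausdorff_dist \<Omega> (Kn n) K) \<longlonglongrightarrow> 0" for Kn K
  \<comment> \<open>For empty \<open>\<Omega>\<close> the diameter is 0 and small Hausdorff distance
    says nothing about nearness, but \<open>K\<close> is then empty.\<close>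
  proof (cases "\<Omega> = {}")
    case True
    then have "K = {}" using Kmf(5)[OF K] by simp
    then show ?thesis by (simp add: surface_energy_def)
  next
    case False
    obtain h where h: "energy_density K h" "surface_energy \<phi> K = ennreal (\<integral>x. h x \<partial>H1_on K)"
      using rep[OF K] by blast
    have "\<forall>n. \<exists>h. energy_density (Kn n) h \<and> surface_energy \<phi> (Kn n) = ennreal (\<integral>x. h x \<partial>H1_on (Kn n))"
      using rep[OF Kn] by blast
    then obtain hn where hn: "\<And>n. energy_density (Kn n) (hn n)"
      "\<And>n. surface_energy \<phi> (Kn n) = ennreal (\<integral>x. hn n x \<partial>H1_on (Kn n))" by metis
    show ?thesis
    proof (rule ennreal_le_epsilon)
      fix e :: real assume e: "0 < e"
      have "\<forall>\<^sub>F n in sequentially. (\<integral>x. h x \<partial>H1_on K) - e \<le> (\<integral>x. hn n x \<partial>H1_on (Kn n))"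
        by (rule energy_lower_semicontinuous[OF Kmf(1,2,4,5)[OF K] h(1) Kmf[OF Kn] hn(1) _ e])
          (rule hausdorff_dist_near[OF assms(1,2) False Kmf(1)[OF Kn] Kmf(1)[OF K] lim])
      then have "\<forall>\<^sub>F n in sequentially. ennreal ((\<integral>x. h x \<partial>H1_on K) - e) \<le> surface_energy \<phi> (Kn n)"
        by eventually_elim (simp add: hn(2) ennreal_leI)
      then have "ennreal ((\<integral>x. h x \<partial>H1_on K) - e) \<le> liminf (\<lambda>n. surface_energy \<phi> (Kn n))"
        by (rule Liminf_bounded)
      then have "ennreal ((\<integral>x. h x \<partial>H1_on K) - e) + ennreal e \<le> liminf (\<lambda>n. surface_energy \<phi> (Kn n)) + ennreal e"
        by (rule add_right_mono)
      \<comment> \<open>If \<open>e\<close> exceeds the integral, the difference becomes 0 in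
        \<open>ennreal\<close> and \<open>e\<close> alone is large enough.\<close>
      moreover have "surface_energy \<phi> K \<le> ennreal ((\<integral>x. h x \<partial>H1_on K) - e) + ennreal e"
        unfolding h(2) using e
        by (cases "e \<le> (\<integral>x. h x \<partial>H1_on K)")
          (auto simp: ennreal_plus[symmetric] ennreal_neg intro: ennreal_leI simp del: ennreal_plus)
      ultimately show "surface_energy \<phi> K \<le> liminf (\<lambda>n. surface_energy \<phi> (Kn n)) + ennreal e"
        by (rule order_trans[rotated])
    qed
  qed
  moreover have "surface_energy \<phi> K < \<infinity>" if "K \<in> Kmf m \<Omega>" for K
    using rep[OF that] by auto
  ultimately show ?thesis by blast
qed

end
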